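(* The problems of listing the maximal induced chordal subgraphs and the maximal connected induced chordal subgraphs of a graph $G$ are proximity searchable, and each can be solved (every solution output exactly once) with $O(m^2n)$ time delay.
   Context: $G$ is a simple undirected graph with $n$ vertices and $m$ edges (isolated vertices disregarded). A graph is chordal if every cycle of length greater than 3 has a chord. A maximal (connected) induced chordal subgraph is an inclusion-maximal $S\subseteq V(G)$ such that $G[S]$ is chordal (and connected, maximality then being among such connected sets). A listing problem with universe $\mathcal{U}$ (here $V(G)$) and set $\mathcal{S}$ of solutions to list is proximity searchable if there exist $\tilde{\cap}:\mathcal{S}\times\mathcal{S}\to 2^{\mathcal{U}}$ and $\mathrm{neighbors}:\mathcal{S}\to 2^{\mathcal{S}}$ such that one solution can be found in time polynomial in $|\mathcal{U}|$, $\mathrm{neighbors}$ is computable in time polynomial in $|\mathcal{U}|$, and for any two distinct $S,S^*\in\mathcal{S}$ some $S'\in\mathrm{neighbors}(S)$ satisfies $|S'\,\tilde{\cap}\,S^*|>|S\,\tilde{\cap}\,S^*|$. Delay is the maximum time before the first output, between consecutive outputs, and after the last output. *)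

theory Defs
  imports Main "HOL-Computational_Algebra.Polynomial"
begin

section \<open>Graphs\<close>

text \<open>A simple undirected graph is given by its vertex set and its set of edges,
  which are two-element sets of vertices.\<close>

definition induced_edges :: "'a set set \<Rightarrow> 'a set \<Rightarrow> 'a set set" where
  "induced_edges E S = {e \<in> E. e \<subseteq> S}"

definition cycle_edges :: "'a list \<Rightarrow> 'a set set" where
  "cycle_edges cs = {{cs ! i, cs ! (Suc i mod length cs)} | i. i < length cs}"

definition is_cycle :: "'a set set \<Rightarrow> 'a list \<Rightarrow> bool" where
  "is_cycle E cs \<longleftrightarrow> length cs \<ge> 3 \<and> distinct cs \<and> cycle_edges cs \<subseteq> E"

definition is_chord :: "'a set set \<Rightarrow> 'a list \<Rightarrow> 'a set \<Rightarrow> bool" where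
  "is_chord E cs e \<longleftrightarrow> e \<in> E \<and> e \<subseteq> set cs \<and> e \<notin> cycle_edges cs"

definition chordal :: "'a set set \<Rightarrow> bool" where
  "chordal E \<longleftrightarrow> (\<forall>cs. is_cycle E cs \<and> length cs > 3 \<longrightarrow> (\<exists>e. is_chord E cs e))"

text \<open>The empty set counts as connected. This only matters for the graph without
  vertices: in every other graph the empty set is not maximal.\<close>

definition connected_graph :: "'a set \<Rightarrow> 'a set set \<Rightarrow> bool" where
  "connected_graph S E \<longleftrightarrow>
     (\<forall>u\<in>S. \<forall>v\<in>S. (u, v) \<in> {(x, y). x \<in> S \<and> y \<in> S \<and> {x, y} \<in> E}\<^sup>*)"

definition induced_chordal :: "'a set \<Rightarrow> 'a set set \<Rightarrow> 'a set \<Rightarrow> bool" where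
  "induced_chordal V E S \<longleftrightarrow> S \<subseteq> V \<and> chordal (induced_edges E S)"

definition connected_induced_chordal :: "'a set \<Rightarrow> 'a set set \<Rightarrow> 'a set \<Rightarrow> bool" where
  "connected_induced_chordal V E S \<longleftrightarrow>
     induced_chordal V E S \<and> connected_graph S (induced_edges E S)"

definition inclusion_maximal :: "('a set \<Rightarrow> bool) \<Rightarrow> 'a set \<Rightarrow> bool" where
  "inclusion_maximal Q S \<longleftrightarrow> Q S \<and> (\<forall>T. Q T \<and> S \<subseteq> T \<longrightarrow> T = S)"


section \<open>Random access machine\<close>

text \<open>
  A uniform-cost RAM with addition and (truncated) subtraction, without multiplication,
  in structured form. A program has finitely many scalar registers and arrays (finitely
  many arrays can be interleaved in one memory). Every executed assignment, test or output
  costs one unit; as the expressions occurring in a program have fixed size, this agrees up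
  to a constant factor with charging every single operation.
\<close>

datatype aexp =
    Const nat
  | Var string
  | Get string aexp
  | Plus aexp aexp
  | Minus aexp aexp

datatype bexp =
    Eq aexp aexp
  | Less aexp aexp
  | Not bexp
  | And bexp bexp

text \<open>\<open>Out e\<close> writes one word to the output; \<open>Close\<close> marks the end of the current output item.\<close>

datatype com =
    Skip
  | Assign string aexp
  | Put string aexp aexp
  | Out aexp
  | Close
  | Seq com com
  | If bexp com com
  | While bexp com

record state =
  reg :: "string \<Rightarrow> nat"
  arr :: "string \<Rightarrow> nat \<Rightarrow> nat"

primrec aval :: "aexp \<Rightarrow> state \<Rightarrow> nat" where
  "aval (Const k) s = k"
| "aval (Var x) s = reg s x"
| "aval (Get a e) s = arr s a (aval e s)"
| "aval (Plus e f) s = aval e s + aval f s"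
| "aval (Minus e f) s = aval e s - aval f s"

primrec bval :: "bexp \<Rightarrow> state \<Rightarrow> bool" where
  "bval (Eq e f) s \<longleftrightarrow> aval e s = aval f s"
| "bval (Less e f) s \<longleftrightarrow> aval e s < aval f s"
| "bval (Not b) s \<longleftrightarrow> \<not> bval b s"
| "bval (And b c) s \<longleftrightarrow> bval b s \<and> bval c s"

text \<open>The trace of an execution has one event per unit of time.\<close>

datatype event = Step | Word nat | End

inductive exec :: "com \<Rightarrow> state \<Rightarrow> event list \<Rightarrow> state \<Rightarrow> bool" where
  Skip: "exec Skip s [Step] s"
| Assign: "exec (Assign x e) s [Step] (s\<lparr>reg := (reg s)(x := aval e s)\<rparr>)"
| Put: "exec (Put a i e) s [Step]
          (s\<lparr>arr := (arr s)(a := (arr s a)(aval i s := aval e s))\<rparr>)"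
| Out: "exec (Out e) s [Word (aval e s)] s"
| Close: "exec Close s [End] s"
| Seq: "exec c s t s' \<Longrightarrow> exec d s' t' s'' \<Longrightarrow> exec (Seq c d) s (t @ t') s''"
| IfTrue: "bval b s \<Longrightarrow> exec c s t s' \<Longrightarrow> exec (If b c d) s (Step # t) s'"
| IfFalse: "\<not> bval b s \<Longrightarrow> exec d s t s' \<Longrightarrow> exec (If b c d) s (Step # t) s'"
| WhileFalse: "\<not> bval b s \<Longrightarrow> exec (While b c) s [Step] s"
| WhileTrue: "bval b s \<Longrightarrow> exec c s t s' \<Longrightarrow> exec (While b c) s' t' s'' \<Longrightarrow>
    exec (While b c) s (Step # t @ t') s''"

inductive_cases exec_SkipE: "exec Skip s t s'"
inductive_cases exec_AssignE: "exec (Assign x e) s t s'"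
inductive_cases exec_PutE: "exec (Put a i e) s t s'"
inductive_cases exec_OutE: "exec (Out e) s t s'"
inductive_cases exec_CloseE: "exec Close s t s'"
inductive_cases exec_SeqE: "exec (Seq c d) s t s'"
inductive_cases exec_IfE: "exec (If b c d) s t s'"
inductive_cases exec_WhileE: "exec (While b c) s t s'"

lemma exec_deterministic:
  "exec c s t s' \<Longrightarrow> exec c s u s'' \<Longrightarrow> t = u \<and> s' = s''"
proof (induction arbitrary: u s'' rule: exec.induct)
  case (Skip s)
  then show ?case by (blast elim: exec_SkipE)
next
  case (Assign x e s)
  then show ?case by (blast elim: exec_AssignE)
next
  case (Put a i e s)
  then show ?case by (blast elim: exec_PutE)
next
  case (Out e s)
  then show ?case by (blast elim: exec_OutE)
next
  case (Close s)
  then show ?case by (blast elim: exec_CloseE)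
next
  case (Seq c s t s' d t' sa)
  from Seq.prems show ?case
    by (rule exec_SeqE) (use Seq.IH in blast)
next
  case (IfTrue b s c t s' d)
  from IfTrue.prems show ?case
    by (rule exec_IfE) (use IfTrue.IH IfTrue.hyps in blast)+
next
  case (IfFalse b s d t s' c)
  from IfFalse.prems show ?case
    by (rule exec_IfE) (use IfFalse.IH IfFalse.hyps in blast)+
next
  case (WhileFalse b s c)
  from WhileFalse.prems show ?case
    by (rule exec_WhileE) (use WhileFalse.hyps in blast)+
next
  case (WhileTrue b s c t s' t' sa)
  from WhileTrue.prems show ?case
    by (rule exec_WhileE) (use WhileTrue.IH WhileTrue.hyps in blast)+
qed

definition initial :: "nat list \<Rightarrow> state" where
  "initial ws = \<lparr>reg = (\<lambda>_. 0),
     arr = (\<lambda>a i. if a = ''input'' \<and> i < length ws then ws ! i else 0)\<rparr>"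

text \<open>\<open>run p ws t\<close>: on input \<open>ws\<close>, the program \<open>p\<close> halts with trace \<open>t\<close>.\<close>

definition run :: "com \<Rightarrow> nat list \<Rightarrow> event list \<Rightarrow> bool" where
  "run p ws t \<longleftrightarrow> (\<exists>s. exec p (initial ws) t s)"

text \<open>A trace is cut after every \<open>End\<close>; the last segment is what follows the last output item.\<close>

fun segments :: "event list \<Rightarrow> event list list" where
  "segments [] = [[]]"
| "segments (End # t) = [End] # segments t"
| "segments (e # t) = (e # hd (segments t)) # tl (segments t)"

fun output_words :: "event list \<Rightarrow> nat list" where
  "output_words [] = []"
| "output_words (Word k # t) = k # output_words t"
| "output_words (_ # t) = output_words t"

definition items :: "event list \<Rightarrow> nat list list" where
  "items t = map output_words (butlast (segments t))"

definition delay :: "event list \<Rightarrow> nat" where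
  "delay t = Max (length ` set (segments t))"

text \<open>The sets output in a run, each written as a repetition-free sequence of its elements;
  no output item is left unfinished.\<close>

definition outputs :: "com \<Rightarrow> nat list \<Rightarrow> event list \<Rightarrow> nat set list \<Rightarrow> bool" where
  "outputs p ws t Ss \<longleftrightarrow> run p ws t \<and> output_words (last (segments t)) = [] \<and>
     (\<forall>xs\<in>set (items t). distinct xs) \<and> map set (items t) = Ss"


section \<open>Listing problems\<close>

text \<open>A listing problem assigns to each instance a universe and a set of solutions;
  \<open>encode\<close> is the input given to the machine.\<close>

record 'i listing_problem =
  instances :: "'i set"
  encode :: "'i \<Rightarrow> nat list"
  universe :: "'i \<Rightarrow> nat set"
  solutions :: "'i \<Rightarrow> nat set set"

definition one_solution_in_polytime :: "'i listing_problem \<Rightarrow> bool" where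
  "one_solution_in_polytime P \<longleftrightarrow>
     (\<exists>p (q :: nat poly). \<forall>x\<in>instances P. \<exists>t. \<exists>S\<in>solutions P x.
        outputs p (encode P x) t [S] \<and> length t \<le> poly q (card (universe P x)))"

text \<open>The argument \<open>S\<close> of \<open>nb\<close> is passed to the machine as a list of its elements in
  arbitrary order, appended to the instance and preceded by its length.\<close>

definition neighbors_in_polytime ::
    "'i listing_problem \<Rightarrow> ('i \<Rightarrow> nat set \<Rightarrow> nat set set) \<Rightarrow> bool" where
  "neighbors_in_polytime P nb \<longleftrightarrow>
     (\<exists>p (q :: nat poly). \<forall>x\<in>instances P. \<forall>S\<in>solutions P x. \<forall>xs.
        set xs = S \<and> distinct xs \<longrightarrow>
          (\<exists>t Ss. outputs p (encode P x @ length xs # xs) t Ss \<and> set Ss = nb x S \<and>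
             length t \<le> poly q (card (universe P x))))"

definition proximity_searchable :: "'i listing_problem \<Rightarrow> bool" where
  "proximity_searchable P \<longleftrightarrow>
     one_solution_in_polytime P \<and>
     (\<exists>(prox :: 'i \<Rightarrow> nat set \<Rightarrow> nat set \<Rightarrow> nat set) (nb :: 'i \<Rightarrow> nat set \<Rightarrow> nat set set).
        (\<forall>x\<in>instances P. \<forall>S\<in>solutions P x. \<forall>S'\<in>solutions P x. prox x S S' \<subseteq> universe P x) \<and>
        (\<forall>x\<in>instances P. \<forall>S\<in>solutions P x. nb x S \<subseteq> solutions P x) \<and>
        neighbors_in_polytime P nb \<and>
        (\<forall>x\<in>instances P. \<forall>S\<in>solutions P x. \<forall>S'\<in>solutions P x. S \<noteq> S' \<longrightarrow>
           (\<exists>R\<in>nb x S. card (prox x R S') > card (prox x S S'))))"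

text \<open>Every solution is output exactly once, with delay \<open>O(f)\<close>. The summand 1 covers
  instances with \<open>f x = 0\<close>, on which the machine still has to make at least one step.\<close>

definition listable_with_delay :: "'i listing_problem \<Rightarrow> ('i \<Rightarrow> nat) \<Rightarrow> bool" where
  "listable_with_delay P f \<longleftrightarrow>
     (\<exists>p c. \<forall>x\<in>instances P. \<exists>t Ss.
        outputs p (encode P x) t Ss \<and> distinct Ss \<and> set Ss = solutions P x \<and>
        delay t \<le> c * (f x + 1))"


section \<open>Listing maximal (connected) induced chordal subgraphs\<close>

text \<open>A graph is presented to the machine by its number \<open>n\<close> of vertices, which are
  \<open>0, \<dots>, n - 1\<close>, and a list containing each edge once, in arbitrary order and orientation.\<close>

type_synonym graph = "nat \<times> (nat \<times> nat) list"

definition verts :: "graph \<Rightarrow> nat set" where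
  "verts G = {..<fst G}"

definition edges :: "graph \<Rightarrow> nat set set" where
  "edges G = (\<lambda>(u, v). {u, v}) ` set (snd G)"

definition simple_graph :: "graph \<Rightarrow> bool" where
  "simple_graph G \<longleftrightarrow>
     (\<forall>(u, v)\<in>set (snd G). u \<in> verts G \<and> v \<in> verts G \<and> u \<noteq> v) \<and>
     distinct (map (\<lambda>(u, v). {u, v}) (snd G))"

definition no_isolated_vertices :: "graph \<Rightarrow> bool" where
  "no_isolated_vertices G \<longleftrightarrow> (\<forall>v\<in>verts G. \<exists>e\<in>edges G. v \<in> e)"

definition encode_graph :: "graph \<Rightarrow> nat list" where
  "encode_graph G = fst G # length (snd G) # concat (map (\<lambda>(u, v). [u, v]) (snd G))"

definition max_chordal_problem :: "graph listing_problem" where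
  "max_chordal_problem =
     \<lparr>instances = {G. simple_graph G \<and> no_isolated_vertices G},
      encode = encode_graph,
      universe = verts,
      solutions = (\<lambda>G. {S. inclusion_maximal (induced_chordal (verts G) (edges G)) S})\<rparr>"

definition max_connected_chordal_problem :: "graph listing_problem" where
  "max_connected_chordal_problem =
     \<lparr>instances = {G. simple_graph G \<and> no_isolated_vertices G},
      encode = encode_graph,
      universe = verts,
      solutions =
        (\<lambda>G. {S. inclusion_maximal (connected_induced_chordal (verts G) (edges G)) S})\<rparr>"

end

theory Submission imports Defs "HOL-Library.Nat_Bijection" begin

text \<open>Number the vertices of a chordal set \<open>S'\<close> so that the earlier neighbours of each vertex form a
  clique and every initial segment is connected whenever \<open>S'\<close> is; maximum cardinality search yields such
  an order. The proximity of \<open>S\<close> to \<open>S'\<close> is the longest initial segment of \<open>S'\<close> inside \<open>S\<close>. If \<open>v\<close> is the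
  next vertex, its neighbours in the segment form a clique of \<open>S\<close>, hence consist of their last vertex \<open>a\<close>
  and earlier neighbours of \<open>a\<close> in an order of \<open>S\<close>. Deleting from \<open>S\<close> all other neighbours of \<open>v\<close> and adding
  \<open>v\<close> gives a chordal set, since \<open>v\<close> can be inserted last; an extension of its component at \<open>v\<close> to a
  solution is closer to \<open>S'\<close>. There are at most \<open>2m + n\<close> pairs \<open>(v, a)\<close>, an extension takes \<open>2n\<close> chordality
  tests, and a test is a linear-time maximum cardinality search.

  Breadth-first search over these neighbours lists all solutions, outputting each one before it is
  expanded. As the machine has unbounded words, a set of vertices is represented in the queue by the
  number \<open>set_encode S\<close>, which is also its index in the table of the sets already seen. Connectivity is treated
  uniformly: without the connectedness requirement any two vertices count as linked.\<close>

section \<open>Chordal graphs and elimination orders\<close>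

text \<open>Connected chordal sets are not closed under subsets, so a greedy extension must not
  discard a vertex for lack of a link: the link may appear later. Chordality is hereditary, so a
  failed chordality test is final. Hence unlinked vertices merely wait, and every test settles a
  vertex for good. An extension grows twice: inside the candidate, to absorb the component of
  \<open>v\<close>, and then freely, to become maximal. Two unrelated orders are in play. Proximity
  uses a fixed order of \<open>S'\<close>, which the machine never sees; candidates use whatever
  order the search produces on \<open>S\<close>. The guessed vertex \<open>a\<close> is the
  interface between them. A solution is output when it leaves the queue, so a single expansion lies
  between two outputs, and the counts above multiply to order \<open>(n + m) ^ 2 * n\<close>. Since
  no vertex is isolated, \<open>n\<close> is at most \<open>2 * m\<close>, which turns this into
  \<open>m ^ 2 * n\<close>.\<close>

definition adj :: "'a set set \<Rightarrow> 'a \<Rightarrow> 'a \<Rightarrow> bool" where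
  "adj E u v \<longleftrightarrow> u \<noteq> v \<and> {u, v} \<in> E"

lemma adj_sym: "adj E u v \<longleftrightarrow> adj E v u"
  by (auto simp: adj_def insert_commute)

lemma adj_irrefl [simp]: "\<not> adj E u u"
  by (simp add: adj_def)

text \<open>The threshold \<open>k\<close> is separate from the number of \<open>u\<close> because
  maximum cardinality search counts the visited neighbours of one vertex at the moment when another
  is numbered.\<close>

definition prior :: "'a set set \<Rightarrow> 'a set \<Rightarrow> ('a \<Rightarrow> nat) \<Rightarrow> 'a \<Rightarrow> nat \<Rightarrow> 'a set" where
  "prior E X num u k = {w \<in> X. adj E u w \<and> num w < k}"

definition clique :: "'a set set \<Rightarrow> 'a set \<Rightarrow> bool" where
  "clique E K \<longleftrightarrow> (\<forall>a\<in>K. \<forall>b\<in>K. a \<noteq> b \<longrightarrow> adj E a b)"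

text \<open>The reverse of a perfect elimination order: vertices are numbered in the order in which
  they are inserted.\<close>

definition insertion_order :: "'a set set \<Rightarrow> 'a set \<Rightarrow> ('a \<Rightarrow> nat) \<Rightarrow> bool" where
  "insertion_order E X num \<longleftrightarrow> inj_on num X \<and> (\<forall>u\<in>X. clique E (prior E X num u (num u)))"

text \<open>The greedy rule of maximum cardinality search without the search: vertices still
  unvisited when \<open>u\<close> is chosen are those numbered no earlier than
  \<open>u\<close>.\<close>

definition mcs_order :: "'a set set \<Rightarrow> 'a set \<Rightarrow> ('a \<Rightarrow> nat) \<Rightarrow> bool" where
  "mcs_order E X num \<longleftrightarrow> inj_on num X \<and>
     (\<forall>u\<in>X. \<forall>v\<in>X. num u \<le> num v \<longrightarrow>
        card (prior E X num v (num u)) \<le> card (prior E X num u (num u)))"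

text \<open>A cycle within \<open>Y\<close> is a cycle within \<open>X\<close>, and a chord found
  there joins two vertices of the cycle, hence lies within \<open>Y\<close>.\<close>

lemma chordal_mono:
  assumes "chordal (induced_edges E X)" and "Y \<subseteq> X"
  shows "chordal (induced_edges E Y)"
  unfolding chordal_def
proof (intro allI impI)
  fix cs assume a: "is_cycle (induced_edges E Y) cs \<and> 3 < length cs"
  then have "is_cycle (induced_edges E X) cs"
    using assms(2) unfolding is_cycle_def induced_edges_def by auto
  then obtain e where e: "is_chord (induced_edges E X) cs e"
    using assms(1) a unfolding chordal_def by blast
  have "set cs \<subseteq> Y"
  proof
    fix x assume "x \<in> set cs"
    then obtain i where "i < length cs" "x = cs ! i" by (metis in_set_conv_nth)
    then have "{x, cs ! (Suc i mod length cs)} \<in> cycle_edges cs"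
      unfolding cycle_edges_def by blast
    then show "x \<in> Y" using a unfolding is_cycle_def induced_edges_def by auto
  qed
  then have "is_chord (induced_edges E Y) cs e"
    using e unfolding is_chord_def induced_edges_def by auto
  then show "\<exists>e. is_chord (induced_edges E Y) cs e" ..
qed

text \<open>On a cycle, the vertex inserted last has both its cycle neighbours among its earlier
  neighbours, so these are adjacent; if the cycle has more than three vertices, this edge is a
  chord.\<close>

lemma insertion_order_chordal:
  assumes "insertion_order E X num"
  shows "chordal (induced_edges E X)"
  unfolding chordal_def
proof (intro allI impI)
  fix cs assume a: "is_cycle (induced_edges E X) cs \<and> 3 < length cs"
  define L where "L = length cs"
  have L: "L > 3" and dist: "distinct cs" and ce: "cycle_edges cs \<subseteq> induced_edges E X"
    using a by (auto simp: is_cycle_def L_def)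
  have edge: "{cs ! i, cs ! (Suc i mod L)} \<in> induced_edges E X" if "i < L" for i
    using ce that unfolding cycle_edges_def L_def by blast
  have inX: "cs ! i \<in> X" if "i < L" for i
    using edge[OF that] unfolding induced_edges_def by auto
  have inj: "cs ! i = cs ! j \<longleftrightarrow> i = j" if "i < L" "j < L" for i j
    using that dist by (simp add: L_def nth_eq_iff_index_eq)
  have "finite (num ` set cs)" "num ` set cs \<noteq> {}" using L by (auto simp: L_def)
  then have "Max (num ` set cs) \<in> num ` set cs" by (rule Max_in)
  then obtain y where y1: "y \<in> set cs" "num y = Max (num ` set cs)" by auto
  have y: "y \<in> set cs" "\<And>z. z \<in> set cs \<Longrightarrow> num z \<le> num y" using y1 by auto
  then obtain i where i: "i < L" "y = cs ! i" by (metis in_set_conv_nth L_def)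
  \<comment> \<open>Positions of the successor and the predecessor, on the cycle, of the vertex
    \<open>cs ! i\<close> inserted last.\<close>
  define b where "b = Suc i mod L"
  define c where "c = (if i = 0 then L - 1 else i - 1)"
  have bc: "b < L" "c < L" "Suc c mod L = i" using i L by (auto simp: b_def c_def)
  have bi: "b \<noteq> i" "c \<noteq> i" "b \<noteq> c" using i L
    by (auto simp: b_def c_def mod_Suc split: if_splits)
  have less: "num (cs ! z) < num (cs ! i)" if "z < L" "z \<noteq> i" for z
  proof -
    have "num (cs ! z) \<le> num (cs ! i)" using y(2)[of "cs ! z"] that i by (auto simp: L_def)
    moreover have "inj_on num X" using assms by (simp add: insertion_order_def)
    then have "num (cs ! z) \<noteq> num (cs ! i)"
      using inX[of z] inX[of i] inj[of z i] that i by (auto dest: inj_onD)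
    ultimately show ?thesis by simp
  qed
  have "adj E (cs ! i) (cs ! b)" "adj E (cs ! i) (cs ! c)"
    using edge[of i] edge[of c] i bc bi inj[of i b] inj[of i c]
    by (auto simp: adj_def induced_edges_def b_def insert_commute)
  moreover have "clique E (prior E X num (cs ! i) (num (cs ! i)))"
    using assms inX i by (simp add: insertion_order_def)
  ultimately have "adj E (cs ! b) (cs ! c)"
    using bc bi inX less inj[of b c] by (simp add: clique_def prior_def)
  then have bce: "{cs ! b, cs ! c} \<in> induced_edges E X"
    using bc inX by (auto simp: adj_def induced_edges_def)
  have "{cs ! b, cs ! c} \<notin> cycle_edges cs"
  proof
    assume "{cs ! b, cs ! c} \<in> cycle_edges cs"
    then obtain k where k: "k < L" "{cs ! b, cs ! c} = {cs ! k, cs ! (Suc k mod L)}"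
      unfolding cycle_edges_def L_def by blast
    have sk: "Suc k mod L < L" using L by simp
    have "b = k \<and> c = Suc k mod L \<or> c = k \<and> b = Suc k mod L"
      using k(2) inj[OF bc(1) k(1)] inj[OF bc(2) k(1)] inj[OF bc(1) sk] inj[OF bc(2) sk]
      by (auto simp: doubleton_eq_iff)
    \<comment> \<open>If \<open>c\<close> followed \<open>b\<close>, the cycle would have length 3;
      if \<open>b\<close> followed \<open>c\<close>, then \<open>b\<close> would be
      \<open>i\<close>.\<close>
    then show False
    proof
      assume "b = k \<and> c = Suc k mod L"
      then show False using i L unfolding b_def c_def by (auto simp: mod_Suc split: if_splits)
    next
      assume "c = k \<and> b = Suc k mod L"
      then show False using bc bi by auto
    qed
  qed
  then have "is_chord (induced_edges E X) cs {cs ! b, cs ! c}"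
    using bce bc by (auto simp: is_chord_def L_def)
  then show "\<exists>e. is_chord (induced_edges E X) cs e" ..
qed

section \<open>Induced paths and the correctness of maximum cardinality search\<close>

definition induced_path :: "'a set set \<Rightarrow> 'a set \<Rightarrow> 'a list \<Rightarrow> bool" where
  "induced_path E X p \<longleftrightarrow> distinct p \<and> set p \<subseteq> X \<and>
     (\<forall>i j. i < j \<and> j < length p \<longrightarrow> adj E (p ! i) (p ! j) = (j = Suc i))"

lemma induced_path_rev:
  assumes "induced_path E X p"
  shows "induced_path E X (rev p)"
  unfolding induced_path_def
proof (intro conjI allI impI)
  show "distinct (rev p)" "set (rev p) \<subseteq> X" using assms by (auto simp: induced_path_def)
next
  fix i j assume ij: "i < j \<and> j < length (rev p)"
  define a where "a = length p - Suc j"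
  define b where "b = length p - Suc i"
  have ab: "a < b" "b < length p" using ij by (auto simp: a_def b_def)
  then have "adj E (p ! a) (p ! b) = (b = Suc a)" using assms by (auto simp: induced_path_def)
  moreover have "(b = Suc a) = (j = Suc i)" using ij by (auto simp: a_def b_def)
  ultimately show "adj E (rev p ! i) (rev p ! j) = (j = Suc i)"
    using ij adj_sym by (fastforce simp: rev_nth a_def b_def)
qed

text \<open>Closing the path with \<open>d\<close> gives a cycle of length at least 4. It has no
  chord: the path has no shortcuts, and \<open>d\<close> sees only its two ends.\<close>

lemma chordless_cycle_False:
  assumes ch: "chordal (induced_edges E X)" and p: "induced_path E X p" and len: "length p \<ge> 3"
    and d: "d \<in> X" "d \<notin> set p" "adj E d (hd p)" "adj E d (last p)"
    and E: "\<And>e. e \<in> E \<Longrightarrow> \<exists>x y. e = {x, y} \<and> x \<noteq> y"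
    and nd: "\<And>i. 0 < i \<Longrightarrow> i < length p - 1 \<Longrightarrow> \<not> adj E d (p ! i)"
  shows False
proof -
  define cs where "cs = p @ [d]"
  define L where "L = length p"
  have lc: "length cs = Suc L" by (simp add: cs_def L_def)
  have hl: "hd p = p ! 0" "last p = p ! (L - 1)" using len
    by (cases "p = []"; simp add: L_def hd_conv_nth last_conv_nth)+
  have padj: "adj E (p ! i) (p ! j) = (j = Suc i)" if "i < j" "j < L" for i j
    using p that by (auto simp: induced_path_def L_def)
  have pX: "set p \<subseteq> X" using p by (simp add: induced_path_def)
  have cyc: "\<exists>k<Suc L. {i, j} = {k, Suc k mod Suc L}"
    if "i < j" "j < Suc L" "j = Suc i \<or> i = 0 \<and> j = L" for i j
  proof (cases "j = Suc i")
    case True then show ?thesis using that by (intro exI[of _ i]) auto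
  next
    case False then show ?thesis using that by (intro exI[of _ L]) auto
  qed
  \<comment> \<open>Position \<open>L\<close> holds \<open>d\<close>, so the closing edge of the
    cycle is the pair of positions 0 and \<open>L\<close>.\<close>
  have csadj: "adj E (cs ! i) (cs ! j) = (j = Suc i \<or> i = 0 \<and> j = L)"
    if "i < j" "j < Suc L" for i j
  proof (cases "j = L")
    case False then show ?thesis using padj that by (auto simp: cs_def L_def nth_append)
  next
    case True
    have "adj E d (p ! i) = (i = 0 \<or> Suc i = L)"
    proof (cases "i = 0 \<or> Suc i = L")
      case True then show ?thesis using d(3,4) hl by (metis diff_Suc_1)
    next
      case False
      then have "i < length p - 1" using that \<open>j = L\<close> by (auto simp: L_def)
      then show ?thesis using nd[of i] False by simp
    qed
    then show ?thesis using True that adj_sym by (fastforce simp: cs_def L_def nth_append)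
  qed
  have "is_cycle (induced_edges E X) cs"
    unfolding is_cycle_def
  proof (intro conjI)
    show "3 \<le> length cs" using len by (simp add: lc L_def)
    show "distinct cs" using p d by (auto simp: cs_def induced_path_def)
    show "cycle_edges cs \<subseteq> induced_edges E X"
    proof
      fix e assume "e \<in> cycle_edges cs"
      then obtain i where i: "i < Suc L" "e = {cs ! i, cs ! (Suc i mod Suc L)}"
        unfolding cycle_edges_def lc by blast
      have "adj E (cs ! i) (cs ! (Suc i mod Suc L))"
      proof (cases "i = L")
        case True then show ?thesis using csadj[of 0 L] len adj_sym by (fastforce simp: L_def)
      next
        case False then show ?thesis using csadj[of i "Suc i"] i by auto
      qed
      moreover have "Suc i mod Suc L < length cs" using lc by simp
      then have "cs ! i \<in> set cs" "cs ! (Suc i mod Suc L) \<in> set cs"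
        using i lc by (metis nth_mem)+
      moreover have "set cs \<subseteq> X" using pX d by (auto simp: cs_def)
      ultimately show "e \<in> induced_edges E X" using i(2) by (auto simp: adj_def induced_edges_def)
    qed
  qed
  then obtain e where e: "is_chord (induced_edges E X) cs e"
    using ch len lc unfolding chordal_def L_def by auto
  have edge_in: "e \<in> cycle_edges cs" if ij: "i < j" "j < Suc L" "e = {cs ! i, cs ! j}" for i j
  proof -
    have "cs ! i \<noteq> cs ! j" using p d ij lc
      by (subst nth_eq_iff_index_eq) (auto simp: cs_def induced_path_def L_def)
    then have "adj E (cs ! i) (cs ! j)" using e ij by (auto simp: adj_def is_chord_def induced_edges_def)
    then obtain k where k: "k < Suc L" "{i, j} = {k, Suc k mod Suc L}"
      using csadj cyc ij by meson
    have "{cs ! i, cs ! j} = (!) cs ` {i, j}" by auto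
    also have "\<dots> = {cs ! k, cs ! (Suc k mod Suc L)}" unfolding k(2) by auto
    finally show ?thesis using k(1) ij(3) unfolding cycle_edges_def lc by blast
  qed
  have "e \<in> E" "e \<subseteq> set cs" "e \<notin> cycle_edges cs"
    using e by (auto simp: is_chord_def induced_edges_def)
  moreover obtain x y where xy: "e = {x, y}" "x \<noteq> y" using E \<open>e \<in> E\<close> by blast
  moreover obtain i j where "i < Suc L" "x = cs ! i" "j < Suc L" "y = cs ! j"
    using xy \<open>e \<subseteq> set cs\<close> by (metis in_set_conv_nth lc insert_subset)
  ultimately show False
    using edge_in by (metis insert_commute linorder_neqE_nat)
qed

text \<open>When \<open>b\<close> was chosen, it had at least as many visited neighbours as \<open>c\<close>, but not all those of \<open>c\<close>.\<close>

lemma mcs_orderD: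
  assumes "mcs_order E X num" "finite X" "a \<in> X" "b \<in> X" "c \<in> X"
    and "num a < num b" "num b < num c" "adj E a c" "\<not> adj E a b"
  obtains d where "d \<in> X" "num d < num b" "adj E d b" "\<not> adj E d c"
proof -
  have le: "card (prior E X num c (num b)) \<le> card (prior E X num b (num b))"
    using assms unfolding mcs_order_def by (meson less_imp_le)
  have a: "a \<in> prior E X num c (num b)" "a \<notin> prior E X num b (num b)"
    using assms adj_sym by (fastforce simp: prior_def)+
  have "\<not> prior E X num b (num b) \<subseteq> prior E X num c (num b)"
  proof
    assume "prior E X num b (num b) \<subseteq> prior E X num c (num b)"
    then have "prior E X num b (num b) \<subset> prior E X num c (num b)" using a by auto
    then have "card (prior E X num b (num b)) < card (prior E X num c (num b))"
      using assms(2) by (intro psubset_card_mono) (auto simp: prior_def)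
    then show False using le by simp
  qed
  then show thesis using that adj_sym by (fastforce simp: prior_def)
qed

text \<open>Descent on the later endpoint \<open>b\<close>. Let \<open>a\<close> be the other endpoint and \<open>c\<close> the neighbour of \<open>a\<close> on the
  path. Some \<open>d\<close> before \<open>b\<close> is adjacent to \<open>b\<close> but not to \<open>c\<close>; either it closes a chordless cycle through
  \<open>a\<close>, or it ends a bad path starting at \<open>a\<close>.\<close>

lemma chordal_no_bad_path:
  assumes ch: "chordal (induced_edges E X)" and fin: "finite X" and mcs: "mcs_order E X num"
    and E: "\<And>e. e \<in> E \<Longrightarrow> \<exists>x y. e = {x, y} \<and> x \<noteq> y"
  shows "\<not> (induced_path E X p \<and> length p \<ge> 3 \<and>
     (\<forall>i. 0 < i \<and> i < length p - 1 \<longrightarrow> num (p ! i) > max (num (hd p)) (num (last p))))"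
proof (induction "max (num (hd p)) (num (last p))" arbitrary: p rule: less_induct)
  case less
  show ?case
  proof
    assume bad: "induced_path E X p \<and> length p \<ge> 3 \<and>
      (\<forall>i. 0 < i \<and> i < length p - 1 \<longrightarrow> num (p ! i) > max (num (hd p)) (num (last p)))"
    \<comment> \<open>Orientation: the endpoint with the larger number comes last.\<close>
    define q where "q = (if num (hd p) < num (last p) then p else rev p)"
    have pne: "p \<noteq> []" using bad by auto
    have mq: "max (num (hd q)) (num (last q)) = max (num (hd p)) (num (last p))"
      using pne by (auto simp: q_def hd_rev last_rev)
    define L where "L = length q"
    have L3: "L \<ge> 3" using bad by (auto simp: L_def q_def)
    have ip: "induced_path E X q" using bad induced_path_rev by (auto simp: q_def)
    have qX: "q ! i \<in> X" if "i < L" for i using ip that by (auto simp: induced_path_def L_def)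
    have qadj: "adj E (q ! i) (q ! j) = (j = Suc i)" if "i < j" "j < L" for i j
      using ip that by (auto simp: induced_path_def L_def)
    have qinj: "q ! i = q ! j \<longleftrightarrow> i = j" if "i < L" "j < L" for i j
      using ip that by (auto simp: induced_path_def L_def nth_eq_iff_index_eq)
    have hl: "hd q = q ! 0" "last q = q ! (L - 1)"
      using L3 by (cases "q = []"; simp add: L_def hd_conv_nth last_conv_nth)+
    have inj: "inj_on num X" using mcs by (simp add: mcs_order_def)
    have ne: "num (q ! 0) \<noteq> num (q ! (L - 1))"
      using inj qX[of 0] qX[of "L - 1"] qinj[of 0 "L - 1"] L3 by (auto dest: inj_onD)
    have hp: "p \<noteq> [] \<Longrightarrow> hd q = hd p \<and> last q = last p \<or> hd q = last p \<and> last q = hd p"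
      by (auto simp: q_def hd_rev last_rev)
    have lt: "num (q ! 0) < num (q ! (L - 1))"
    proof (cases "num (hd p) < num (last p)")
      case True then show ?thesis using hl by (simp add: q_def)
    next
      case False
      then have "hd q = last p" "last q = hd p" using pne by (auto simp: q_def hd_rev last_rev)
      then show ?thesis using False ne hl by (metis linorder_neqE_nat)
    qed
    have inner: "num (q ! i) > num (q ! (L - 1))" if "0 < i" "i < L - 1" for i
    proof -
      have "max (num (hd q)) (num (last q)) < num (q ! i)"
      proof (cases "num (hd p) < num (last p)")
        case True then show ?thesis using bad that by (simp add: q_def L_def)
      next
        case False
        then have q: "q = rev p" by (simp add: q_def)
        have "q ! i = p ! (L - 1 - i)" using that by (simp add: q L_def rev_nth)
        moreover have "0 < L - 1 - i" "L - 1 - i < length p - 1" using that by (auto simp: q L_def)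
        ultimately show ?thesis using bad mq by metis
      qed
      then show ?thesis using hl by simp
    qed
    define a where "a = q ! 0"
    define b where "b = q ! (L - 1)"
    have "adj E a (q ! 1)" "\<not> adj E a b" using qadj[of 0 1] qadj[of 0 "L - 1"] L3
      by (auto simp: a_def b_def)
    moreover have "a \<in> X" "b \<in> X" "q ! 1 \<in> X" using qX L3 by (auto simp: a_def b_def)
    moreover have "num a < num b" "num b < num (q ! 1)" using lt inner[of 1] L3
      by (auto simp: a_def b_def)
    ultimately obtain d where d: "d \<in> X" "num d < num b" "adj E d b" "\<not> adj E d (q ! 1)"
      using mcs_orderD[OF mcs fin, of a b "q ! 1"] by metis
    \<comment> \<open>The first neighbour of \<open>d\<close> on the path after its start. It exists
      because \<open>d\<close> is adjacent to \<open>b\<close>, and \<open>j\<close> exceeds 1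
      because \<open>d\<close> is not adjacent to \<open>q ! 1\<close>. On the path cut at
      \<open>j\<close>, the vertex \<open>d\<close> is adjacent to the end and at most to
      \<open>a\<close> besides.\<close>
    define j where "j = (LEAST j. 0 < j \<and> j < L \<and> adj E d (q ! j))"
    have ex: "0 < L - 1 \<and> L - 1 < L \<and> adj E d (q ! (L - 1))" using d L3 by (simp add: b_def)
    have j: "0 < j" "j < L" "adj E d (q ! j)"
      using LeastI[of "\<lambda>j. 0 < j \<and> j < L \<and> adj E d (q ! j)", OF ex] by (auto simp: j_def)
    have jmin: "\<not> adj E d (q ! i)" if "0 < i" "i < j" for i
      using not_less_Least[of i "\<lambda>j. 0 < j \<and> j < L \<and> adj E d (q ! j)"] that j by (auto simp: j_def)
    have j2: "j \<ge> 2" using j d(4) by (metis One_nat_def Suc_leI le_neq_implies_less numeral_2_eq_2)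
    define r where "r = take (Suc j) q"
    have rl: "length r = Suc j" using j by (simp add: r_def L_def)
    have rn: "r ! i = q ! i" if "i \<le> j" for i using that by (simp add: r_def)
    have rh: "hd r = a" "last r = q ! j"
      using rl rn[of 0] rn[of j] by (cases "r = []"; simp add: a_def hd_conv_nth last_conv_nth)+
    have rip: "induced_path E X r"
      using ip unfolding induced_path_def r_def by (auto dest: in_set_takeD)
    \<comment> \<open>Inner vertices are numbered after \<open>b\<close> and \<open>d\<close> before
      it; \<open>a\<close> is excluded because it is not adjacent to \<open>b\<close>.\<close>
    have dq: "d \<noteq> q ! i" if "i < L" for i
    proof -
      have "i = 0 \<or> 0 < i \<and> i < L - 1 \<or> i = L - 1" using that by arith
      then consider "i = 0" | "0 < i" "i < L - 1" | "i = L - 1" by blast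
      then show ?thesis
      proof cases
        case 1 then show ?thesis using d(3) \<open>\<not> adj E a b\<close> by (auto simp: a_def)
      next
        case 2 then show ?thesis using inner[of i] d(2) by (auto simp: b_def)
      next
        case 3 then show ?thesis using d(2) by (auto simp: b_def)
      qed
    qed
    have dr: "d \<notin> set r"
    proof
      assume "d \<in> set r"
      then have "d \<in> set q" by (auto simp: r_def dest: in_set_takeD)
      then show False using dq by (metis in_set_conv_nth L_def)
    qed
    show False
    proof (cases "adj E d a")
      case True
      show False
        by (rule chordless_cycle_False[OF ch rip _ d(1) dr])
          (use True rh rl j2 j E jmin rn in auto)
    next
      case False
      define p' where "p' = r @ [d]"
      have p'l: "length p' = Suc (Suc j)" by (simp add: p'_def rl)
      have p'h: "hd p' = a" "last p' = d" using rh rl by (cases "r = []"; simp add: p'_def)+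
      have "induced_path E X p'"
        unfolding induced_path_def
      proof (intro conjI allI impI)
        show "distinct p'" "set p' \<subseteq> X" using rip dr d by (auto simp: p'_def induced_path_def)
      next
        fix i k assume ik: "i < k \<and> k < length p'"
        show "adj E (p' ! i) (p' ! k) = (k = Suc i)"
        proof (cases "k = Suc j")
          case False
          then have "p' ! i = r ! i" "p' ! k = r ! k" using ik by (auto simp: p'_def rl nth_append)
          then show ?thesis using rip ik False by (auto simp: induced_path_def rl p'l)
        next
          case True
          then have pk: "p' ! k = d" "p' ! i = q ! i" using ik rl rn
            by (auto simp: p'_def nth_append)
          have "adj E d (q ! i) = (i = j)"
          proof (cases "i = 0")
            case i0: True then show ?thesis using False j by (auto simp: a_def)
          next
            case i1: False
            show ?thesis
            proof (cases "i = j")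
              case True then show ?thesis using j by simp
            next
              case False then show ?thesis using jmin[of i] i1 ik True by auto
            qed
          qed
          then show ?thesis using pk True adj_sym by (metis nat.inject)
        qed
      qed
      \<comment> \<open>Both ends \<open>a\<close> and \<open>d\<close> of the new path precede
        \<open>b\<close>, while its inner vertices, possibly \<open>b\<close> itself among them, do
        not. So the path is bad again, with a smaller measure.\<close>
      moreover have "num (p' ! i) > max (num (hd p')) (num (last p'))"
        if "0 < i" "i < length p' - 1" for i
      proof -
        have "p' ! i = q ! i" "i \<le> j" using that rl rn by (auto simp: p'_def nth_append)
        moreover have "num b \<le> num (q ! i)"
        proof (cases "i = L - 1")
          case False
          then have "i < L - 1" using j(2) \<open>i \<le> j\<close> by arith
          then show ?thesis using inner[of i] that by (simp add: b_def)
        qed (simp add: b_def)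
        ultimately show ?thesis using d(2) lt p'h by (simp add: a_def b_def)
      qed
      moreover have "max (num (hd p')) (num (last p')) < max (num (hd p)) (num (last p))"
        using mq hl lt d(2) p'h by (simp add: a_def b_def)
      ultimately show False using less[of p'] p'l j2 by auto
    qed
  qed
qed

text \<open>Two nonadjacent earlier neighbours \<open>a\<close>, \<open>b\<close> of
  \<open>u\<close> would form the shortest kind of bad path, \<open>[a, u, b]\<close>.\<close>

theorem mcs_insertion_order:
  assumes ch: "chordal (induced_edges E X)" and fin: "finite X" and mcs: "mcs_order E X num"
    and E: "\<And>e. e \<in> E \<Longrightarrow> \<exists>x y. e = {x, y} \<and> x \<noteq> y"
  shows "insertion_order E X num"
  unfolding insertion_order_def clique_def
proof (intro conjI ballI impI)
  show "inj_on num X" using mcs by (simp add: mcs_order_def)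
next
  fix u a b assume u: "u \<in> X" and a: "a \<in> prior E X num u (num u)"
    and b: "b \<in> prior E X num u (num u)" and ab: "a \<noteq> b"
  show "adj E a b"
  proof (rule ccontr)
    assume nab: "\<not> adj E a b"
    have "a \<noteq> u" "b \<noteq> u" using a b by (auto simp: prior_def)
    have "induced_path E X [a, u, b]"
      unfolding induced_path_def
    proof (intro conjI allI impI)
      show "distinct [a, u, b]" "set [a, u, b] \<subseteq> X"
        using u a b ab by (auto simp: prior_def)
    next
      fix i j assume "i < j \<and> j < length [a, u, b]"
      then have "i = 0 \<and> j = 1 \<or> i = 0 \<and> j = 2 \<or> i = 1 \<and> j = 2" by auto
      moreover have "adj E a u" "adj E u b" using a b adj_sym[of E a u] by (auto simp: prior_def)
      ultimately show "adj E ([a, u, b] ! i) ([a, u, b] ! j) = (j = Suc i)"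
        using nab by auto
    qed
    moreover have "num ([a, u, b] ! i) > max (num (hd [a, u, b])) (num (last [a, u, b]))"
      if "0 < i" "i < length [a, u, b] - 1" for i
    proof -
      have "i = 1" using that by auto
      then show ?thesis using a b by (auto simp: prior_def)
    qed
    ultimately show False using chordal_no_bad_path[OF ch fin mcs E, of "[a, u, b]"] by auto
  qed
qed

section \<open>Connected sets and searches with connected initial segments\<close>

definition conn_if :: "bool \<Rightarrow> 'a set set \<Rightarrow> 'a set \<Rightarrow> bool" where
  "conn_if cn E X \<longleftrightarrow> (cn \<longrightarrow> connected_graph X (induced_edges E X))"

definition linked :: "bool \<Rightarrow> 'a set set \<Rightarrow> 'a \<Rightarrow> 'a \<Rightarrow> bool" where
  "linked cn E u v \<longleftrightarrow> (cn \<longrightarrow> adj E u v)"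

lemma conn_if_empty [simp]: "conn_if cn E {}"
  by (simp add: conn_if_def connected_graph_def)

lemma conn_if_singleton [simp]: "conn_if cn E {v}"
  by (simp add: conn_if_def connected_graph_def)

lemma conn_if_insert:
  assumes "conn_if cn E X" "x \<in> X" "linked cn E x w"
  shows "conn_if cn E (insert w X)"
  unfolding conn_if_def connected_graph_def
proof (intro impI ballI)
  fix u v assume cn: cn and u: "u \<in> insert w X" and v: "v \<in> insert w X"
  let ?r = "{(a, b). a \<in> insert w X \<and> b \<in> insert w X \<and> {a, b} \<in> induced_edges E (insert w X)}"
  let ?q = "{(a, b). a \<in> X \<and> b \<in> X \<and> {a, b} \<in> induced_edges E X}"
  have sub: "?q\<^sup>* \<subseteq> ?r\<^sup>*" by (rule rtrancl_mono) (auto simp: induced_edges_def)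
  have "(a, b) \<in> ?q\<^sup>*" if "a \<in> X" "b \<in> X" for a b
    using assms(1) cn that by (auto simp: conn_if_def connected_graph_def)
  then have old: "(a, b) \<in> ?r\<^sup>*" if "a \<in> X" "b \<in> X" for a b using sub that by blast
  have "{x, w} \<in> E" using assms(3) cn by (auto simp: linked_def adj_def)
  moreover from this have "{w, x} \<in> E" by (simp add: insert_commute)
  ultimately have "(x, w) \<in> ?r" "(w, x) \<in> ?r"
    using assms(2) unfolding induced_edges_def by blast+
  then have xw: "(x, w) \<in> ?r\<^sup>*" "(w, x) \<in> ?r\<^sup>*" by blast+
  have "(u, x) \<in> ?r\<^sup>*" using u old[of u x] assms(2) xw by auto
  moreover have "(x, v) \<in> ?r\<^sup>*" using v old[of x v] assms(2) xw by auto
  ultimately show "(u, v) \<in> ?r\<^sup>*" by (rule rtrancl_trans)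
qed

text \<open>A walk within \<open>Y\<close> from \<open>x\<close> to a vertex outside
  \<open>X\<close> leaves \<open>X\<close> along some edge. Without the connectedness requirement,
  \<open>x\<close> and that vertex already form a linked pair.\<close>

lemma conn_if_boundary:
  assumes "conn_if cn E Y" "x \<in> X" "x \<in> Y" "\<not> Y \<subseteq> X"
  obtains u w where "u \<in> X" "u \<in> Y" "w \<in> Y" "w \<notin> X" "linked cn E u w"
proof -
  obtain y where y: "y \<in> Y" "y \<notin> X" using assms(4) by blast
  have "\<exists>u w. u \<in> X \<and> u \<in> Y \<and> w \<in> Y \<and> w \<notin> X \<and> linked cn E u w"
  proof (cases cn)
    case False then show ?thesis using assms y by (auto simp: linked_def)
  next
    case True
    let ?r = "{(a, b). a \<in> Y \<and> b \<in> Y \<and> {a, b} \<in> induced_edges E Y}"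
    have "(x, y) \<in> ?r\<^sup>*" using assms y True by (auto simp: conn_if_def connected_graph_def)
    \<comment> \<open>Induction along the walk; being conditional, the claim is void as long as the
      walk stays inside \<open>X\<close>.\<close>
    then have "y \<notin> X \<Longrightarrow> ?thesis"
    proof (induction rule: rtrancl_induct)
      case base then show ?case using assms by blast
    next
      case (step a b)
      show ?case
      proof (cases "a \<in> X")
        case True
        then have "linked cn E a b" using step by (auto simp: linked_def adj_def induced_edges_def)
        then show ?thesis using True step by blast
      qed (use step in blast)
    qed
    then show ?thesis using y by blast
  qed
  then show thesis using that by blast
qed

text \<open>The search runs one vertex at a time. Connectedness of the segments needs no extra
  choice: in a connected \<open>X\<close> some unvisited vertex has a visited neighbour, so the
  maximizing vertex has one too.\<close>

lemma mcs_list_exists: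
  assumes "finite X" "conn_if cn E X" "k \<le> card X"
  shows "\<exists>vs. distinct vs \<and> set vs \<subseteq> X \<and> length vs = k \<and>
     (\<forall>i<k. \<forall>v\<in>X - set (take i vs).
        card {w \<in> set (take i vs). adj E v w} \<le> card {w \<in> set (take i vs). adj E (vs ! i) w}) \<and>
     (\<forall>i\<le>k. conn_if cn E (set (take i vs)))"
  using assms(3)
proof (induction k)
  case 0 then show ?case by (intro exI[of _ "[]"]) auto
next
  case (Suc k)
  then obtain vs where vs: "distinct vs" "set vs \<subseteq> X" "length vs = k"
    "\<forall>i<k. \<forall>v\<in>X - set (take i vs).
      card {w \<in> set (take i vs). adj E v w} \<le> card {w \<in> set (take i vs). adj E (vs ! i) w}"
    "\<forall>i\<le>k. conn_if cn E (set (take i vs))" by auto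
  let ?c = "\<lambda>v. card {w \<in> set vs. adj E v w}"
  have "card (set vs) < card X" using vs Suc by (simp add: distinct_card)
  then have ne: "X - set vs \<noteq> {}"
    using card_mono[of "set vs" X] by auto
  have fin: "finite (?c ` (X - set vs))" using assms(1) by simp
  then have "Max (?c ` (X - set vs)) \<in> ?c ` (X - set vs)" using ne by (intro Max_in) auto
  then obtain v where v: "v \<in> X - set vs" "?c v = Max (?c ` (X - set vs))" by auto
  have vmax: "?c w \<le> ?c v" if "w \<in> X - set vs" for w
    unfolding v(2) using that fin by (intro Max_ge) auto
  have cv: "conn_if cn E (set vs)" using vs(3,5) by (metis le_refl take_all)
  have "conn_if cn E (insert v (set vs))"
  proof (cases "vs = []")
    case True then show ?thesis by simp
  next
    case False
    then have "hd vs \<in> set vs" "hd vs \<in> X" "\<not> X \<subseteq> set vs" using vs(2) v(1) by auto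
    then obtain u w where uw: "u \<in> set vs" "w \<in> X" "w \<notin> set vs" "linked cn E u w"
      by (rule conn_if_boundary[OF assms(2)])
    show ?thesis
    proof (cases cn)
      case True
      then have "u \<in> {x \<in> set vs. adj E w x}" using uw adj_sym[of E u w] by (auto simp: linked_def)
      then have "0 < ?c w" by (auto simp: card_gt_0_iff)
      also have "?c w \<le> ?c v" using vmax[of w] uw by auto
      finally have "{x \<in> set vs. adj E v x} \<noteq> {}" by (auto simp: card_gt_0_iff)
      then obtain x where "x \<in> set vs" "adj E v x" by blast
      then show ?thesis using cv conn_if_insert[of cn E "set vs" x v] adj_sym[of E v x]
        by (auto simp: linked_def)
    qed (auto simp: conn_if_def)
  qed
  moreover have "set (take i (vs @ [v])) = (if i \<le> k then set (take i vs) else insert v (set vs))" for i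
    using vs(3) by auto
  ultimately show ?case
    using vs v vmax
    by (intro exI[of _ "vs @ [v]"]) (auto simp: nth_append less_Suc_eq le_Suc_eq)
qed

lemma mcs_order_exists:
  assumes "finite X" "conn_if cn E X"
  shows "\<exists>num. mcs_order E X num \<and> (\<forall>x\<in>X. conn_if cn E {y \<in> X. num y \<le> num x})"
proof -
  obtain vs where vs: "distinct vs" "set vs \<subseteq> X" "length vs = card X"
    "\<forall>i<card X. \<forall>v\<in>X - set (take i vs).
      card {w \<in> set (take i vs). adj E v w} \<le> card {w \<in> set (take i vs). adj E (vs ! i) w}"
    "\<forall>i\<le>card X. conn_if cn E (set (take i vs))"
    using mcs_list_exists[OF assms order_refl] by auto
  have svs: "set vs = X" using vs assms(1) by (metis card_subset_eq distinct_card)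
  define num where "num = inv_into {..<length vs} ((!) vs)"
  have num: "num (vs ! i) = i" if "i < length vs" for i
    unfolding num_def using that vs(1) by (intro inv_into_f_f) (auto simp: inj_on_nth)
  have ex: "\<exists>i<length vs. x = vs ! i" if "x \<in> X" for x using that svs by (metis in_set_conv_nth)
  \<comment> \<open>Passes between the two descriptions of the visited set: a prefix of the list and
    a threshold on the numbers.\<close>
  have tk: "set (take i vs) = {y \<in> X. num y < i}" if "i \<le> length vs" for i
  proof -
    have "set (take i vs) = (!) vs ` {..<i}" using that
      by (metis atLeast0LessThan nth_image)
    also have "\<dots> = {y \<in> X. num y < i}" using that num ex svs by (force simp: image_def)
    finally show ?thesis .
  qed
  have "inj_on num X" using num ex by (metis inj_onI)
  moreover have "card (prior E X num v (num u)) \<le> card (prior E X num u (num u))"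
    if "u \<in> X" "v \<in> X" "num u \<le> num v" for u v
  proof -
    obtain i where i: "i < length vs" "u = vs ! i" using ex \<open>u \<in> X\<close> by blast
    have "prior E X num w (num u) = {x \<in> set (take i vs). adj E w x}" for w
      using tk[of i] i num by (auto simp: prior_def)
    moreover have "v \<in> X - set (take i vs)" using tk[of i] i num that by auto
    ultimately show ?thesis using vs i by simp
  qed
  moreover have "conn_if cn E {y \<in> X. num y \<le> num x}" if "x \<in> X" for x
  proof -
    obtain i where i: "i < length vs" "x = vs ! i" using ex \<open>x \<in> X\<close> by blast
    then have "{y \<in> X. num y \<le> num x} = set (take (Suc i) vs)" using tk[of "Suc i"] num by auto
    then show ?thesis using vs i by simp
  qed
  ultimately show ?thesis unfolding mcs_order_def by blast
qed

section \<open>Solutions, candidates and proximity\<close>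

definition feasible :: "bool \<Rightarrow> 'a set \<Rightarrow> 'a set set \<Rightarrow> 'a set \<Rightarrow> bool" where
  "feasible cn V E S \<longleftrightarrow> induced_chordal V E S \<and> conn_if cn E S"

text \<open>\<open>a\<close> guesses which neighbour of \<open>v\<close> in the segment comes last
  in the order of \<open>S\<close>. The choice \<open>a = v\<close> stands for having no such
  neighbour; when \<open>v\<close> carries number 0, the default outside \<open>S\<close>, it lets
  no neighbour of \<open>v\<close> through.\<close>

definition candidate :: "'a set set \<Rightarrow> 'a set \<Rightarrow> ('a \<Rightarrow> nat) \<Rightarrow> 'a \<Rightarrow> 'a \<Rightarrow> 'a set" where
  "candidate E S num v a =
     insert v {b \<in> S. adj E v b \<longrightarrow> b = a \<or> adj E a b \<and> num b < num a}"

text \<open>Insert \<open>v\<close> after all of \<open>S\<close>. Its remaining neighbours are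
  \<open>a\<close> and earlier neighbours of \<open>a\<close>, a clique; every other vertex can only
  have lost earlier neighbours.\<close>

lemma candidate_chordal:
  assumes "insertion_order E S num" "finite S" "v \<notin> S" "a \<in> S \<or> num a = 0"
  shows "chordal (induced_edges E (candidate E S num v a))"
proof -
  \<comment> \<open>The inserted 0 makes the maximum meaningful when \<open>S\<close> is
    empty.\<close>
  define k where "k = Suc (Max (insert 0 (num ` S)))"
  have k: "num x < k" if "x \<in> S" for x
    using that assms(2) by (simp add: k_def less_Suc_eq_le)
  define f where "f = num(v := k)"
  let ?T = "candidate E S num v a"
  have inj: "inj_on num S" and cl: "\<And>u. u \<in> S \<Longrightarrow> clique E (prior E S num u (num u))"
    using assms(1) by (auto simp: insertion_order_def)
  have fS: "f x = num x" if "x \<in> S" for x using that assms(3) by (auto simp: f_def)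
  have "inj_on f ?T"
  proof (rule inj_on_subset)
    have "inj_on f S" using inj fS by (simp add: inj_on_def)
    moreover have "f v \<notin> f ` S" using fS k by (auto simp: f_def)
    ultimately show "inj_on f (insert v S)" by auto
  qed (auto simp: candidate_def)
  moreover have "clique E (prior E ?T f u (f u))" if u: "u \<in> ?T" for u
  proof (cases "u = v")
    case False
    then have uS: "u \<in> S" using u by (auto simp: candidate_def)
    have "prior E ?T f u (f u) \<subseteq> prior E S num u (num u)"
      using uS fS k by (fastforce simp: prior_def candidate_def f_def)
    then show ?thesis using cl[OF uS] by (auto simp: clique_def)
  next
    case True
    have "prior E ?T f v (f v) \<subseteq> {b \<in> S. b = a \<or> adj E a b \<and> num b < num a}"
      by (auto simp: prior_def candidate_def)
    moreover have "clique E {b \<in> S. b = a \<or> adj E a b \<and> num b < num a}"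
    proof (cases "a \<in> S")
      case True
      then show ?thesis using cl[OF True] adj_sym[of E] by (auto simp: clique_def prior_def)
    next
      \<comment> \<open>Here \<open>a\<close> has number 0, so no vertex precedes it and the set is
        empty.\<close>
      case False then show ?thesis using assms(4) by (auto simp: clique_def)
    qed
    ultimately show ?thesis unfolding True clique_def by blast
  qed
  ultimately show ?thesis by (intro insertion_order_chordal) (auto simp: insertion_order_def)
qed

text \<open>Chosen once for each set, so that proximity is a function of the two solutions.\<close>

definition prefix_order :: "bool \<Rightarrow> 'a set set \<Rightarrow> 'a set \<Rightarrow> 'a \<Rightarrow> nat" where
  "prefix_order cn E X = (SOME num. mcs_order E X num \<and> (\<forall>x\<in>X. conn_if cn E {y \<in> X. num y \<le> num x}))"

definition proximity :: "bool \<Rightarrow> 'a set set \<Rightarrow> 'a set \<Rightarrow> 'a set \<Rightarrow> 'a set" where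
  "proximity cn E S S' =
     {x \<in> S'. \<forall>y\<in>S'. prefix_order cn E S' y \<le> prefix_order cn E S' x \<longrightarrow> y \<in> S}"

text \<open>The order \<open>f\<close> of \<open>S'\<close> yields the first missing vertex
  \<open>v\<close> and the segment \<open>P\<close> ending in it; the order \<open>num\<close> of
  \<open>S\<close> is used to pick out \<open>a\<close> in the clique \<open>K\<close>. A connected
  \<open>P\<close> through \<open>v\<close> inside the candidate is contained in \<open>R\<close> by
  assumption, so the segment grows by at least \<open>v\<close>.\<close>

lemma proximity_increases:
  assumes fin: "finite V" and E: "\<And>e. e \<in> E \<Longrightarrow> \<exists>x y. e = {x, y} \<and> x \<noteq> y"
    and S: "inclusion_maximal (feasible cn V E) S" and S': "inclusion_maximal (feasible cn V E) S'"
    and ne: "S \<noteq> S'" and inj: "inj_on num S"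
    and nb: "\<And>v a. v \<in> V \<Longrightarrow> v \<notin> S \<Longrightarrow> a = v \<or> a \<in> S \<and> adj E v a \<Longrightarrow>
       \<exists>R\<in>N. \<forall>P. v \<in> P \<and> P \<subseteq> candidate E S num v a \<and> conn_if cn E P \<longrightarrow> P \<subseteq> R"
  shows "\<exists>R\<in>N. card (proximity cn E S S') < card (proximity cn E R S')"
proof -
  have SV': "S' \<subseteq> V" and ch': "chordal (induced_edges E S')" and cn': "conn_if cn E S'"
    using S' by (auto simp: inclusion_maximal_def feasible_def induced_chordal_def)
  have fS': "finite S'" using SV' fin by (rule finite_subset)
  define f where "f = prefix_order cn E S'"
  have f: "mcs_order E S' f \<and> (\<forall>x\<in>S'. conn_if cn E {y \<in> S'. f y \<le> f x})"
    unfolding f_def prefix_order_def by (rule someI_ex[OF mcs_order_exists[OF fS' cn']])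
  then have io: "insertion_order E S' f" using mcs_insertion_order[OF ch' fS' _ E] by blast
  \<comment> \<open>Otherwise maximality of \<open>S'\<close> would force equality; hence some
    vertex of \<open>S'\<close> is missing from \<open>S\<close>.\<close>
  have "\<not> S' \<subseteq> S" using S S' ne unfolding inclusion_maximal_def by blast
  then have ex: "\<exists>k. \<exists>x\<in>S' - S. f x = k" by blast
  define k where "k = (LEAST k. \<exists>x\<in>S' - S. f x = k)"
  obtain v where v: "v \<in> S'" "v \<notin> S" "f v = k" using LeastI_ex[OF ex] by (auto simp: k_def)
  have min: "f x \<ge> k" if "x \<in> S'" "x \<notin> S" for x
    unfolding k_def using that by (intro Least_le) auto
  define P where "P = {y \<in> S'. f y \<le> f v}"
  have injf: "inj_on f S'" using io by (simp add: insertion_order_def)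
  have PS: "y \<in> S" if "y \<in> P" "y \<noteq> v" for y
    using that min[of y] v injf by (force simp: P_def inj_on_def)
  have PC: "conn_if cn E P" using f v by (auto simp: P_def)
  define K where "K = prior E S' f v (f v)"
  have "K \<subseteq> S"
  proof
    fix y assume "y \<in> K"
    then have "y \<in> P" "y \<noteq> v" by (auto simp: K_def prior_def P_def)
    then show "y \<in> S" by (rule PS)
  qed
  then have K: "K \<subseteq> S" "clique E K" "finite K"
    using io v(1) fS' by (auto simp: K_def prior_def insertion_order_def)
  have KP: "y \<in> K" if "y \<in> P" "adj E v y" for y
  proof -
    have "y \<noteq> v" using that(2) by auto
    then have "f y \<noteq> f v" using injf v(1) that(1) by (auto simp: P_def dest: inj_onD)
    then show ?thesis using that by (auto simp: K_def prior_def P_def)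
  qed
  have "\<exists>a. (a = v \<or> a \<in> S \<and> adj E v a) \<and> P \<subseteq> candidate E S num v a"
  proof (cases "K = {}")
    case True
    then show ?thesis using KP PS by (intro exI[of _ v]) (auto simp: candidate_def)
  next
    case False
    \<comment> \<open>\<open>K\<close> is a clique, so its vertex with the largest number in the
      order of \<open>S\<close> is adjacent to all the others, which precede it there. This is the
      form required by \<open>candidate\<close>.\<close>
    then have "Max (num ` K) \<in> num ` K" using K by (intro Max_in) auto
    then obtain a where a: "a \<in> K" "num a = Max (num ` K)" by auto
    have "b = a \<or> adj E a b \<and> num b < num a" if "b \<in> K" for b
    proof (cases "b = a")
      case False
      have "num b \<le> num a" unfolding a(2) using that K(3) by simp
      moreover have "num b \<noteq> num a" using inj False that a(1) K(1) by (auto dest: inj_onD)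
      ultimately show ?thesis using K(2) that a(1) False by (auto simp: clique_def)
    qed simp
    then have "P \<subseteq> candidate E S num v a" using KP PS by (auto simp: candidate_def)
    moreover have "a \<in> S \<and> adj E v a" using a K by (auto simp: K_def prior_def)
    ultimately show ?thesis by blast
  qed
  then obtain a where a: "a = v \<or> a \<in> S \<and> adj E v a" "P \<subseteq> candidate E S num v a" by blast
  have "v \<in> V" "v \<in> P" using v SV' by (auto simp: P_def)
  obtain R where R': "R \<in> N"
    "\<forall>P. v \<in> P \<and> P \<subseteq> candidate E S num v a \<and> conn_if cn E P \<longrightarrow> P \<subseteq> R"
    using nb[OF \<open>v \<in> V\<close> v(2) a(1)] by blast
  then have R: "R \<in> N" "P \<subseteq> R" using \<open>v \<in> P\<close> PC a(2) by simp_all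
  have "proximity cn E S S' \<subseteq> P" 
  proof
    fix x assume "x \<in> proximity cn E S S'"
    then have "x \<in> S'" "f v \<le> f x \<Longrightarrow> v \<in> S" using v(1) by (auto simp: proximity_def f_def)
    then have "x \<in> S'" "\<not> f v \<le> f x" using v(2) by blast+
    then show "x \<in> P" by (simp add: P_def)
  qed
  moreover have "v \<notin> proximity cn E S S'" using v by (auto simp: proximity_def)
  moreover have "P \<subseteq> proximity cn E R S'"
  proof
    fix x assume x: "x \<in> P"
    then have "y \<in> R" if "y \<in> S'" "f y \<le> f x" for y
      using that R(2) by (auto simp: P_def)
    then show "x \<in> proximity cn E R S'" using x by (auto simp: proximity_def f_def P_def)
  qed
  moreover have "v \<in> P" using v by (simp add: P_def)
  ultimately have "proximity cn E S S' \<subset> proximity cn E R S'" by blast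
  moreover have "finite (proximity cn E R S')" using fS' by (simp add: proximity_def)
  ultimately have "card (proximity cn E S S') < card (proximity cn E R S')"
    by (rule psubset_card_mono[rotated])
  then show ?thesis using R(1) by blast
qed

section \<open>Reasoning about programs with time bounds\<close>

notation Seq (infixr ";;" 60)

definition visible :: "event list \<Rightarrow> event list" where
  "visible t = filter (\<lambda>e. e \<noteq> Step) t"

lemma visible_simps [simp]:
  "visible [] = []" "visible (Step # t) = visible t" "visible (Word k # t) = Word k # visible t"
  "visible (End # t) = End # visible t" "visible (t @ u) = visible t @ visible u"
  by (simp_all add: visible_def)

text \<open>Total correctness with a time bound. One execution suffices because execution is
  deterministic. The postcondition sees the trace without its \<open>Step\<close> events.\<close>

definition wp :: "com \<Rightarrow> state \<Rightarrow> nat \<Rightarrow> (state \<Rightarrow> event list \<Rightarrow> bool) \<Rightarrow> bool" where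
  "wp c s k Q \<longleftrightarrow> (\<exists>t s'. exec c s t s' \<and> length t \<le> k \<and> Q s' (visible t))"

text \<open>The version for silent code, which covers everything except the output routines.\<close>

definition ex :: "com \<Rightarrow> state \<Rightarrow> nat \<Rightarrow> (state \<Rightarrow> bool) \<Rightarrow> bool" where
  "ex c s k Q \<longleftrightarrow> wp c s k (\<lambda>s' es. es = [] \<and> Q s')"

primrec regs_of :: "com \<Rightarrow> string set" where
  "regs_of Skip = {}"
| "regs_of (Assign x e) = {x}"
| "regs_of (Put a i e) = {}"
| "regs_of (Out e) = {}"
| "regs_of Close = {}"
| "regs_of (c ;; d) = regs_of c \<union> regs_of d"
| "regs_of (If b c d) = regs_of c \<union> regs_of d"
| "regs_of (While b c) = regs_of c"

primrec arrs_of :: "com \<Rightarrow> string set" where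
  "arrs_of Skip = {}"
| "arrs_of (Assign x e) = {}"
| "arrs_of (Put a i e) = {a}"
| "arrs_of (Out e) = {}"
| "arrs_of Close = {}"
| "arrs_of (c ;; d) = arrs_of c \<union> arrs_of d"
| "arrs_of (If b c d) = arrs_of c \<union> arrs_of d"
| "arrs_of (While b c) = arrs_of c"

text \<open>A frame condition computed from the program text. It spares every postcondition the
  listing of untouched registers and arrays.\<close>

definition unchanged :: "com \<Rightarrow> state \<Rightarrow> state \<Rightarrow> bool" where
  "unchanged c s s' \<longleftrightarrow> (\<forall>x. x \<notin> regs_of c \<longrightarrow> reg s' x = reg s x) \<and>
     (\<forall>a. a \<notin> arrs_of c \<longrightarrow> arr s' a = arr s a)"

lemma unchanged_refl [simp]: "unchanged c s s"
  by (simp add: unchanged_def)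

lemma exec_unchanged: "exec c s t s' \<Longrightarrow> unchanged c s s'"
  by (induction rule: exec.induct) (auto simp: unchanged_def)

text \<open>Silent code without loops is a state transformer, so such blocks are verified by
  simplifying \<open>effect\<close> and \<open>cost\<close>. On the excluded constructs the values
  of these functions are placeholders.\<close>

primrec straight :: "com \<Rightarrow> bool" where
  "straight Skip = True"
| "straight (Assign x e) = True"
| "straight (Put a i e) = True"
| "straight (Out e) = False"
| "straight Close = False"
| "straight (c ;; d) = (straight c \<and> straight d)"
| "straight (If b c d) = (straight c \<and> straight d)"
| "straight (While b c) = False"

primrec effect :: "com \<Rightarrow> state \<Rightarrow> state" where
  "effect Skip s = s"
| "effect (Assign x e) s = s\<lparr>reg := (reg s)(x := aval e s)\<rparr>"
| "effect (Put a i e) s = s\<lparr>arr := (arr s)(a := (arr s a)(aval i s := aval e s))\<rparr>"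
| "effect (Out e) s = s"
| "effect Close s = s"
| "effect (c ;; d) s = effect d (effect c s)"
| "effect (If b c d) s = (if bval b s then effect c s else effect d s)"
| "effect (While b c) s = s"

primrec cost :: "com \<Rightarrow> nat" where
  "cost Skip = 1"
| "cost (Assign x e) = 1"
| "cost (Put a i e) = 1"
| "cost (Out e) = 1"
| "cost Close = 1"
| "cost (c ;; d) = cost c + cost d"
| "cost (If b c d) = Suc (max (cost c) (cost d))"
| "cost (While b c) = 1"

lemma exec_straight: "straight c \<Longrightarrow> \<exists>t. exec c s t (effect c s) \<and> length t \<le> cost c \<and> visible t = []"
proof (induction c arbitrary: s)
  case Skip then show ?case using exec.Skip by fastforce
next
  case (Assign x e) then show ?case using exec.Assign by fastforce
next
  case (Put a i e) then show ?case using exec.Put by fastforce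
next
  case (Seq c d)
  obtain t where t: "exec c s t (effect c s)" "length t \<le> cost c" "visible t = []"
    using Seq by fastforce
  obtain u where u: "exec d (effect c s) u (effect d (effect c s))" "length u \<le> cost d" "visible u = []"
    using Seq by fastforce
  show ?case using exec.Seq[OF t(1) u(1)] t u by (intro exI[of _ "t @ u"]) auto
next
  case (If b c d)
  obtain t where t: "exec c s t (effect c s)" "length t \<le> cost c" "visible t = []"
    using If by fastforce
  obtain u where u: "exec d s u (effect d s)" "length u \<le> cost d" "visible u = []"
    using If by fastforce
  show ?case
  proof (cases "bval b s")
    case True
    then show ?thesis using exec.IfTrue[OF True t(1)] t by (intro exI[of _ "Step # t"]) auto
  next
    case False
    then show ?thesis using exec.IfFalse[OF False u(1)] u by (intro exI[of _ "Step # u"]) auto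
  qed
qed auto

lemma wp_straight: "straight c \<Longrightarrow> cost c \<le> k \<Longrightarrow> Q (effect c s) [] \<Longrightarrow> wp c s k Q"
  unfolding wp_def using exec_straight[of c s] by (metis le_trans)

text \<open>Weakening hands over the frame relation for free; this is how facts about untouched data
  reach the next step.\<close>

lemma wp_conseq: "wp c s k Q \<Longrightarrow> k \<le> k' \<Longrightarrow> (\<And>t es. Q t es \<Longrightarrow> unchanged c s t \<Longrightarrow> Q' t es) \<Longrightarrow> wp c s k' Q'"
  unfolding wp_def using exec_unchanged by (meson le_trans)

lemma wp_Seq:
  assumes "wp c s k (\<lambda>t es. wp d t l (\<lambda>u fs. Q u (es @ fs)))"
  shows "wp (c ;; d) s (k + l) Q"
proof -
  obtain t s' where t: "exec c s t s'" "length t \<le> k" "wp d s' l (\<lambda>u fs. Q u (visible t @ fs))"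
    using assms unfolding wp_def by metis
  then obtain u s'' where u: "exec d s' u s''" "length u \<le> l" "Q s'' (visible t @ visible u)"
    unfolding wp_def by blast
  show ?thesis unfolding wp_def
    using exec.Seq[OF t(1) u(1)] t u by (intro exI[of _ "t @ u"] exI[of _ s'']) auto
qed

lemma wp_If:
  assumes "bval b s \<Longrightarrow> wp c s k Q" "\<not> bval b s \<Longrightarrow> wp d s k Q"
  shows "wp (If b c d) s (Suc k) Q"
proof (cases "bval b s")
  case True
  then obtain t s' where "exec c s t s'" "length t \<le> k" "Q s' (visible t)"
    using assms unfolding wp_def by blast
  then show ?thesis unfolding wp_def using exec.IfTrue[OF True]
    by (intro exI[of _ "Step # t"] exI[of _ s']) auto
next
  case False
  then obtain t s' where "exec d s t s'" "length t \<le> k" "Q s' (visible t)"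
    using assms unfolding wp_def by blast
  then show ?thesis unfolding wp_def using exec.IfFalse[OF False]
    by (intro exI[of _ "Step # t"] exI[of _ s']) auto
qed

text \<open>The potential \<open>\<Phi>\<close> pays for the loop body and its test.\<close>

lemma wp_While:
  assumes "I s es"
    and "\<And>t es. I t es \<Longrightarrow> bval b t \<Longrightarrow> unchanged c s t \<Longrightarrow>
      \<exists>k. wp c t k (\<lambda>t' fs. I t' (es @ fs) \<and> \<Phi> t' + Suc k \<le> \<Phi> t)"
    and "\<And>t es. I t es \<Longrightarrow> \<not> bval b t \<Longrightarrow> unchanged c s t \<Longrightarrow> Q t es"
  shows "wp (While b c) s (Suc (\<Phi> s)) (\<lambda>t fs. Q t (es @ fs))"
proof -
  have "wp (While b c) t (Suc (\<Phi> t)) (\<lambda>u fs. Q u (es @ fs))" if "I t es" "unchanged c s t" for t es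
    using that
  proof (induction "\<Phi> t" arbitrary: t es rule: less_induct)
    case less
    show ?case
    proof (cases "bval b t")
      case False
      have "Q t es" using assms(3) less False by blast
      then show ?thesis unfolding wp_def using exec.WhileFalse[OF False]
        by (intro exI[of _ "[Step]"] exI[of _ t]) auto
    next
      case True
      obtain k where "wp c t k (\<lambda>t' fs. I t' (es @ fs) \<and> \<Phi> t' + Suc k \<le> \<Phi> t)"
        using assms(2) less True by blast
      then obtain tr u where u: "exec c t tr u" "length tr \<le> k" "I u (es @ visible tr)"
        "\<Phi> u + Suc k \<le> \<Phi> t" unfolding wp_def by blast
      have "unchanged c s u" using less(3) exec_unchanged[OF u(1)] by (simp add: unchanged_def)
      then have "wp (While b c) u (Suc (\<Phi> u)) (\<lambda>v fs. Q v ((es @ visible tr) @ fs))"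
        using less(1)[of u "es @ visible tr"] u by simp
      then obtain tr' v where v: "exec (While b c) u tr' v" "length tr' \<le> Suc (\<Phi> u)"
        "Q v (es @ visible tr @ visible tr')" unfolding wp_def by auto
      show ?thesis unfolding wp_def using exec.WhileTrue[OF True u(1) v(1)] u v
        by (intro exI[of _ "Step # tr @ tr'"] exI[of _ v]) auto
    qed
  qed
  then show ?thesis using assms(1) by simp
qed

definition For :: "string \<Rightarrow> string \<Rightarrow> com \<Rightarrow> com" where
  "For x y c = Assign x (Const 0) ;;
     While (Less (Var x) (Var y)) (c ;; Assign x (Plus (Var x) (Const 1)))"

lemma For_simps [simp]:
  "regs_of (For x y c) = insert x (regs_of c)" "arrs_of (For x y c) = arrs_of c"
  "straight (For x y c) = False"
  by (auto simp: For_def)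

lemma sum_from_Suc: "i < N \<Longrightarrow> (\<Sum>j=i..<N. f j) = f i + (\<Sum>j=Suc i..<N. f j)" for f :: "nat \<Rightarrow> nat"
  by (rule sum.atLeast_Suc_lessThan)

text \<open>The cost \<open>k i\<close> may vary with the turn, as in the loop over vertices of
  different degree. Each turn adds 2 for the increment and the test; the outer 2 pays for the
  initialization and the last test. The invariant gets the index as an argument and must survive any
  change of the counter register.\<close>

lemma wp_For:
  assumes x: "x \<notin> regs_of c" "y \<notin> regs_of c" "x \<noteq> y" and N: "reg s y = N"
    and I0: "I 0 s es"
    and Ix: "\<And>i t es v. I i t es \<Longrightarrow> I i (t\<lparr>reg := (reg t)(x := v)\<rparr>) es"
    and step: "\<And>i t es. i < N \<Longrightarrow> I i t es \<Longrightarrow> reg t x = i \<Longrightarrow> reg t y = N \<Longrightarrow>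
       unchanged (For x y c) s t \<Longrightarrow> wp c t (k i) (\<lambda>t' fs. I (Suc i) t' (es @ fs))"
    and post: "\<And>t es. I N t es \<Longrightarrow> unchanged (For x y c) s t \<Longrightarrow> Q t es"
  shows "wp (For x y c) s (2 + (\<Sum>i<N. k i + 2)) (\<lambda>t fs. Q t (es @ fs))"
proof -
  let ?c = "c ;; Assign x (Plus (Var x) (Const 1))"
  let ?s = "effect (Assign x (Const 0)) s"
  let ?J = "\<lambda>t es. reg t x \<le> N \<and> reg t y = N \<and> I (reg t x) t es \<and> unchanged (For x y c) s t"
  \<comment> \<open>The time still owed to the remaining turns serves as potential.\<close>
  let ?f = "\<lambda>t. \<Sum>i=reg t x..<N. k i + 2"
  have "wp (While (Less (Var x) (Var y)) ?c) ?s (Suc (?f ?s)) (\<lambda>t fs. Q t (es @ fs))"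
  proof (rule wp_While[where I = ?J])
    show "?J ?s es" using x N I0 Ix[of 0 s es 0] by (auto simp: unchanged_def)
  next
    fix t es assume J: "?J t es" and b: "bval (Less (Var x) (Var y)) t"
    let ?i = "reg t x"
    have i: "?i < N" using J b by simp
    have "wp c t (k ?i) (\<lambda>t' fs. I (Suc ?i) t' (es @ fs))"
      using step i J by simp
    then have "wp c t (k ?i) (\<lambda>u es'. wp (Assign x (Plus (Var x) (Const 1))) u 1
         (\<lambda>t' fs. ?J t' (es @ es' @ fs) \<and> ?f t' + Suc (k ?i + 1) \<le> ?f t))"
    proof (rule wp_conseq)
      fix u es' assume u: "I (Suc ?i) u (es @ es')" "unchanged c t u"
      have r: "reg u x = ?i" "reg u y = N" using u(2) x J by (auto simp: unchanged_def)
      have "unchanged (For x y c) s u" using u(2) J by (auto simp: unchanged_def)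
      then show "wp (Assign x (Plus (Var x) (Const 1))) u 1
         (\<lambda>t' fs. ?J t' (es @ es' @ fs) \<and> ?f t' + Suc (k ?i + 1) \<le> ?f t)"
        using r i x Ix[OF u(1), of "Suc ?i"] sum_from_Suc[OF i, of "\<lambda>i. k i + 2"]
        by (intro wp_straight) (auto simp: unchanged_def)
    qed simp
    then have "wp ?c t (k ?i + 1) (\<lambda>t' fs. ?J t' (es @ fs) \<and> ?f t' + Suc (k ?i + 1) \<le> ?f t)"
      by (intro wp_Seq) simp
    then show "\<exists>k. wp ?c t k (\<lambda>t' fs. ?J t' (es @ fs) \<and> ?f t' + Suc k \<le> ?f t)" by blast
  next
    fix t es assume J: "?J t es" and "\<not> bval (Less (Var x) (Var y)) t"
    then show "Q t es" using post by auto
  qed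
  moreover have "?f ?s = (\<Sum>i<N. k i + 2)" by (simp add: atLeast0LessThan)
  ultimately have "wp (For x y c) s (1 + Suc (\<Sum>i<N. k i + 2)) (\<lambda>t fs. Q t (es @ fs))"
    unfolding For_def by - (rule wp_Seq, rule wp_straight, auto)
  then show ?thesis by simp
qed

lemma ex_straight: "straight c \<Longrightarrow> cost c \<le> k \<Longrightarrow> Q (effect c s) \<Longrightarrow> ex c s k Q"
  unfolding ex_def by (rule wp_straight) auto

lemma ex_conseq: "ex c s k Q \<Longrightarrow> k \<le> k' \<Longrightarrow> (\<And>t. Q t \<Longrightarrow> unchanged c s t \<Longrightarrow> Q' t) \<Longrightarrow> ex c s k' Q'"
  unfolding ex_def by (erule wp_conseq) auto

lemma ex_wp: "ex c s k Q \<Longrightarrow> k \<le> k' \<Longrightarrow> (\<And>t. Q t \<Longrightarrow> unchanged c s t \<Longrightarrow> Q' t []) \<Longrightarrow> wp c s k' Q'"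
  unfolding ex_def by (erule wp_conseq) auto

lemma ex_Seq: "ex c s k (\<lambda>t. ex d t l Q) \<Longrightarrow> ex (c ;; d) s (k + l) Q"
  unfolding ex_def by (rule wp_Seq, erule wp_conseq) auto

lemma wp_Seq_silent: "ex c s k (\<lambda>t. wp d t l Q) \<Longrightarrow> wp (c ;; d) s (k + l) Q"
  unfolding ex_def by (rule wp_Seq, erule wp_conseq) auto

lemma ex_If:
  "(bval b s \<Longrightarrow> ex c s k Q) \<Longrightarrow> (\<not> bval b s \<Longrightarrow> ex d s k Q) \<Longrightarrow> ex (If b c d) s (Suc k) Q"
  unfolding ex_def by (rule wp_If) auto

lemma ex_While:
  assumes "I s"
    and "\<And>t. I t \<Longrightarrow> bval b t \<Longrightarrow> unchanged c s t \<Longrightarrow>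
      \<exists>k. ex c t k (\<lambda>t'. I t' \<and> \<Phi> t' + Suc k \<le> \<Phi> t)"
    and "\<And>t. I t \<Longrightarrow> \<not> bval b t \<Longrightarrow> unchanged c s t \<Longrightarrow> Q t"
  shows "ex (While b c) s (Suc (\<Phi> s)) Q"
proof -
  have "wp (While b c) s (Suc (\<Phi> s)) (\<lambda>t fs. [] @ fs = [] \<and> Q t)"
  proof (rule wp_While[where I = "\<lambda>t es. es = [] \<and> I t" and Q = "\<lambda>t es. es = [] \<and> Q t"])
    fix t and es :: "event list" assume t: "es = [] \<and> I t" "bval b t" "unchanged c s t"
    then obtain k where "ex c t k (\<lambda>t'. I t' \<and> \<Phi> t' + Suc k \<le> \<Phi> t)" using assms(2) by blast
    then have "wp c t k (\<lambda>t' fs. (es @ fs = [] \<and> I t') \<and> \<Phi> t' + Suc k \<le> \<Phi> t)"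
      by (rule ex_wp) (use t in auto)
    then show "\<exists>k. wp c t k (\<lambda>t' fs. (es @ fs = [] \<and> I t') \<and> \<Phi> t' + Suc k \<le> \<Phi> t)" by blast
  qed (use assms in auto)
  then show ?thesis by (simp add: ex_def)
qed

lemma ex_For:
  assumes "x \<notin> regs_of c" "y \<notin> regs_of c" "x \<noteq> y" "reg s y = N"
    and "I 0 s"
    and "\<And>i t v. I i t \<Longrightarrow> I i (t\<lparr>reg := (reg t)(x := v)\<rparr>)"
    and "\<And>i t. i < N \<Longrightarrow> I i t \<Longrightarrow> reg t x = i \<Longrightarrow> reg t y = N \<Longrightarrow>
       unchanged (For x y c) s t \<Longrightarrow> ex c t (k i) (\<lambda>t'. I (Suc i) t')"
    and "\<And>t. I N t \<Longrightarrow> unchanged (For x y c) s t \<Longrightarrow> Q t"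
  shows "ex (For x y c) s (2 + (\<Sum>i<N. k i + 2)) Q"
proof -
  have "wp (For x y c) s (2 + (\<Sum>i<N. k i + 2)) (\<lambda>t fs. [] @ fs = [] \<and> Q t)"
  proof (rule wp_For[where I = "\<lambda>i t es. es = [] \<and> I i t" and Q = "\<lambda>t es. es = [] \<and> Q t",
        OF assms(1-4)])
    fix i t and es :: "event list" assume t: "i < N" "es = [] \<and> I i t" "reg t x = i" "reg t y = N"
      "unchanged (For x y c) s t"
    then have "ex c t (k i) (I (Suc i))" using assms(7) by blast
    then show "wp c t (k i) (\<lambda>t' fs. es @ fs = [] \<and> I (Suc i) t')"
      by (rule ex_wp) (use t in auto)
  qed (use assms in auto)
  then show ?thesis by (simp add: ex_def)
qed

lemma ex_For_const:
  assumes "x \<notin> regs_of c" "y \<notin> regs_of c" "x \<noteq> y" "reg s y = N"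
    and "I 0 s"
    and "\<And>i t v. I i t \<Longrightarrow> I i (t\<lparr>reg := (reg t)(x := v)\<rparr>)"
    and "\<And>i t. i < N \<Longrightarrow> I i t \<Longrightarrow> reg t x = i \<Longrightarrow> reg t y = N \<Longrightarrow>
       unchanged (For x y c) s t \<Longrightarrow> ex c t k (\<lambda>t'. I (Suc i) t')"
    and "\<And>t. I N t \<Longrightarrow> unchanged (For x y c) s t \<Longrightarrow> Q t"
  shows "ex (For x y c) s (2 + N * (k + 2)) Q"
proof -
  have "ex (For x y c) s (2 + (\<Sum>i<N. k + 2)) Q"
    by (rule ex_For[where I = I and k = "\<lambda>_. k", OF assms(1-4)]) (use assms in auto)
  then show ?thesis by simp
qed

section \<open>Traces\<close>

lemma segments_nonempty [simp]: "segments t \<noteq> []"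
  by (induction t rule: segments.induct) auto

lemma segments_append:
  "segments (t @ u) = butlast (segments t) @ (last (segments t) @ hd (segments u)) # tl (segments u)"
proof (induction t rule: segments.induct)
  case 1
  have "segments u = hd (segments u) # tl (segments u)" by simp
  then show ?case by simp
next
  case ("3_1" t)
  then show ?case by (cases "segments t") auto
next
  case ("3_2" v t)
  then show ?case by (cases "segments t") auto
qed auto

lemma output_words_append [simp]: "output_words (t @ u) = output_words t @ output_words u"
  by (induction t rule: output_words.induct) auto

lemma output_words_map [simp]: "output_words (map Word xs) = xs"
  by (induction xs) auto

text \<open>Separates what is output from when: silent steps lengthen segments but leave their words
  alone.\<close>

lemma segments_visible: "map output_words (segments (visible t)) = map output_words (segments t)"
proof (induction t rule: segments.induct)
  case ("3_1" t)
  then show ?case by (cases "segments t") auto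
next
  case ("3_2" v t)
  then show ?case by (cases "segments t"; cases "segments (visible t)") auto
qed auto

definition written :: "nat list list \<Rightarrow> event list" where
  "written xss = concat (map (\<lambda>xs. map Word xs @ [End]) xss)"

lemma segments_words: "segments (map Word xs @ End # t) = (map Word xs @ [End]) # segments t"
  by (induction xs) auto

lemma segments_written: "map output_words (segments (written xss)) = xss @ [[]]"
  by (induction xss) (auto simp: written_def segments_words)

lemma items_written:
  assumes "visible t = written xss"
  shows "items t = xss" "output_words (last (segments t)) = []"
proof -
  have *: "map output_words (segments t) = xss @ [[]]"
    using segments_visible[of t] segments_written assms by metis
  then have "butlast (map output_words (segments t)) = xss" by simp
  then show "items t = xss" by (simp add: items_def map_butlast)
  have "last (map output_words (segments t)) = []" using * by simp
  then show "output_words (last (segments t)) = []" by (simp add: last_map)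
qed

lemma written_append: "written (xss @ yss) = written xss @ written yss"
  by (simp add: written_def)

text \<open>The number \<open>m\<close> enters the assumptions through \<open>handshake\<close>
  alone, which pays for all scans of neighbour lists.\<close>

locale graph =
  fixes n m :: nat and E :: "nat set set" and nb :: "nat \<Rightarrow> nat list"
  assumes E: "\<And>e. e \<in> E \<Longrightarrow> \<exists>x y. e = {x, y} \<and> x \<noteq> y"
    and E_bound: "\<And>e. e \<in> E \<Longrightarrow> e \<subseteq> {..<n}"
    and nb_distinct: "\<And>u. u < n \<Longrightarrow> distinct (nb u)"
    and set_nb: "\<And>u. u < n \<Longrightarrow> set (nb u) = {v. adj E u v}"
    and handshake: "(\<Sum>u<n. length (nb u)) = 2 * m"
begin

lemma adj_bound: "adj E u v \<Longrightarrow> u < n \<and> v < n"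
  using E_bound unfolding adj_def by blast

text \<open>The row length of matrices stored in one array. It exceeds \<open>n\<close>, every
  degree and the total number \<open>n + 2 * m\<close> of bucket entries, so rows never overlap.
  Being linear in \<open>n + m\<close>, it is also the unit in which time is measured.\<close>

definition W :: nat where "W = Suc (n + 2 * m)"

lemma index_eq: "i < W \<Longrightarrow> i' < W \<Longrightarrow> j * W + i = j' * W + i' \<longleftrightarrow> j = j' \<and> i = i'"
  by (metis W_def add.commute add_left_cancel div_mult_self1 div_less mod_mult_self1 mod_less
      add_0 nat.distinct(1))

lemma n_less_W: "n < W" by (simp add: W_def)

lemma degree_bound: "u < n \<Longrightarrow> length (nb u) < W"
  using member_le_sum[of u "{..<n}" "\<lambda>u. length (nb u)"] handshake by (simp add: W_def)

lemma sum_degree_bound: "X \<subseteq> {..<n} \<Longrightarrow> (\<Sum>u\<in>X. length (nb u)) \<le> 2 * m"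
  using sum_mono2[of "{..<n}" X "\<lambda>u. length (nb u)"] handshake by simp

text \<open>The tables prepared once from the input. \<open>base\<close> and \<open>pow\<close>
  replace multiplication and exponentiation, which the machine does not offer; \<open>base\<close>
  includes index \<open>n\<close> because buckets are numbered from 0 to \<open>n\<close>.\<close>

definition env :: "state \<Rightarrow> bool" where
  "env s \<longleftrightarrow> reg s ''n'' = n \<and> reg s ''n1'' = Suc n \<and>
     (\<forall>i\<le>n. arr s ''base'' i = i * W) \<and>
     (\<forall>u<n. \<forall>v<n. arr s ''adj'' (u * W + v) = (if adj E u v then 1 else 0)) \<and>
     (\<forall>u<n. arr s ''deg'' u = length (nb u)) \<and>
     (\<forall>u<n. \<forall>i<length (nb u). arr s ''nbr'' (u * W + i) = nb u ! i) \<and>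
     (\<forall>i<n. arr s ''pow'' i = 2 ^ i)"

definition graph_arrays :: "string set" where
  "graph_arrays = {''base'', ''adj'', ''deg'', ''nbr'', ''pow''}"

lemma env_unchanged:
  assumes "env s" "unchanged c s t" "''n'' \<notin> regs_of c" "''n1'' \<notin> regs_of c" "arrs_of c \<inter> graph_arrays = {}"
  shows "env t"
proof -
  have "arr t a = arr s a" if "a \<in> graph_arrays" for a using assms that by (auto simp: unchanged_def)
  then have "arr t ''base'' = arr s ''base''" "arr t ''adj'' = arr s ''adj''"
    "arr t ''deg'' = arr s ''deg''" "arr t ''nbr'' = arr s ''nbr''" "arr t ''pow'' = arr s ''pow''"
    by (auto simp: graph_arrays_def)
  moreover have "reg t ''n'' = reg s ''n''" "reg t ''n1'' = reg s ''n1''"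
    using assms by (auto simp: unchanged_def)
  ultimately show ?thesis using assms(1) by (simp add: env_def)
qed

end

section \<open>Maximum cardinality search\<close>

text \<open>An unvisited neighbour is pushed into the bucket of its increased count while its old
  entry stays behind as a stale copy, so no deletion inside a bucket is ever made. Among the visited
  neighbours, \<open>p\<close> records the latest and \<open>b\<close> its number.\<close>

definition scan_prog :: com where
  "scan_prog =
     Assign ''w'' (Get ''nbr'' (Plus (Get ''base'' (Var ''u'')) (Var ''e''))) ;;
     If (Eq (Get ''st'' (Var ''w'')) (Const 2))
       (If (Eq (Get ''num'' (Var ''w'')) (Const 0))
         (Put ''cnt'' (Var ''w'') (Plus (Get ''cnt'' (Var ''w'')) (Const 1)) ;;
          Assign ''c'' (Get ''cnt'' (Var ''w'')) ;;
          Put ''bk'' (Plus (Get ''base'' (Var ''c'')) (Get ''sz'' (Var ''c''))) (Var ''w'') ;;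
          Put ''sz'' (Var ''c'') (Plus (Get ''sz'' (Var ''c'')) (Const 1)))
         (If (Less (Var ''b'') (Get ''num'' (Var ''w'')))
           (Assign ''b'' (Get ''num'' (Var ''w'')) ;; Assign ''p'' (Var ''w''))
           Skip))
       Skip"

text \<open>Visited neighbours of \<open>u\<close> are compared with \<open>p\<close> only, not
  pairwise, which keeps the test linear in the degree; \<open>clique_last\<close> justifies
  it.\<close>

definition check_prog :: com where
  "check_prog =
     Assign ''w'' (Get ''nbr'' (Plus (Get ''base'' (Var ''u'')) (Var ''e''))) ;;
     If (And (And (Eq (Get ''st'' (Var ''w'')) (Const 2)) (Not (Eq (Get ''num'' (Var ''w'')) (Const 0))))
          (And (Not (Eq (Var ''w'') (Var ''p'')))
            (Eq (Get ''adj'' (Plus (Get ''base'' (Var ''p'')) (Var ''w''))) (Const 0))))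
       (Assign ''ok'' (Const 0))
       Skip"

text \<open>Numbers start at 1, because 0 marks an unvisited vertex.\<close>

definition visit_init_prog :: com where
  "visit_init_prog =
     Assign ''k'' (Plus (Var ''k'') (Const 1)) ;;
     Put ''num'' (Var ''u'') (Var ''k'') ;;
     Assign ''d'' (Get ''deg'' (Var ''u'')) ;;
     Assign ''b'' (Const 0) ;;
     Assign ''p'' (Const 0)"

definition visit_prog :: com where
  "visit_prog =
     visit_init_prog ;;
     For ''e'' ''d'' scan_prog ;;
     For ''e'' ''d'' check_prog ;;
     Assign ''j'' (Plus (Var ''j'') (Const 1))"

definition pop_prog :: com where
  "pop_prog =
     Put ''sz'' (Var ''j'') (Minus (Get ''sz'' (Var ''j'')) (Const 1)) ;;
     Assign ''u'' (Get ''bk'' (Plus (Get ''base'' (Var ''j'')) (Get ''sz'' (Var ''j''))))"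

text \<open>\<open>j\<close> bounds the nonempty buckets from above. It drops past an empty bucket
  and rises by one after a visit, since a visit raises counts by at most one. A popped vertex that
  is already visited was a stale copy.\<close>

definition mcs_step_prog :: com where
  "mcs_step_prog =
     If (Eq (Get ''sz'' (Var ''j'')) (Const 0))
       (Assign ''j'' (Minus (Var ''j'') (Const 1)))
       (pop_prog ;;
        If (Eq (Get ''num'' (Var ''u'')) (Const 0)) visit_prog Skip)"

definition mcs_prog :: com where
  "mcs_prog =
     For ''i'' ''n1'' (Put ''sz'' (Var ''i'') (Const 0)) ;;
     For ''i'' ''n''
       (Put ''cnt'' (Var ''i'') (Const 0) ;;
        Put ''num'' (Var ''i'') (Const 0) ;;
        If (Eq (Get ''st'' (Var ''i'')) (Const 2))
          (Put ''bk'' (Get ''sz'' (Const 0)) (Var ''i'') ;;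
           Put ''sz'' (Const 0) (Plus (Get ''sz'' (Const 0)) (Const 1)))
          Skip) ;;
     (Assign ''k'' (Const 0) ;; Assign ''j'' (Const 0) ;; Assign ''ok'' (Const 1)) ;;
     While (Not (And (Eq (Var ''j'') (Const 0)) (Eq (Get ''sz'' (Const 0)) (Const 0)))) mcs_step_prog"

lemma scan_prog_changes [simp]:
  "regs_of scan_prog = {''w'', ''c'', ''b'', ''p''}" "arrs_of scan_prog = {''cnt'', ''bk'', ''sz''}"
  by (auto simp: scan_prog_def)

lemma check_prog_changes [simp]:
  "regs_of check_prog = {''w'', ''ok''}" "arrs_of check_prog = {}"
  by (auto simp: check_prog_def)

lemma visit_prog_changes [simp]:
  "regs_of visit_prog = {''w'', ''c'', ''b'', ''p'', ''k'', ''d'', ''e'', ''ok'', ''j''}"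
  "arrs_of visit_prog = {''cnt'', ''bk'', ''sz'', ''num''}"
  by (auto simp: visit_prog_def visit_init_prog_def)

lemma mcs_step_prog_changes [simp]:
  "regs_of mcs_step_prog = {''w'', ''c'', ''b'', ''p'', ''k'', ''d'', ''e'', ''ok'', ''j'', ''u''}"
  "arrs_of mcs_step_prog = {''cnt'', ''bk'', ''sz'', ''num''}"
  by (auto simp: mcs_step_prog_def pop_prog_def)

lemma mcs_prog_changes [simp]:
  "regs_of mcs_prog = {''w'', ''c'', ''b'', ''p'', ''k'', ''d'', ''e'', ''ok'', ''j'', ''u'', ''i''}"
  "arrs_of mcs_prog = {''cnt'', ''bk'', ''sz'', ''num''}"
  by (auto simp: mcs_prog_def)

section \<open>Buckets with stale entries\<close>

context graph begin

text \<open>Deliberately weak: an entry may be stale, but then it is visited or lies no higher than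
  its true count. What matters is that every unvisited vertex has an entry in the right
  bucket.\<close>

definition buckets ::
    "nat set \<Rightarrow> (nat \<Rightarrow> nat) \<Rightarrow> (nat \<Rightarrow> nat) \<Rightarrow> (nat \<Rightarrow> nat) \<Rightarrow> (nat \<Rightarrow> nat) \<Rightarrow> bool" where
  "buckets X num cnt sz bk \<longleftrightarrow>
     (\<forall>j\<le>n. \<forall>i<sz j. bk (j * W + i) \<in> X \<and>
        (num (bk (j * W + i)) = 0 \<longrightarrow> j \<le> cnt (bk (j * W + i)))) \<and>
     (\<forall>x\<in>X. num x = 0 \<longrightarrow> cnt x \<le> n \<and> (\<exists>i<sz (cnt x). bk (cnt x * W + i) = x))"

lemma buckets_push:
  assumes b: "buckets X num cnt sz bk" and sz: "\<And>j. j \<le> n \<Longrightarrow> sz j < W"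
    and w: "w \<in> X" "num w = 0" "Suc (cnt w) \<le> n"
  shows "buckets X num (cnt(w := Suc (cnt w)))
    (sz(Suc (cnt w) := Suc (sz (Suc (cnt w)))))
    (bk(Suc (cnt w) * W + sz (Suc (cnt w)) := w))" (is "buckets X num ?cnt ?sz ?bk")
proof -
  let ?c = "Suc (cnt w)"
  have old: "?bk (j * W + i) = bk (j * W + i)" if "j \<le> n" "i < sz j" for i j
  proof -
    have "i < W" using sz[OF that(1)] that(2) by simp
    then show ?thesis using index_eq[of i "sz ?c" j ?c] sz[OF w(3)] that by auto
  qed
  have new: "?bk (?c * W + sz ?c) = w" by simp
  have b1: "bk (j * W + i) \<in> X \<and> (num (bk (j * W + i)) = 0 \<longrightarrow> j \<le> cnt (bk (j * W + i)))"
    if "j \<le> n" "i < sz j" for i j using b that by (auto simp: buckets_def)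
  have b2: "cnt x \<le> n \<and> (\<exists>i<sz (cnt x). bk (cnt x * W + i) = x)" if "x \<in> X" "num x = 0" for x
    using b that by (auto simp: buckets_def)
  show ?thesis unfolding buckets_def
  proof (intro conjI allI ballI impI)
    fix j i assume ji: "j \<le> n" "i < ?sz j"
    show "?bk (j * W + i) \<in> X"
    proof (cases "i < sz j")
      case True then show ?thesis using b1 old ji by simp
    next
      case False
      then have "j = ?c" "i = sz ?c" using ji by (auto split: if_splits)
      then show ?thesis using new w by simp
    qed
  next
    fix j i assume ji: "j \<le> n" "i < ?sz j" "num (?bk (j * W + i)) = 0"
    show "j \<le> ?cnt (?bk (j * W + i))"
    proof (cases "i < sz j")
      case True
      then have eq: "?bk (j * W + i) = bk (j * W + i)" using old ji by blast
      then have "j \<le> cnt (bk (j * W + i))" using b1[of j i] ji True by simp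
      then show ?thesis unfolding eq by (auto simp del: add_Suc)
    next
      case False
      then have "j = ?c" "i = sz ?c" using ji by (auto split: if_splits)
      then show ?thesis using new by simp
    qed
  next
    fix x assume x: "x \<in> X" "num x = 0"
    then show "?cnt x \<le> n" using b2 w by auto
    show "\<exists>i<?sz (?cnt x). ?bk (?cnt x * W + i) = x"
    proof (cases "x = w")
      case True
      then show ?thesis using new by (intro exI[of _ "sz ?c"]) simp
    next
      case False
      obtain i where "i < sz (cnt x)" "bk (cnt x * W + i) = x" using b2[OF x] by blast
      then show ?thesis using False old[of "cnt x" i] b2[OF x] by (intro exI[of _ i]) auto
    qed
  qed
qed

text \<open>Requiring the popped vertex to be visited under \<open>num'\<close> ensures that no
  needed entry is lost. With \<open>num'\<close> equal to \<open>num\<close> this is the removal of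
  a stale copy, otherwise the start of a visit.\<close>

lemma buckets_pop:
  assumes b: "buckets X num cnt sz bk" and j: "j \<le> n" "sz j = Suc q"
    and num': "num' (bk (j * W + q)) \<noteq> 0" "\<And>x. num' x = 0 \<Longrightarrow> num x = 0"
  shows "buckets X num' cnt (sz(j := q)) bk"
  unfolding buckets_def
proof (intro conjI allI ballI impI)
  fix j' i assume "j' \<le> n" "i < (sz(j := q)) j'"
  then have ji: "j' \<le> n" "i < sz j'" using j by (auto split: if_splits)
  then show "bk (j' * W + i) \<in> X" using b by (auto simp: buckets_def)
  assume "num' (bk (j' * W + i)) = 0"
  then show "j' \<le> cnt (bk (j' * W + i))" using b ji num' by (auto simp: buckets_def)
next
  fix x assume x: "x \<in> X" "num' x = 0"
  then have *: "cnt x \<le> n" "\<exists>i<sz (cnt x). bk (cnt x * W + i) = x"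
    using b num' by (auto simp: buckets_def)
  then show "cnt x \<le> n" by blast
  obtain i where i: "i < sz (cnt x)" "bk (cnt x * W + i) = x" using * by blast
  have "cnt x = j \<Longrightarrow> i \<noteq> q" using i x num' by auto
  then show "\<exists>i<(sz(j := q)) (cnt x). bk (cnt x * W + i) = x"
    using i j by (intro exI[of _ i]) auto
qed

lemma sum_fun_upd:
  fixes f :: "nat \<Rightarrow> nat"
  assumes "j \<le> n"
  shows "(\<Sum>i\<le>n. (f(j := v)) i) + f j = (\<Sum>i\<le>n. f i) + v"
proof -
  have "(\<Sum>i\<le>n. (f(j := v)) i) = v + (\<Sum>i\<in>{..n} - {j}. f i)"
    using assms by (subst sum.remove[of _ j]) auto
  moreover have "(\<Sum>i\<le>n. f i) = f j + (\<Sum>i\<in>{..n} - {j}. f i)"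
    using assms by (subst sum.remove[of _ j]) auto
  ultimately show ?thesis by simp
qed

definition members :: "state \<Rightarrow> nat set" where
  "members s = {u. u < n \<and> arr s ''st'' u = 2}"

lemma members_cong: "arr t ''st'' = arr s ''st'' \<Longrightarrow> members t = members s"
  by (simp add: members_def)

abbreviation visited :: "nat set \<Rightarrow> (nat \<Rightarrow> nat) \<Rightarrow> nat set" where
  "visited X num \<equiv> {x \<in> X. num x \<noteq> 0}"

lemma scan_correct:
  assumes env: "env s" and X: "X = members s" and u: "u < n" "reg s ''u'' = u"
    and d: "reg s ''d'' = length (nb u)" and b0: "reg s ''b'' = 0"
    and bu: "buckets X (arr s ''num'') (arr s ''cnt'') (arr s ''sz'') (arr s ''bk'')"
    and cnt: "\<And>x. x \<in> X \<Longrightarrow> arr s ''num'' x = 0 \<Longrightarrow> arr s ''cnt'' x \<le> j"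
    and j: "Suc j \<le> n"
    and top: "\<And>i. i \<le> n \<Longrightarrow> Suc j < i \<Longrightarrow> arr s ''sz'' i = 0"
    and total: "(\<Sum>i\<le>n. arr s ''sz'' i) + length (nb u) \<le> n + 2 * m"
  shows "ex (For ''e'' ''d'' scan_prog) s (2 + length (nb u) * 10) (\<lambda>t.
     buckets X (arr s ''num'') (arr t ''cnt'') (arr t ''sz'') (arr t ''bk'') \<and>
     (\<forall>x\<in>X. arr s ''num'' x = 0 \<longrightarrow>
        arr t ''cnt'' x = arr s ''cnt'' x + (if adj E u x then 1 else 0)) \<and>
     (\<forall>i\<le>n. Suc j < i \<longrightarrow> arr t ''sz'' i = 0) \<and>
     (\<Sum>i\<le>n. arr t ''sz'' i) \<le> (\<Sum>i\<le>n. arr s ''sz'' i) + length (nb u) \<and>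
     (\<forall>w\<in>X. adj E u w \<longrightarrow> arr s ''num'' w \<le> reg t ''b'') \<and>
     (reg t ''b'' \<noteq> 0 \<longrightarrow> reg t ''p'' \<in> X \<and> adj E u (reg t ''p'') \<and>
        arr s ''num'' (reg t ''p'') = reg t ''b''))"
proof -
  let ?num = "arr s ''num''"
  let ?D = "\<lambda>e. set (take e (nb u))"
  let ?I = "\<lambda>e t. buckets X ?num (arr t ''cnt'') (arr t ''sz'') (arr t ''bk'') \<and>
     (\<forall>x\<in>X. ?num x = 0 \<longrightarrow> arr t ''cnt'' x = arr s ''cnt'' x + (if x \<in> ?D e then 1 else 0)) \<and>
     (\<forall>i\<le>n. Suc j < i \<longrightarrow> arr t ''sz'' i = 0) \<and>
     (\<Sum>i\<le>n. arr t ''sz'' i) \<le> (\<Sum>i\<le>n. arr s ''sz'' i) + e \<and>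
     (\<forall>w\<in>X. w \<in> ?D e \<longrightarrow> ?num w \<le> reg t ''b'') \<and>
     (reg t ''b'' \<noteq> 0 \<longrightarrow> reg t ''p'' \<in> X \<and> reg t ''p'' \<in> ?D e \<and> ?num (reg t ''p'') = reg t ''b'')"
  have "ex (For ''e'' ''d'' scan_prog) s (2 + length (nb u) * (8 + 2)) (?I (length (nb u)))"
  proof (rule ex_For_const[where I = ?I])
    show "reg s ''d'' = length (nb u)" by (rule d)
    show "?I 0 s" using bu top b0 by simp
  next
    fix e t assume e: "e < length (nb u)" and I: "?I e t" and re: "reg t ''e'' = e"
      and un: "unchanged (For ''e'' ''d'' scan_prog) s t"
    define w where "w = nb u ! e"
    have envt: "env t" by (rule env_unchanged[OF env un]) (auto simp: graph_arrays_def)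
    have ru: "reg t ''u'' = u" "arr t ''num'' = ?num" "arr t ''st'' = arr s ''st''"
      using un u by (auto simp: unchanged_def)
    have w: "arr t ''nbr'' (u * W + e) = w" "arr t ''base'' u = u * W"
      using envt u e by (auto simp: env_def w_def)
    have "w \<in> set (nb u)" using e by (simp add: w_def)
    then have wn: "w < n" using set_nb[OF u(1)] adj_bound by auto
    have wX: "arr s ''st'' w = 2 \<longleftrightarrow> w \<in> X" using wn by (simp add: X members_def)
    have D: "?D (Suc e) = insert w (?D e)" using e by (simp add: w_def take_Suc_conv_app_nth)
    \<comment> \<open>Each neighbour occurs once in the list, so the count of \<open>w\<close> is
      still its initial one.\<close>
    have wD: "w \<notin> ?D e" using nb_distinct[OF u(1)] e
      by (auto simp: w_def in_set_conv_nth nth_eq_iff_index_eq)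
    let ?t = "effect scan_prog t"
    have "?I (Suc e) ?t"
    proof (cases "w \<in> X \<and> ?num w = 0")
      case True
      define c where "c = arr t ''cnt'' w"
      have c: "c = arr s ''cnt'' w" using I True wD by (simp add: c_def)
      have cj: "Suc c \<le> Suc j" using cnt[of w] True c by simp
      \<comment> \<open>The budget of \<open>n + 2 * m\<close> entries in total keeps each bucket
        inside its row.\<close>
      have szW: "arr t ''sz'' i < W" if "i \<le> n" for i
      proof -
        have "arr t ''sz'' i \<le> (\<Sum>i\<le>n. arr t ''sz'' i)" using that by (intro member_le_sum) auto
        then show ?thesis using I total e by (simp add: W_def)
      qed
      have bc: "arr t ''base'' (Suc c) = Suc c * W" using envt cj j by (simp add: env_def del: mult_Suc)
      have st: "arr ?t ''cnt'' = (arr t ''cnt'')(w := Suc c)"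
        "arr ?t ''sz'' = (arr t ''sz'')(Suc c := Suc (arr t ''sz'' (Suc c)))"
        "arr ?t ''bk'' = (arr t ''bk'')(Suc c * W + arr t ''sz'' (Suc c) := w)"
        "reg ?t ''b'' = reg t ''b''" "reg ?t ''p'' = reg t ''p''"
        using True wX ru w re bc
        by (simp_all add: scan_prog_def c_def[symmetric] del: mult_Suc)
      have "buckets X ?num (arr ?t ''cnt'') (arr ?t ''sz'') (arr ?t ''bk'')"
        unfolding st c_def
        by (rule buckets_push) (use I szW True cj j c_def in auto)
      moreover have "(\<Sum>i\<le>n. arr ?t ''sz'' i) + arr t ''sz'' (Suc c)
          = (\<Sum>i\<le>n. arr t ''sz'' i) + Suc (arr t ''sz'' (Suc c))"
        unfolding st using cj j by (intro sum_fun_upd) simp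
      ultimately show ?thesis using I True cj wD c unfolding D st by auto
    next
      case False
      then have st: "arr ?t ''cnt'' = arr t ''cnt''"
        "arr ?t ''sz'' = arr t ''sz''" "arr ?t ''bk'' = arr t ''bk''"
        "reg ?t ''b'' = (if w \<in> X \<and> reg t ''b'' < ?num w then ?num w else reg t ''b'')"
        "reg ?t ''p'' = (if w \<in> X \<and> reg t ''b'' < ?num w then w else reg t ''p'')"
        using wX ru w re by (auto simp: scan_prog_def)
      show ?thesis using I False unfolding D st by auto
    qed
    then show "ex scan_prog t 8 (?I (Suc e))"
      by (intro ex_straight) (simp_all add: scan_prog_def)
  qed (auto)
  then show ?thesis using set_nb[OF u(1)] by simp
qed

text \<open>When \<open>u\<close> has no visited neighbour, \<open>p\<close> carries no information;
  the outcome then does not depend on the lookup in its row.\<close>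

lemma check_correct:
  assumes env: "env s" and X: "X = members s" and u: "u < n" "reg s ''u'' = u"
    and d: "reg s ''d'' = length (nb u)" and ok: "reg s ''ok'' \<le> 1"
    and p: "reg s ''p'' < n \<or> (\<forall>w\<in>X. adj E u w \<longrightarrow> arr s ''num'' w = 0)"
  shows "ex (For ''e'' ''d'' check_prog) s (2 + length (nb u) * 5) (\<lambda>t. reg t ''ok'' \<le> 1 \<and>
     (reg t ''ok'' = 1 \<longleftrightarrow> reg s ''ok'' = 1 \<and>
       (\<forall>w\<in>X. adj E u w \<and> arr s ''num'' w \<noteq> 0 \<and> w \<noteq> reg s ''p'' \<longrightarrow> adj E (reg s ''p'') w)))"
proof -
  let ?num = "arr s ''num''"
  let ?p = "reg s ''p''"
  let ?D = "\<lambda>e. set (take e (nb u))"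
  let ?I = "\<lambda>e t. reg t ''ok'' \<le> 1 \<and> (reg t ''ok'' = 1 \<longleftrightarrow> reg s ''ok'' = 1 \<and>
       (\<forall>w\<in>X. w \<in> ?D e \<and> ?num w \<noteq> 0 \<and> w \<noteq> ?p \<longrightarrow> adj E ?p w))"
  have "ex (For ''e'' ''d'' check_prog) s (2 + length (nb u) * (3 + 2)) (?I (length (nb u)))"
  proof (rule ex_For_const[where I = ?I])
    show "reg s ''d'' = length (nb u)" by (rule d)
    show "?I 0 s" using ok by simp
  next
    fix e t assume e: "e < length (nb u)" and I: "?I e t" and re: "reg t ''e'' = e"
      and un: "unchanged (For ''e'' ''d'' check_prog) s t"
    define w where "w = nb u ! e"
    have envt: "env t" by (rule env_unchanged[OF env un]) (auto simp: graph_arrays_def)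
    have ru: "reg t ''u'' = u" "arr t ''num'' = ?num" "arr t ''st'' = arr s ''st''" "reg t ''p'' = ?p"
      using un u by (auto simp: unchanged_def)
    have w: "arr t ''nbr'' (u * W + e) = w" "arr t ''base'' u = u * W"
      using envt u e by (auto simp: env_def w_def)
    have "w \<in> set (nb u)" using e by (simp add: w_def)
    then have uw: "adj E u w" and wn: "w < n" using set_nb[OF u(1)] adj_bound by auto
    have wX: "arr s ''st'' w = 2 \<longleftrightarrow> w \<in> X" using wn by (simp add: X members_def)
    have D: "?D (Suc e) = insert w (?D e)" using e by (simp add: w_def take_Suc_conv_app_nth)
    have pw: "arr t ''adj'' (arr t ''base'' ?p + w) = 0 \<longleftrightarrow> \<not> adj E ?p w" if "w \<in> X" "?num w \<noteq> 0"
      using envt wn p uw that by (auto simp: env_def)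
    let ?t = "effect check_prog t"
    have "reg ?t ''ok'' = (if w \<in> X \<and> ?num w \<noteq> 0 \<and> w \<noteq> ?p \<and> \<not> adj E ?p w then 0 else reg t ''ok'')"
      using ru w re wX pw by (auto simp: check_prog_def)
    then have "?I (Suc e) ?t" using I unfolding D by auto
    then show "ex check_prog t 3 (?I (Suc e))"
      by (intro ex_straight) (simp_all add: check_prog_def)
  qed (auto)
  then show ?thesis using set_nb[OF u(1)] by simp
qed

end

text \<open>Elements of \<open>L\<close> adjacent to its latest vertex \<open>p\<close> are earlier
  neighbours of \<open>p\<close>, which already form a clique.\<close>

lemma clique_last:
  assumes "clique E (prior E V num p (num p))" "inj_on num V" "L \<subseteq> V" "p \<in> L"
    and "\<And>w. w \<in> L \<Longrightarrow> num w \<le> num p"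
  shows "(\<forall>w\<in>L. w \<noteq> p \<longrightarrow> adj E p w) \<longleftrightarrow> clique E L"
proof
  assume a: "\<forall>w\<in>L. w \<noteq> p \<longrightarrow> adj E p w"
  have "w \<in> prior E V num p (num p)" if "w \<in> L" "w \<noteq> p" for w
  proof -
    have "num w \<noteq> num p" using that assms(2-4) by (auto dest: inj_onD)
    then have "num w < num p" using assms(5)[OF that(1)] by simp
    then show ?thesis using a that assms(3) by (auto simp: prior_def)
  qed
  then show "clique E L" using a assms(1) adj_sym[of E _ p] unfolding clique_def by metis
next
  assume "clique E L" then show "\<forall>w\<in>L. w \<noteq> p \<longrightarrow> adj E p w"
    using assms(4) by (auto simp: clique_def)
qed

section \<open>Invariant and amortized time of the search\<close>

context graph begin

text \<open>The budget adds the entries present to those that unvisited vertices can still cause to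
  be pushed. In the greedy condition an unvisited vertex, numbered 0, counts as later than all
  visited ones. The sets \<open>prior\<close> are taken within the visited vertices for the same
  reason.\<close>

definition mcs_state :: "nat set \<Rightarrow> (nat \<Rightarrow> nat) \<Rightarrow> (nat \<Rightarrow> nat) \<Rightarrow> (nat \<Rightarrow> nat) \<Rightarrow> (nat \<Rightarrow> nat) \<Rightarrow>
    nat \<Rightarrow> nat \<Rightarrow> nat \<Rightarrow> bool" where
  "mcs_state X num cnt sz bk k j ok \<longleftrightarrow>
     buckets X num cnt sz bk \<and>
     (\<forall>x<n. x \<notin> X \<longrightarrow> num x = 0) \<and>
     inj_on num (visited X num) \<and> (\<forall>x\<in>X. num x \<le> k) \<and> card (visited X num) = k \<and>
     (\<forall>x\<in>X. num x = 0 \<longrightarrow> cnt x = card {w \<in> visited X num. adj E x w}) \<and>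
     (\<forall>i\<le>n. j < i \<longrightarrow> sz i = 0) \<and> j \<le> k \<and>
     (\<Sum>i\<le>n. sz i) + (\<Sum>x\<in>{x \<in> X. num x = 0}. length (nb x)) \<le> n + 2 * m \<and>
     (\<forall>u\<in>visited X num. \<forall>v\<in>X. num v = 0 \<or> num u \<le> num v \<longrightarrow>
        card (prior E (visited X num) num v (num u)) \<le> card (prior E (visited X num) num u (num u))) \<and>
     ok \<le> 1 \<and>
     (ok = 1 \<longleftrightarrow> (\<forall>u\<in>visited X num. clique E (prior E (visited X num) num u (num u))))"

lemma mcs_state_decrease:
  assumes "mcs_state X num cnt sz bk k j ok" "sz j = 0"
  shows "mcs_state X num cnt sz bk k (j - 1) ok"
proof -
  have "\<forall>i\<le>n. j - 1 < i \<longrightarrow> sz i = 0"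
  proof (intro allI impI)
    fix i assume "i \<le> n" "j - 1 < i"
    then show "sz i = 0" using assms by (cases "i = j") (auto simp: mcs_state_def)
  qed
  moreover have "j - 1 \<le> k" using assms by (auto simp: mcs_state_def)
  ultimately show ?thesis using assms(1) unfolding mcs_state_def by blast
qed

lemma mcs_state_top:
  assumes "mcs_state X num cnt sz bk k j ok" "X \<subseteq> {..<n}"
  shows "j \<le> n"
proof -
  have "card (visited X num) \<le> card {..<n}" using assms(2) by (intro card_mono) auto
  then show ?thesis using assms(1) by (auto simp: mcs_state_def)
qed

lemma mcs_state_skip:
  assumes st: "mcs_state X num cnt sz bk k j ok" and X: "X \<subseteq> {..<n}"
    and q: "sz j = Suc q" and u: "num (bk (j * W + q)) \<noteq> 0"
  shows "mcs_state X num cnt (sz(j := q)) bk k j ok"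
proof -
  have jn: "j \<le> n" by (rule mcs_state_top[OF st X])
  have "buckets X num cnt (sz(j := q)) bk"
    by (rule buckets_pop[where num = num]) (use st jn q u in \<open>simp_all add: mcs_state_def\<close>)
  moreover have "(\<Sum>i\<le>n. (sz(j := q)) i) \<le> (\<Sum>i\<le>n. sz i)"
    using sum_fun_upd[OF jn, of sz q] q by simp
  ultimately show ?thesis using st unfolding mcs_state_def by auto
qed

text \<open>The popped vertex has the largest count: buckets above \<open>j\<close> are empty, so no
  unvisited count exceeds \<open>j\<close>, and an unvisited entry of bucket \<open>j\<close> has
  count at least \<open>j\<close>. The early conclusions serve the two loops; the last one takes
  their results as premises and rebuilds the invariant.\<close>

lemma mcs_state_visit:
  assumes st: "mcs_state X num cnt sz bk k j ok" and X: "X \<subseteq> {..<n}"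
    and q: "sz j = Suc q" and u: "u = bk (j * W + q)" "num u = 0"
  defines "num' \<equiv> num(u := Suc k)"
  shows "u \<in> X" and "Suc j \<le> n" and "\<And>x. x \<in> X \<Longrightarrow> num x = 0 \<Longrightarrow> cnt x \<le> j"
    and "buckets X num' cnt (sz(j := q)) bk"
    and "Suc ((\<Sum>i\<le>n. (sz(j := q)) i)) = (\<Sum>i\<le>n. sz i)"
    and "(\<Sum>x\<in>{x \<in> X. num x = 0}. (f :: nat \<Rightarrow> nat) x) = f u + (\<Sum>x\<in>{x \<in> X. num' x = 0}. f x)"
    and "\<And>cnt' sz' bk' p ok'. buckets X num' cnt' sz' bk' \<Longrightarrow>
     (\<forall>x\<in>X. num' x = 0 \<longrightarrow> cnt' x = cnt x + (if adj E u x then 1 else 0)) \<Longrightarrow>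
     (\<forall>i\<le>n. Suc j < i \<longrightarrow> sz' i = 0) \<Longrightarrow>
     (\<Sum>i\<le>n. sz' i) \<le> (\<Sum>i\<le>n. (sz(j := q)) i) + length (nb u) \<Longrightarrow>
     (\<forall>w\<in>X. adj E u w \<longrightarrow> num' w \<le> b) \<Longrightarrow>
     (b \<noteq> 0 \<longrightarrow> p \<in> X \<and> adj E u p \<and> num' p = b) \<Longrightarrow>
     ok' \<le> 1 \<Longrightarrow> (ok' = 1 \<longleftrightarrow> ok = 1 \<and>
       (\<forall>w\<in>X. adj E u w \<and> num' w \<noteq> 0 \<and> w \<noteq> p \<longrightarrow> adj E p w)) \<Longrightarrow>
     mcs_state X num' cnt' sz' bk' (Suc k) (Suc j) ok'"
proof -
  define V where "V = visited X num"
  have finX: "finite X" using X by (rule finite_subset) simp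
  have jn: "j \<le> n" by (rule mcs_state_top[OF st X])
  have i1: "buckets X num cnt sz bk" and i2: "\<And>x. x < n \<Longrightarrow> x \<notin> X \<Longrightarrow> num x = 0"
    and i3: "inj_on num V" "\<And>x. x \<in> X \<Longrightarrow> num x \<le> k" "card V = k"
    and i4: "\<And>x. x \<in> X \<Longrightarrow> num x = 0 \<Longrightarrow> cnt x = card {w \<in> V. adj E x w}"
    and i5: "\<And>i. i \<le> n \<Longrightarrow> j < i \<Longrightarrow> sz i = 0" "j \<le> k"
    and i6: "(\<Sum>i\<le>n. sz i) + (\<Sum>x\<in>{x \<in> X. num x = 0}. length (nb x)) \<le> n + 2 * m"
    and i7: "\<And>u v. u \<in> V \<Longrightarrow> v \<in> X \<Longrightarrow> num v = 0 \<or> num u \<le> num v \<Longrightarrow>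
        card (prior E V num v (num u)) \<le> card (prior E V num u (num u))"
    and i8: "ok \<le> 1" "ok = 1 \<longleftrightarrow> (\<forall>u\<in>V. clique E (prior E V num u (num u)))"
    using st unfolding mcs_state_def V_def by auto
  have VX: "V \<subseteq> X" "finite V" using finX by (auto simp: V_def)
  show uX: "u \<in> X" using i1 jn q u by (auto simp: buckets_def)
  have uV: "u \<notin> V" using u by (simp add: V_def)
  have "card (insert u V) \<le> card {..<n}" using VX X uX by (intro card_mono) auto
  then show "Suc j \<le> n" using i3(3) i5(2) uV VX by simp
  show cj: "cnt x \<le> j" if x: "x \<in> X" "num x = 0" for x
  proof (rule ccontr)
    assume "\<not> cnt x \<le> j"
    moreover have "cnt x \<le> n" "\<exists>i<sz (cnt x). bk (cnt x * W + i) = x"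
      using i1 x by (auto simp: buckets_def)
    ultimately show False using i5(1)[of "cnt x"] by auto
  qed
  have ju: "cnt u = j"
  proof -
    have "j \<le> cnt u" using i1 jn q u by (auto simp: buckets_def)
    then show ?thesis using cj[OF uX u(2)] by simp
  qed
  show "buckets X num' cnt (sz(j := q)) bk"
    by (rule buckets_pop[OF i1 jn q]) (auto simp: num'_def u(1) split: if_splits)
  show "Suc ((\<Sum>i\<le>n. (sz(j := q)) i)) = (\<Sum>i\<le>n. sz i)"
    using sum_fun_upd[OF jn, of sz q] q by simp
  have unv: "{x \<in> X. num x = 0} = insert u {x \<in> X. num' x = 0}" "u \<notin> {x \<in> X. num' x = 0}"
    using uX u(2) by (auto simp: num'_def)
  have sumu: "(\<Sum>x\<in>{x \<in> X. num x = 0}. f x) = f u + (\<Sum>x\<in>{x \<in> X. num' x = 0}. f x)"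
    for f :: "nat \<Rightarrow> nat"
    unfolding unv(1) using unv(2) finX by simp
  then show "(\<Sum>x\<in>{x \<in> X. num x = 0}. f x) = f u + (\<Sum>x\<in>{x \<in> X. num' x = 0}. f x)" .
  fix cnt' sz' bk' :: "nat \<Rightarrow> nat" and p ok' :: nat
  assume a1: "buckets X num' cnt' sz' bk'"
    and a2: "\<forall>x\<in>X. num' x = 0 \<longrightarrow> cnt' x = cnt x + (if adj E u x then 1 else 0)"
    and a3: "\<forall>i\<le>n. Suc j < i \<longrightarrow> sz' i = 0"
    and a4: "(\<Sum>i\<le>n. sz' i) \<le> (\<Sum>i\<le>n. (sz(j := q)) i) + length (nb u)"
    and a5: "\<forall>w\<in>X. adj E u w \<longrightarrow> num' w \<le> b"
    and a6: "b \<noteq> 0 \<longrightarrow> p \<in> X \<and> adj E u p \<and> num' p = b"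
    and a7: "ok' \<le> 1" "ok' = 1 \<longleftrightarrow> ok = 1 \<and>
       (\<forall>w\<in>X. adj E u w \<and> num' w \<noteq> 0 \<and> w \<noteq> p \<longrightarrow> adj E p w)"
  have V': "visited X num' = insert u V" using uX by (auto simp: num'_def V_def)
  have num'V: "num' x = num x" if "x \<in> V" for x using that uV by (auto simp: num'_def)
  have numk: "num x \<le> k" if "x \<in> V" for x using i3(2) VX that by auto
  \<comment> \<open>The new vertex has the largest number, so it joins no earlier set.\<close>
  have prV: "prior E (insert u V) num' v (num' x) = prior E V num v (num x)" if "x \<in> V" for v x
  proof -
    have "num' x \<le> k" using num'V numk that by simp
    then show ?thesis using num'V that uV by (auto simp: prior_def num'_def)
  qed
  have pru: "prior E (insert u V) num' v (num' u) = {w \<in> V. adj E v w}" for v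
    using numk uV by (force simp: prior_def num'_def less_Suc_eq_le)
  have inj: "inj_on num' (insert u V)"
  proof -
    have "inj_on num' V" using i3(1) num'V by (simp add: inj_on_def)
    moreover have "num' u \<notin> num' ` V" using num'V numk by (fastforce simp: num'_def)
    ultimately show ?thesis using uV by simp
  qed
  show "mcs_state X num' cnt' sz' bk' (Suc k) (Suc j) ok'"
    unfolding mcs_state_def V'
  proof (intro conjI)
    show "buckets X num' cnt' sz' bk'" by (rule a1)
    show "\<forall>x<n. x \<notin> X \<longrightarrow> num' x = 0" using i2 uX by (auto simp: num'_def)
    show "inj_on num' (insert u V)" by (rule inj)
    show "\<forall>x\<in>X. num' x \<le> Suc k" using i3(2) by (auto simp: num'_def le_Suc_eq)
    show "card (insert u V) = Suc k" using uV VX i3(3) by simp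
    show "\<forall>x\<in>X. num' x = 0 \<longrightarrow> cnt' x = card {w \<in> insert u V. adj E x w}"
    proof (intro ballI impI)
      fix x assume x: "x \<in> X" "num' x = 0"
      then have "num x = 0" by (auto simp: num'_def split: if_splits)
      then have "cnt x = card {w \<in> V. adj E x w}" using i4 x by blast
      moreover have "{w \<in> insert u V. adj E x w} =
          (if adj E u x then insert u {w \<in> V. adj E x w} else {w \<in> V. adj E x w})"
        using adj_sym[of E u x] by auto
      ultimately show "cnt' x = card {w \<in> insert u V. adj E x w}"
        using a2 x uV VX by simp
    qed
    show "\<forall>i\<le>n. Suc j < i \<longrightarrow> sz' i = 0" by (rule a3)
    show "Suc j \<le> Suc k" using i5 by simp
    show "(\<Sum>i\<le>n. sz' i) + (\<Sum>x\<in>{x \<in> X. num' x = 0}. length (nb x)) \<le> n + 2 * m"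
      using a4 i6 sumu[of "\<lambda>x. length (nb x)"] sum_fun_upd[OF jn, of sz q] q by linarith
    show "\<forall>x\<in>insert u V. \<forall>v\<in>X. num' v = 0 \<or> num' x \<le> num' v \<longrightarrow>
        card (prior E (insert u V) num' v (num' x)) \<le> card (prior E (insert u V) num' x (num' x))"
    proof (intro ballI impI)
      fix x v assume x: "x \<in> insert u V" and v: "v \<in> X" "num' v = 0 \<or> num' x \<le> num' v"
      show "card (prior E (insert u V) num' v (num' x)) \<le> card (prior E (insert u V) num' x (num' x))"
      proof (cases "x = u")
        case False
        then have xV: "x \<in> V" using x by simp
        have "num v = 0 \<or> num x \<le> num v"
          using v u(2) num'V[OF xV] by (auto simp: num'_def split: if_splits)
        then show ?thesis using prV[OF xV] i7[OF xV v(1)] by simp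
      next
        \<comment> \<open>Only here is the greedy choice used: unvisited \<open>v\<close> has at
          most as many visited neighbours as \<open>u\<close>.\<close>
        case True
        show ?thesis
        proof (cases "v = u")
          case False
          have "num v = 0" using v i3(2)[of v] False True by (auto simp: num'_def)
          then have "card {w \<in> V. adj E v w} \<le> card {w \<in> V. adj E u w}"
            using cj[of v] ju i4[of v] i4[of u] u uX v(1) by simp
          then show ?thesis by (simp only: pru True)
        qed (use True in simp)
      qed
    qed
    show "ok' \<le> 1" by (rule a7)
    let ?L = "{w \<in> V. adj E u w}"
    have new: "clique E (prior E (insert u V) num' u (num' u)) \<longleftrightarrow>
       (\<forall>w\<in>X. adj E u w \<and> num' w \<noteq> 0 \<and> w \<noteq> p \<longrightarrow> adj E p w)"
      if cl: "\<forall>u\<in>V. clique E (prior E V num u (num u))"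
    proof -
      have "(\<forall>w\<in>X. adj E u w \<and> num' w \<noteq> 0 \<and> w \<noteq> p \<longrightarrow> adj E p w) \<longleftrightarrow>
          (\<forall>w\<in>?L. w \<noteq> p \<longrightarrow> adj E p w)"
        by (auto simp: V_def num'_def)
      also have "\<dots> \<longleftrightarrow> clique E ?L"
      proof (cases "?L = {}")
        case True then show ?thesis by (simp only: True) (simp add: clique_def)
      next
        case False
        then obtain y where y: "y \<in> V" "adj E u y" by blast
        \<comment> \<open>A visited neighbour has a positive number, so \<open>p\<close> has really
          been set.\<close>
        have "b \<noteq> 0"
          using y a5 num'V[of y] VX by (auto simp: V_def)
        then have p: "p \<in> X" "adj E u p" "num' p = b" "p \<noteq> u" using a6 by auto
        then have pL: "p \<in> ?L" using \<open>b \<noteq> 0\<close> by (auto simp: V_def num'_def)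
        show ?thesis
        proof (rule clique_last[where num = num and V = V])
          show "clique E (prior E V num p (num p))" using cl pL by blast
          fix w assume "w \<in> ?L"
          then show "num w \<le> num p" using a5 num'V[of w] num'V[of p] p pL VX by auto
        qed (use i3 pL in auto)
      qed
      finally show ?thesis unfolding pru by simp
    qed
    show "(ok' = 1) = (\<forall>x\<in>insert u V. clique E (prior E (insert u V) num' x (num' x)))"
      using new a7(2) i8(2) prV by auto
  qed
qed

definition mcs_inv :: "nat set \<Rightarrow> state \<Rightarrow> bool" where
  "mcs_inv X t \<longleftrightarrow> mcs_state X (arr t ''num'') (arr t ''cnt'') (arr t ''sz'') (arr t ''bk'')
     (reg t ''k'') (reg t ''j'') (reg t ''ok'')"

text \<open>Removing a stale entry takes 6 units including the loop test, lowering \<open>j\<close>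
  takes 3. A visit takes 15 units per neighbour in its two loops and may deposit 6 for a new entry;
  the weight 40 covers this, the fixed part of a visit and the 3 for raising
  \<open>j\<close>.\<close>

definition potential :: "nat set \<Rightarrow> state \<Rightarrow> nat" where
  "potential X t = 6 * (\<Sum>i\<le>n. arr t ''sz'' i) + 3 * reg t ''j'' +
     40 * (\<Sum>x\<in>{x \<in> X. arr t ''num'' x = 0}. Suc (length (nb x)))"


lemma straight_parts [simp]:
  "straight pop_prog" "cost pop_prog = 2" "straight visit_init_prog" "cost visit_init_prog = 5"
  by (simp_all add: pop_prog_def visit_init_prog_def)

lemma mcs_step:
  assumes env: "env t" and X: "X = members t" and inv: "mcs_inv X t"
    and go: "\<not> (reg t ''j'' = 0 \<and> arr t ''sz'' 0 = 0)"
  shows "\<exists>k. ex mcs_step_prog t k (\<lambda>t'. mcs_inv X t' \<and> potential X t' + Suc k \<le> potential X t)"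
proof -
  define num cnt sz bk where "num = arr t ''num''" and "cnt = arr t ''cnt''"
    and "sz = arr t ''sz''" and "bk = arr t ''bk''"
  define j k ok where "j = reg t ''j''" and "k = reg t ''k''" and "ok = reg t ''ok''"
  note defs = num_def cnt_def sz_def bk_def j_def k_def ok_def
  have Xn: "X \<subseteq> {..<n}" and finX: "finite X" by (auto simp: X members_def)
  have st: "mcs_state X num cnt sz bk k j ok" using inv by (simp add: mcs_inv_def defs)
  have jn: "j \<le> n" by (rule mcs_state_top[OF st Xn])
  show ?thesis
  proof (cases "sz j = 0")
    case True
    then have j0: "j \<noteq> 0" using go by (cases "j = 0") (auto simp: j_def sz_def)
    have "ex mcs_step_prog t 2 (\<lambda>t'. mcs_inv X t' \<and> potential X t' + Suc 2 \<le> potential X t)"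
      unfolding mcs_step_prog_def
    proof (subst numeral_2_eq_2, rule ex_If)
      show "ex (Assign ''j'' (Minus (Var ''j'') (Const 1))) t (Suc 0)
         (\<lambda>t'. mcs_inv X t' \<and> potential X t' + Suc 2 \<le> potential X t)"
        using mcs_state_decrease[OF st True] j0
        by (intro ex_straight) (auto simp: mcs_inv_def potential_def defs)
    qed (use True in \<open>simp add: j_def sz_def\<close>)
    then show ?thesis by blast
  next
    case False
    then obtain q where q: "sz j = Suc q" using not0_implies_Suc by blast
    define u where "u = bk (j * W + q)"
    define t1 where "t1 = effect pop_prog t"
    have bj: "arr t ''base'' j = j * W" using env jn by (simp add: env_def)
    have t1: "arr t1 ''num'' = num" "arr t1 ''cnt'' = cnt" "arr t1 ''sz'' = sz(j := q)"
      "arr t1 ''bk'' = bk" "reg t1 ''u'' = u" "reg t1 ''k'' = k" "reg t1 ''j'' = j"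
      "reg t1 ''ok'' = ok" "arr t1 ''st'' = arr t ''st''"
      using q bj by (simp_all add: t1_def pop_prog_def defs u_def)
    have un1: "unchanged pop_prog t t1"
      unfolding t1_def using exec_straight[of pop_prog t] exec_unchanged
      by (force simp: pop_prog_def)
    have env1: "env t1" by (rule env_unchanged[OF env un1]) (auto simp: pop_prog_def graph_arrays_def)
    have sum1: "Suc (\<Sum>i\<le>n. (sz(j := q)) i) = (\<Sum>i\<le>n. sz i)"
      using sum_fun_upd[OF jn, of sz q] q by simp
    have pot: "potential X t = 6 * (\<Sum>i\<le>n. sz i) + 3 * j +
        40 * (\<Sum>x\<in>{x \<in> X. num x = 0}. Suc (length (nb x)))"
      by (simp add: potential_def defs)
    \<comment> \<open>The 4 extra units are for the pop, the outer test and the loop test.\<close>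
    have "\<exists>l. ex (If (Eq (Get ''num'' (Var ''u'')) (Const 0)) visit_prog Skip) t1 l
       (\<lambda>t'. mcs_inv X t' \<and> potential X t' + (l + 4) \<le> potential X t)"
    proof (cases "num u = 0")
      case False
      have "ex (If (Eq (Get ''num'' (Var ''u'')) (Const 0)) visit_prog Skip) t1 (Suc 1)
         (\<lambda>t'. mcs_inv X t' \<and> potential X t' + (Suc 1 + 4) \<le> potential X t)"
      proof (rule ex_If)
        have "mcs_inv X t1" using mcs_state_skip[OF st Xn q] False by (simp add: mcs_inv_def t1 u_def)
        moreover have "potential X t1 + (Suc 1 + 4) \<le> potential X t"
          unfolding pot using sum1 by (simp add: potential_def t1)
        ultimately show "ex Skip t1 1 (\<lambda>t'. mcs_inv X t' \<and> potential X t' + (Suc 1 + 4) \<le> potential X t)"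
          by (intro ex_straight) auto
      qed (use False t1 in simp)
      then show ?thesis by blast
    next
      case True
      note visit = mcs_state_visit[OF st Xn q u_def True]
      have un: "u < n" using visit(1) Xn by auto
      define D where "D = length (nb u)"
      define num' where "num' = num(u := Suc k)"
      define t2 where "t2 = effect visit_init_prog t1"
      have t2: "arr t2 ''num'' = num'" "arr t2 ''cnt'' = cnt" "arr t2 ''sz'' = sz(j := q)"
        "arr t2 ''bk'' = bk" "reg t2 ''u'' = u" "reg t2 ''k'' = Suc k" "reg t2 ''j'' = j"
        "reg t2 ''ok'' = ok" "arr t2 ''st'' = arr t ''st''" "reg t2 ''d'' = D"
        "reg t2 ''b'' = 0"
        using env1 un by (simp_all add: t2_def visit_init_prog_def t1 num'_def D_def env_def)
      have un2: "unchanged visit_init_prog t1 t2"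
        unfolding t2_def using exec_straight[of visit_init_prog t1] exec_unchanged
        by (force simp: visit_init_prog_def)
      have env2: "env t2"
        by (rule env_unchanged[OF env1 un2]) (auto simp: visit_init_prog_def graph_arrays_def)
      have X2: "X = members t2" using X t2 by (simp add: members_def)
      have total: "(\<Sum>i\<le>n. (sz(j := q)) i) + D \<le> n + 2 * m"
        using st visit(6)[of "\<lambda>x. length (nb x)"] sum1 by (simp add: mcs_state_def D_def)
      have pre: "buckets X num' cnt (sz(j := q)) bk"
        "\<And>x. x \<in> X \<Longrightarrow> num' x = 0 \<Longrightarrow> cnt x \<le> j"
        "\<And>i. i \<le> n \<Longrightarrow> Suc j < i \<Longrightarrow> (sz(j := q)) i = 0"
        using visit(3,4) st by (auto simp: num'_def mcs_state_def split: if_splits)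
      let ?scan = "For ''e'' ''d'' scan_prog" and ?check = "For ''e'' ''d'' check_prog"
      let ?next = "Assign ''j'' (Plus (Var ''j'') (Const 1))"
      let ?l = "5 + ((2 + D * 10) + ((2 + D * 5) + 1))"
      let ?Q = "\<lambda>t'. mcs_inv X t' \<and> potential X t' + (Suc ?l + 4) \<le> potential X t"
      have "ex (?scan ;; ?check ;; ?next) t2 ((2 + D * 10) + ((2 + D * 5) + 1)) ?Q"
      proof (rule ex_Seq, rule ex_conseq)
        show "ex ?scan t2 (2 + length (nb u) * 10) (\<lambda>t.
           buckets X (arr t2 ''num'') (arr t ''cnt'') (arr t ''sz'') (arr t ''bk'') \<and>
           (\<forall>x\<in>X. arr t2 ''num'' x = 0 \<longrightarrow>
              arr t ''cnt'' x = arr t2 ''cnt'' x + (if adj E u x then 1 else 0)) \<and>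
           (\<forall>i\<le>n. Suc j < i \<longrightarrow> arr t ''sz'' i = 0) \<and>
           (\<Sum>i\<le>n. arr t ''sz'' i) \<le> (\<Sum>i\<le>n. arr t2 ''sz'' i) + length (nb u) \<and>
           (\<forall>w\<in>X. adj E u w \<longrightarrow> arr t2 ''num'' w \<le> reg t ''b'') \<and>
           (reg t ''b'' \<noteq> 0 \<longrightarrow> reg t ''p'' \<in> X \<and> adj E u (reg t ''p'') \<and>
              arr t2 ''num'' (reg t ''p'') = reg t ''b''))"
          by (rule scan_correct[OF env2 X2 un])
            (use t2 visit(2) total pre in \<open>simp_all add: D_def\<close>)
      next
        fix t3 assume scan: "buckets X (arr t2 ''num'') (arr t3 ''cnt'') (arr t3 ''sz'') (arr t3 ''bk'') \<and>
           (\<forall>x\<in>X. arr t2 ''num'' x = 0 \<longrightarrow>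
              arr t3 ''cnt'' x = arr t2 ''cnt'' x + (if adj E u x then 1 else 0)) \<and>
           (\<forall>i\<le>n. Suc j < i \<longrightarrow> arr t3 ''sz'' i = 0) \<and>
           (\<Sum>i\<le>n. arr t3 ''sz'' i) \<le> (\<Sum>i\<le>n. arr t2 ''sz'' i) + length (nb u) \<and>
           (\<forall>w\<in>X. adj E u w \<longrightarrow> arr t2 ''num'' w \<le> reg t3 ''b'') \<and>
           (reg t3 ''b'' \<noteq> 0 \<longrightarrow> reg t3 ''p'' \<in> X \<and> adj E u (reg t3 ''p'') \<and>
              arr t2 ''num'' (reg t3 ''p'') = reg t3 ''b'')"
          and un3: "unchanged ?scan t2 t3"
        have t3: "arr t3 ''num'' = num'" "reg t3 ''u'' = u" "reg t3 ''k'' = Suc k"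
          "reg t3 ''j'' = j" "reg t3 ''ok'' = ok" "arr t3 ''st'' = arr t ''st''" "reg t3 ''d'' = D"
          using un3 t2 by (auto simp: unchanged_def)
        have env3: "env t3" by (rule env_unchanged[OF env2 un3]) (auto simp: graph_arrays_def)
        have X3: "X = members t3" using X t3 by (simp add: members_def)
        have p3: "reg t3 ''p'' < n \<or> (\<forall>w\<in>X. adj E u w \<longrightarrow> num' w = 0)"
          using scan Xn by (cases "reg t3 ''b'' = 0") (auto simp: t2)
        have ok3: "reg t3 ''ok'' \<le> 1" using st by (simp add: t3 mcs_state_def)
        show "ex (?check ;; ?next) t3 ((2 + D * 5) + 1) ?Q"
        proof (rule ex_Seq, rule ex_conseq)
          show "ex ?check t3 (2 + length (nb u) * 5) (\<lambda>t. reg t ''ok'' \<le> 1 \<and>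
             (reg t ''ok'' = 1 \<longleftrightarrow> reg t3 ''ok'' = 1 \<and> (\<forall>w\<in>X. adj E u w \<and> arr t3 ''num'' w \<noteq> 0 \<and>
                w \<noteq> reg t3 ''p'' \<longrightarrow> adj E (reg t3 ''p'') w)))"
            by (rule check_correct[OF env3 X3 un]) (use t3 p3 ok3 in \<open>auto simp: D_def\<close>)
        next
          fix t4 assume check: "reg t4 ''ok'' \<le> 1 \<and>
             (reg t4 ''ok'' = 1 \<longleftrightarrow> reg t3 ''ok'' = 1 \<and> (\<forall>w\<in>X. adj E u w \<and> arr t3 ''num'' w \<noteq> 0 \<and>
                w \<noteq> reg t3 ''p'' \<longrightarrow> adj E (reg t3 ''p'') w))"
            and un4: "unchanged ?check t3 t4"
          have t4: "arr t4 ''num'' = num'" "arr t4 ''cnt'' = arr t3 ''cnt''"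
            "arr t4 ''sz'' = arr t3 ''sz''" "arr t4 ''bk'' = arr t3 ''bk''"
            "reg t4 ''k'' = Suc k" "reg t4 ''j'' = j"
            using un4 t3 by (auto simp: unchanged_def)
          have "mcs_state X num' (arr t3 ''cnt'') (arr t3 ''sz'') (arr t3 ''bk'') (Suc k) (Suc j)
             (reg t4 ''ok'')"
            unfolding num'_def
            by (rule visit(7)[where b = "reg t3 ''b''" and p = "reg t3 ''p''"])
              (use scan check in \<open>simp_all add: t2 t3 num'_def\<close>)
          then have "mcs_inv X (effect ?next t4)" by (simp add: mcs_inv_def t4)
          moreover have "potential X (effect ?next t4) + (Suc ?l + 4) \<le> potential X t"
          proof -
            have "(\<Sum>i\<le>n. arr t3 ''sz'' i) \<le> (\<Sum>i\<le>n. (sz(j := q)) i) + D"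
              using scan by (simp add: t2 D_def)
            then show ?thesis
              unfolding pot visit(6)[of "\<lambda>x. Suc (length (nb x))"] num'_def[symmetric]
              using sum1 by (simp add: potential_def t4 D_def[symmetric])
          qed
          ultimately show "ex ?next t4 1 ?Q"
            by (intro ex_straight) auto
        qed (simp add: D_def)
      qed (simp add: D_def)
      then have "ex visit_prog t1 ?l ?Q"
        unfolding visit_prog_def
        by - (rule ex_Seq, rule ex_straight, simp_all add: t2_def)
      then have "ex (If (Eq (Get ''num'' (Var ''u'')) (Const 0)) visit_prog Skip) t1 (Suc ?l) ?Q"
        by (intro ex_If) (use t1 True in auto)
      then show ?thesis by blast
    qed
    then obtain l where "ex (If (Eq (Get ''num'' (Var ''u'')) (Const 0)) visit_prog Skip) t1 l
       (\<lambda>t'. mcs_inv X t' \<and> potential X t' + (l + 4) \<le> potential X t)" by blast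
    then have "ex (pop_prog ;; If (Eq (Get ''num'' (Var ''u'')) (Const 0)) visit_prog Skip) t (2 + l)
       (\<lambda>t'. mcs_inv X t' \<and> potential X t' + Suc (Suc (2 + l)) \<le> potential X t)"
      by - (rule ex_Seq, rule ex_straight, simp_all add: t1_def[symmetric] numeral_eq_Suc)
    then have "ex mcs_step_prog t (Suc (2 + l))
       (\<lambda>t'. mcs_inv X t' \<and> potential X t' + Suc (Suc (2 + l)) \<le> potential X t)"
      unfolding mcs_step_prog_def by (intro ex_If) (use q in \<open>auto simp: j_def sz_def\<close>)
    then show ?thesis by blast
  qed
qed


text \<open>When all buckets are empty every member has been visited, and the numbering is a full
  search order. Then \<open>ok\<close> tells whether it is an insertion order, which for a search
  order is equivalent to chordality. Number 0 outside \<open>X\<close> is exported as the default on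
  which candidates rely.\<close>

lemma mcs_correct:
  assumes env: "env s" and X: "X = members s"
  shows "ex mcs_prog s (100 * W) (\<lambda>t.
     (reg t ''ok'' = 1 \<longleftrightarrow> chordal (induced_edges E X)) \<and>
     (chordal (induced_edges E X) \<longrightarrow> insertion_order E X (arr t ''num'')) \<and>
     (\<forall>x<n. x \<notin> X \<longrightarrow> arr t ''num'' x = 0))" (is "ex _ _ _ ?Q")
proof -
  have Xn: "X \<subseteq> {..<n}" and finX: "finite X" by (auto simp: X members_def)
  let ?c1 = "Put ''sz'' (Var ''i'') (Const 0)"
  let ?c2 = "Put ''cnt'' (Var ''i'') (Const 0) ;;
        Put ''num'' (Var ''i'') (Const 0) ;;
        If (Eq (Get ''st'' (Var ''i'')) (Const 2))
          (Put ''bk'' (Get ''sz'' (Const 0)) (Var ''i'') ;;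
           Put ''sz'' (Const 0) (Plus (Get ''sz'' (Const 0)) (Const 1)))
          Skip"
  let ?c3 = "Assign ''k'' (Const 0) ;; Assign ''j'' (Const 0) ;; Assign ''ok'' (Const 1)"
  let ?b = "Not (And (Eq (Var ''j'') (Const 0)) (Eq (Get ''sz'' (Const 0)) (Const 0)))"
  define Y where "Y i = {x \<in> X. x < i}" for i
  let ?I = "\<lambda>i t. (\<forall>x<i. arr t ''cnt'' x = 0 \<and> arr t ''num'' x = 0) \<and>
     (\<forall>j. 0 < j \<and> j \<le> n \<longrightarrow> arr t ''sz'' j = 0) \<and> arr t ''sz'' 0 = card (Y i) \<and>
     (\<forall>q<arr t ''sz'' 0. arr t ''bk'' q \<in> X) \<and> (\<forall>x\<in>Y i. \<exists>q<arr t ''sz'' 0. arr t ''bk'' q = x)"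
  \<comment> \<open>The bound is the initial potential, 6 for each of at most \<open>n\<close>
    entries and 40 for every vertex and every neighbour list entry, plus the final test.\<close>
  have loop: "ex (While ?b mcs_step_prog) t (46 * n + 80 * m + 1) ?Q"
    if t: "env t" "X = members t" "mcs_inv X t" "potential X t \<le> 46 * n + 80 * m" for t
  proof -
    have "ex (While ?b mcs_step_prog) t (Suc (potential X t)) ?Q"
    proof (rule ex_While[where I = "\<lambda>t. env t \<and> X = members t \<and> mcs_inv X t"])
      fix t' assume t': "env t' \<and> X = members t' \<and> mcs_inv X t'" "bval ?b t'"
      then obtain k where k: "ex mcs_step_prog t' k
          (\<lambda>t''. mcs_inv X t'' \<and> potential X t'' + Suc k \<le> potential X t')"
        using mcs_step[of t' X] by auto
      have "ex mcs_step_prog t' k (\<lambda>t''. (env t'' \<and> X = members t'' \<and> mcs_inv X t'') \<and>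
          potential X t'' + Suc k \<le> potential X t')"
      proof (rule ex_conseq[OF k order_refl])
        fix t'' assume *: "mcs_inv X t'' \<and> potential X t'' + Suc k \<le> potential X t'"
          and un: "unchanged mcs_step_prog t' t''"
        have "env t''" by (rule env_unchanged[of t', OF _ un]) (use t' in \<open>auto simp: graph_arrays_def\<close>)
        moreover have "members t'' = members t'"
          by (rule members_cong) (use un in \<open>auto simp: unchanged_def\<close>)
        ultimately show "(env t'' \<and> X = members t'' \<and> mcs_inv X t'') \<and>
          potential X t'' + Suc k \<le> potential X t'" using * t' by simp
      qed
      then show "\<exists>k. ex mcs_step_prog t' k (\<lambda>t''. (env t'' \<and> X = members t'' \<and> mcs_inv X t'') \<and>
          potential X t'' + Suc k \<le> potential X t')" by blast
    next
      fix t' assume t': "env t' \<and> X = members t' \<and> mcs_inv X t'" "\<not> bval ?b t'"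
      let ?num = "arr t' ''num''"
      have st: "mcs_state X ?num (arr t' ''cnt'') (arr t' ''sz'') (arr t' ''bk'')
         (reg t' ''k'') (reg t' ''j'') (reg t' ''ok'')" using t'(1) unfolding mcs_inv_def by blast
      have sz0: "arr t' ''sz'' i = 0" if "i \<le> n" for i
        using st t'(2) that by (cases "i = 0") (auto simp: mcs_state_def)
      \<comment> \<open>An unvisited member would still own an entry in the bucket of its
        count.\<close>
      have "?num x \<noteq> 0" if "x \<in> X" for x
      proof
        assume "?num x = 0"
        then have "arr t' ''cnt'' x \<le> n" "\<exists>i. i < arr t' ''sz'' (arr t' ''cnt'' x)"
          using st that unfolding mcs_state_def buckets_def by blast+
        then show False using sz0 by simp
      qed
      then have V: "visited X ?num = X" by blast
      have mcs: "mcs_order E X ?num" using st unfolding mcs_state_def mcs_order_def V by blast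
      have ok: "reg t' ''ok'' = 1 \<longleftrightarrow> insertion_order E X ?num"
        using st unfolding mcs_state_def insertion_order_def V by blast
      have ch: "chordal (induced_edges E X) \<longleftrightarrow> insertion_order E X ?num"
        using mcs_insertion_order[OF _ finX mcs E] insertion_order_chordal by blast
      show "?Q t'" using ok ch st unfolding mcs_state_def by blast
    qed (use t in auto)
    then show ?thesis by (rule ex_conseq) (use t in auto)
  qed
  have start: "ex (?c3 ;; While ?b mcs_step_prog) t (3 + (46 * n + 80 * m + 1)) ?Q"
    if t: "env t" "X = members t" "?I n t" for t
  proof (rule ex_Seq, rule ex_straight)
    let ?t = "effect ?c3 t"
    have num0: "arr t ''num'' x = 0" "arr t ''cnt'' x = 0" if "x \<in> X" for x
      using t(3) Xn that by auto
    have t_eqs: "arr ?t = arr t" "reg ?t ''k'' = 0" "reg ?t ''j'' = 0" "reg ?t ''ok'' = 1"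
      by simp_all
    have V: "visited X (arr t ''num'') = {}" "{x \<in> X. arr t ''num'' x = 0} = X" using num0 by auto
    have Yn: "Y n = X" using Xn by (auto simp: Y_def)
    have cX: "card X \<le> n" using card_mono[OF _ Xn] by simp
    have "(\<Sum>i\<le>n. arr t ''sz'' i) = (\<Sum>i\<in>{0}. arr t ''sz'' i)"
      using t(3) by (intro sum.mono_neutral_right) auto
    then have sum0: "(\<Sum>i\<le>n. arr t ''sz'' i) = card X" using t(3) Yn by simp
    have "buckets X (arr t ''num'') (arr t ''cnt'') (arr t ''sz'') (arr t ''bk'')"
      unfolding buckets_def
    proof (intro conjI allI ballI impI)
      fix j i assume ji: "j \<le> n" "i < arr t ''sz'' j"
      then have "j = 0" using t(3) by (cases "j = 0") auto
      then show "arr t ''bk'' (j * W + i) \<in> X" using t(3) ji by auto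
      show "j \<le> arr t ''cnt'' (arr t ''bk'' (j * W + i))" using \<open>j = 0\<close> by simp
    next
      fix x assume "x \<in> X"
      then show "arr t ''cnt'' x \<le> n"
        "\<exists>i<arr t ''sz'' (arr t ''cnt'' x). arr t ''bk'' (arr t ''cnt'' x * W + i) = x"
        using num0[of x] t(3) Yn by auto
    qed
    then have inv: "mcs_inv X ?t"
      using t(3) num0 cX sum_degree_bound[OF Xn]
      unfolding mcs_inv_def mcs_state_def t_eqs V sum0 by simp
    have pot: "potential X ?t \<le> 46 * n + 80 * m"
      using cX sum_degree_bound[OF Xn] by (simp add: potential_def sum0 V sum_Suc)
    have un: "unchanged ?c3 t ?t" by (auto simp: unchanged_def)
    have "env ?t" by (rule env_unchanged[OF t(1) un]) (auto simp: graph_arrays_def)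
    moreover have "X = members ?t" using t(2) by (simp add: members_def)
    ultimately show "ex (While ?b mcs_step_prog) ?t (46 * n + 80 * m + 1) ?Q"
      using loop inv pot by blast
  qed auto
  have fill: "ex (For ''i'' ''n'' ?c2) t (2 + n * (5 + 2)) (?I n)"
    if t: "env t" "X = members t" "\<forall>j\<le>n. arr t ''sz'' j = 0" for t
  proof (rule ex_For_const[where I = ?I])
    show "reg t ''n'' = n" using t by (simp add: env_def)
    show "?I 0 t" using t(3) by (auto simp: Y_def)
  next
    fix i t' assume i: "i < n" and I: "?I i t'" and ri: "reg t' ''i'' = i"
      and un: "unchanged (For ''i'' ''n'' ?c2) t t'"
    have st: "arr t' ''st'' i = 2 \<longleftrightarrow> i \<in> X" using un i t(2) by (auto simp: unchanged_def members_def)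
    have Y: "Y (Suc i) = (if i \<in> X then insert i (Y i) else Y i)" "i \<notin> Y i"
      by (auto simp: Y_def less_Suc_eq)
    have fY: "finite (Y i)" using finX by (simp add: Y_def)
    have *: "?I (Suc i) (effect ?c2 t')"
    proof (cases "i \<in> X")
      case False
      then show ?thesis using I ri st by (auto simp: Y less_Suc_eq)
    next
      case True
      define z where "z = card (Y i)"
      have z: "arr t' ''sz'' 0 = z" using I by (simp add: z_def)
      have cY: "card (Y (Suc i)) = Suc z" using True Y fY by (simp add: z_def)
      have e: "arr (effect ?c2 t') ''cnt'' = (arr t' ''cnt'')(i := 0)"
        "arr (effect ?c2 t') ''num'' = (arr t' ''num'')(i := 0)"
        "arr (effect ?c2 t') ''sz'' = (arr t' ''sz'')(0 := Suc z)"
        "arr (effect ?c2 t') ''bk'' = (arr t' ''bk'')(z := i)"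
        using True st ri z by simp_all
      have "\<exists>q<Suc z. ((arr t' ''bk'')(z := i)) q = x" if x: "x \<in> Y (Suc i)" for x
      proof (cases "x = i")
        case False
        then have "x \<in> Y i" using x True Y by auto
        then obtain q where "q < z" "arr t' ''bk'' q = x" using I z by auto
        then show ?thesis by (intro exI[of _ q]) auto
      qed (auto intro: exI[of _ z])
      then show ?thesis unfolding e cY using I True z by (auto simp: less_Suc_eq)
    qed
    show "ex ?c2 t' 5 (?I (Suc i))" by (rule ex_straight, simp, simp, rule *)
  qed auto
  let ?cost = "(2 + Suc n * (1 + 2)) + ((2 + n * (5 + 2)) + (3 + (46 * n + 80 * m + 1)))"
  have "ex mcs_prog s ?cost ?Q"
    unfolding mcs_prog_def
  proof (rule ex_Seq, rule ex_For_const[where I = "\<lambda>i t. \<forall>j<i. arr t ''sz'' j = 0"])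
    show "reg s ''n1'' = Suc n" using env by (simp add: env_def)
  next
    fix t assume sz: "\<forall>j<Suc n. arr t ''sz'' j = 0" and un: "unchanged (For ''i'' ''n1'' ?c1) s t"
    have t: "env t" by (rule env_unchanged[OF env un]) (auto simp: graph_arrays_def)
    have Xt: "X = members t" using X un members_cong[of t s] by (auto simp: unchanged_def)
    show "ex (For ''i'' ''n'' ?c2 ;; (?c3 ;; While ?b mcs_step_prog)) t
       ((2 + n * (5 + 2)) + (3 + (46 * n + 80 * m + 1))) ?Q"
    proof (rule ex_Seq, rule ex_conseq[OF fill order_refl])
      fix u assume I: "?I n u" and un: "unchanged (For ''i'' ''n'' ?c2) t u"
      have "env u" by (rule env_unchanged[OF t un]) (auto simp: graph_arrays_def)
      moreover have "X = members u" using Xt un members_cong[of u t] by (auto simp: unchanged_def)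
      ultimately show "ex (?c3 ;; While ?b mcs_step_prog) u (3 + (46 * n + 80 * m + 1)) ?Q"
        using start I by blast
    qed (use t Xt sz in auto)
  qed (auto intro!: ex_straight simp: less_Suc_eq)
  then show ?thesis by (rule ex_conseq) (auto simp: W_def)
qed

end

section \<open>Extending a set to a solution\<close>

text \<open>\<open>y = n\<close> reports that nothing is left to try.\<close>

definition find_prog :: com where
  "find_prog =
     Assign ''y'' (Var ''n'') ;;
     For ''i'' ''n''
       (If (And (Eq (Get ''st'' (Var ''i'')) (Const 1)) (Eq (Get ''al'' (Var ''i'')) (Const 1)))
         (Assign ''y'' (Var ''i'')) Skip)"

definition link_test :: "bool \<Rightarrow> bexp" where
  "link_test cn =
     (if cn then Eq (Get ''adj'' (Plus (Get ''base'' (Var ''y'')) (Var ''i''))) (Const 1)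
      else Eq (Const 0) (Const 0))"

definition spread_prog :: "bool \<Rightarrow> com" where
  "spread_prog cn =
     For ''i'' ''n''
       (If (And (Eq (Get ''st'' (Var ''i'')) (Const 0)) (link_test cn))
         (Put ''st'' (Var ''i'') (Const 1)) Skip)"

definition try_prog :: "bool \<Rightarrow> com" where
  "try_prog cn =
     Put ''st'' (Var ''y'') (Const 2) ;;
     mcs_prog ;;
     If (Eq (Var ''ok'') (Const 1)) (spread_prog cn) (Put ''st'' (Var ''y'') (Const 3))"

definition round_prog :: "bool \<Rightarrow> com" where
  "round_prog cn = find_prog ;; If (Less (Var ''y'') (Var ''n'')) (try_prog cn) Skip"

definition grow_prog :: "bool \<Rightarrow> com" where
  "grow_prog cn = For ''r'' ''n'' (round_prog cn)"

definition clear_prog :: com where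
  "clear_prog = For ''i'' ''n'' (Put ''st'' (Var ''i'') (Const 0))"

definition allow_prog :: com where
  "allow_prog = For ''i'' ''n'' (Put ''al'' (Var ''i'') (Const 1))"

text \<open>Marks are kept between the two growths: a vertex rejected in the first stays rejected,
  since the set has only become larger.\<close>

definition extend_prog :: "bool \<Rightarrow> com" where
  "extend_prog cn =
     clear_prog ;; Put ''st'' (Var ''v'') (Const 1) ;; grow_prog cn ;; allow_prog ;; grow_prog cn"

abbreviation mcs_regs :: "string set" where
  "mcs_regs \<equiv> {''w'', ''c'', ''b'', ''p'', ''k'', ''d'', ''e'', ''ok'', ''j'', ''u'', ''i''}"

lemma grow_parts_changes [simp]:
  "regs_of find_prog = {''y'', ''i''}" "arrs_of find_prog = {}"
  "regs_of (spread_prog cn) = {''i''}" "arrs_of (spread_prog cn) = {''st''}"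
  "regs_of (try_prog cn) = mcs_regs" "arrs_of (try_prog cn) = {''st'', ''cnt'', ''bk'', ''sz'', ''num''}"
  "regs_of (round_prog cn) = insert ''y'' mcs_regs"
  "arrs_of (round_prog cn) = {''st'', ''cnt'', ''bk'', ''sz'', ''num''}"
  "regs_of (grow_prog cn) = {''r'', ''y''} \<union> mcs_regs"
  "arrs_of (grow_prog cn) = {''st'', ''cnt'', ''bk'', ''sz'', ''num''}"
  "regs_of clear_prog = {''i''}" "arrs_of clear_prog = {''st''}"
  "regs_of allow_prog = {''i''}" "arrs_of allow_prog = {''al''}"
  "regs_of (extend_prog cn) = {''r'', ''y''} \<union> mcs_regs"
  "arrs_of (extend_prog cn) = {''st'', ''al'', ''cnt'', ''bk'', ''sz'', ''num''}"
  by (auto simp: find_prog_def spread_prog_def try_prog_def round_prog_def grow_prog_def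
      clear_prog_def allow_prog_def extend_prog_def)

context graph begin

lemma find_correct:
  assumes env: "env s"
  shows "ex find_prog s (3 + n * 4) (\<lambda>t.
     reg t ''y'' < n \<and> arr s ''st'' (reg t ''y'') = 1 \<and> arr s ''al'' (reg t ''y'') = 1 \<or>
     reg t ''y'' = n \<and> (\<forall>u<n. \<not> (arr s ''st'' u = 1 \<and> arr s ''al'' u = 1)))" (is "ex _ _ _ ?Q")
proof -
  let ?b = "If (And (Eq (Get ''st'' (Var ''i'')) (Const 1)) (Eq (Get ''al'' (Var ''i'')) (Const 1)))
         (Assign ''y'' (Var ''i'')) Skip"
  let ?f = "For ''i'' ''n'' ?b"
  have "ex find_prog s (1 + (2 + n * (2 + 2))) ?Q"
    unfolding find_prog_def
  proof (rule ex_Seq, rule ex_straight)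
    let ?s = "effect (Assign ''y'' (Var ''n'')) s"
    show "ex ?f ?s (2 + n * (2 + 2)) ?Q"
    proof (rule ex_For_const[where I = "\<lambda>i t.
        reg t ''y'' < n \<and> arr s ''st'' (reg t ''y'') = 1 \<and> arr s ''al'' (reg t ''y'') = 1 \<or>
        reg t ''y'' = n \<and> (\<forall>u<i. \<not> (arr s ''st'' u = 1 \<and> arr s ''al'' u = 1))"])
      show "reg ?s ''n'' = n" using env by (simp add: env_def)
      show "reg ?s ''y'' < n \<and> arr s ''st'' (reg ?s ''y'') = 1 \<and> arr s ''al'' (reg ?s ''y'') = 1 \<or>
        reg ?s ''y'' = n \<and> (\<forall>u<0. \<not> (arr s ''st'' u = 1 \<and> arr s ''al'' u = 1))"
        using env by (simp add: env_def)
    next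
      fix i t assume i: "i < n" and ri: "reg t ''i'' = i" and un: "unchanged ?f ?s t"
        and I: "reg t ''y'' < n \<and> arr s ''st'' (reg t ''y'') = 1 \<and> arr s ''al'' (reg t ''y'') = 1 \<or>
        reg t ''y'' = n \<and> (\<forall>u<i. \<not> (arr s ''st'' u = 1 \<and> arr s ''al'' u = 1))"
      have a: "arr t = arr s" using un by (auto simp: unchanged_def)
      show "ex ?b t 2 (\<lambda>t.
        reg t ''y'' < n \<and> arr s ''st'' (reg t ''y'') = 1 \<and> arr s ''al'' (reg t ''y'') = 1 \<or>
        reg t ''y'' = n \<and> (\<forall>u<Suc i. \<not> (arr s ''st'' u = 1 \<and> arr s ''al'' u = 1)))"
        by (rule ex_straight) (use i ri I a in \<open>auto simp: less_Suc_eq\<close>)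
    qed auto
  qed auto
  then show ?thesis by (rule ex_conseq) auto
qed

lemma link_test_correct:
  assumes "env s" "reg s ''y'' = y" "reg s ''i'' = i" "y < n" "i < n"
  shows "bval (link_test cn) s \<longleftrightarrow> linked cn E y i"
  using assms by (auto simp: link_test_def linked_def env_def)

lemma spread_correct:
  assumes env: "env s" and y: "reg s ''y'' < n"
  shows "ex (spread_prog cn) s (2 + n * 4) (\<lambda>t. \<forall>u<n. arr t ''st'' u =
     (if arr s ''st'' u = 0 \<and> linked cn E (reg s ''y'') u then 1 else arr s ''st'' u))"
    (is "ex _ _ _ ?Q")
proof -
  let ?b = "If (And (Eq (Get ''st'' (Var ''i'')) (Const 0)) (link_test cn))
         (Put ''st'' (Var ''i'') (Const 1)) Skip"
  let ?I = "\<lambda>i t. \<forall>u. arr t ''st'' u =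
     (if u < i \<and> arr s ''st'' u = 0 \<and> linked cn E (reg s ''y'') u then 1 else arr s ''st'' u)"
  have "ex (spread_prog cn) s (2 + n * (2 + 2)) ?Q"
    unfolding spread_prog_def
  proof (rule ex_For_const[where I = ?I])
    show "reg s ''n'' = n" using env by (simp add: env_def)
  next
    fix i t assume i: "i < n" and ri: "reg t ''i'' = i" and un: "unchanged (For ''i'' ''n'' ?b) s t"
      and I: "?I i t"
    have t: "env t" by (rule env_unchanged[OF env un]) (auto simp: graph_arrays_def)
    have ry: "reg t ''y'' = reg s ''y''" using un by (auto simp: unchanged_def)
    have "bval (link_test cn) t \<longleftrightarrow> linked cn E (reg s ''y'') i"
      by (rule link_test_correct[OF t ry ri y i])
    then show "ex ?b t 2 (?I (Suc i))"
      by (intro ex_straight) (use i ri I in \<open>auto simp: less_Suc_eq\<close>)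
  qed auto
  then show ?thesis by (rule ex_conseq) auto
qed

text \<open>Vertices carry the marks 0 (not linked to the current set), 1 (linked, to be tried),
  2 (in the current set) and 3 (rejected).\<close>

definition growing :: "bool \<Rightarrow> nat \<Rightarrow> state \<Rightarrow> bool" where
  "growing cn v s \<longleftrightarrow> (let X = members s; st = arr s ''st'' in
     (\<forall>u<n. st u \<le> 3) \<and> chordal (induced_edges E X) \<and> conn_if cn E X \<and>
     (v \<in> X \<or> X = {} \<and> st v = 1 \<and> (\<forall>u<n. u \<noteq> v \<longrightarrow> st u = 0)) \<and>
     (\<forall>u<n. st u = 1 \<longrightarrow> X \<noteq> {} \<longrightarrow> (\<exists>x\<in>X. linked cn E x u)) \<and>
     (\<forall>u<n. st u = 0 \<longrightarrow> (\<forall>x\<in>X. \<not> linked cn E x u)) \<and>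
     (\<forall>u<n. st u = 3 \<longrightarrow> \<not> chordal (induced_edges E (insert u X))))"

definition allowed :: "state \<Rightarrow> nat set" where
  "allowed s = {u. u < n \<and> arr s ''al'' u = 1}"

text \<open>Rejections stay justified because a superset of a nonchordal set is nonchordal, and
  links to the set are never lost. The start is special: with the empty set only \<open>v\<close>
  may be tried, and it is always accepted.\<close>

lemma try_correct:
  assumes env: "env s" and v: "v < n" and g: "growing cn v s"
    and y: "y < n" "reg s ''y'' = y" "arr s ''st'' y = 1"
  shows "ex (try_prog cn) s (4 + n * 4 + 100 * W) (\<lambda>t. growing cn v t \<and>
     members s \<subseteq> members t \<and> members t \<subseteq> insert y (members s) \<and>
     arr t ''st'' y \<ge> 2 \<and> (\<forall>u<n. arr s ''st'' u \<ge> 2 \<longrightarrow> arr t ''st'' u \<ge> 2))" (is "ex _ _ _ ?Q")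
proof -
  define X where "X = members s"
  define st where "st = arr s ''st''"
  define X' where "X' = insert y X"
  have Xn: "X \<subseteq> {..<n}" by (auto simp: X_def members_def)
  have g1: "\<And>u. u < n \<Longrightarrow> st u \<le> 3" "chordal (induced_edges E X)" "conn_if cn E X"
    "v \<in> X \<or> X = {} \<and> st v = 1 \<and> (\<forall>u<n. u \<noteq> v \<longrightarrow> st u = 0)"
    "\<And>u. u < n \<Longrightarrow> st u = 1 \<Longrightarrow> X \<noteq> {} \<Longrightarrow> \<exists>x\<in>X. linked cn E x u"
    "\<And>u x. u < n \<Longrightarrow> st u = 0 \<Longrightarrow> x \<in> X \<Longrightarrow> \<not> linked cn E x u"
    "\<And>u. u < n \<Longrightarrow> st u = 3 \<Longrightarrow> \<not> chordal (induced_edges E (insert u X))"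
    using g unfolding growing_def Let_def X_def st_def by auto
  have yX: "y \<notin> X" using y by (simp add: X_def members_def)
  let ?put = "Put ''st'' (Var ''y'') (Const 2)"
  let ?if = "If (Eq (Var ''ok'') (Const 1)) (spread_prog cn) (Put ''st'' (Var ''y'') (Const 3))"
  define s1 where "s1 = effect ?put s"
  have s1: "arr s1 ''st'' = st(y := 2)" "reg s1 ''y'' = y" using y by (simp_all add: s1_def st_def)
  have un1: "unchanged ?put s s1" by (simp add: s1_def unchanged_def)
  have env1: "env s1" by (rule env_unchanged[OF env un1]) (auto simp: graph_arrays_def)
  have X1: "X' = members s1" using y(1) by (auto simp: X'_def X_def members_def s1 st_def)
  have final: "ex ?if t (Suc (2 + n * 4)) ?Q"
    if t: "env t" "reg t ''y'' = y" "arr t ''st'' = st(y := 2)"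
      "reg t ''ok'' = 1 \<longleftrightarrow> chordal (induced_edges E X')" for t
  proof (rule ex_If)
    assume "bval (Eq (Var ''ok'') (Const 1)) t"
    then have ch: "chordal (induced_edges E X')" using t by simp
    \<comment> \<open>Mark 1 means linked to the current set, so acceptance preserves
      connectedness.\<close>
    have X'c: "conn_if cn E X'"
    proof (cases "X = {}")
      case False
      then obtain x where "x \<in> X" "linked cn E x y" using g1(5)[of y] y by (auto simp: st_def)
      then show ?thesis unfolding X'_def by (rule conn_if_insert[OF g1(3)])
    qed (simp add: X'_def)
    show "ex (spread_prog cn) t (2 + n * 4) ?Q"
    proof (rule ex_conseq[OF spread_correct[OF t(1)] order_refl])
      show "reg t ''y'' < n" using t y by simp
      fix t' :: state assume "\<forall>u<n. arr t' ''st'' u =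
        (if arr t ''st'' u = 0 \<and> linked cn E (reg t ''y'') u then 1 else arr t ''st'' u)"
      then have st': "arr t' ''st'' u = (if u \<noteq> y \<and> st u = 0 \<and> linked cn E y u then 1 else (st(y := 2)) u)"
        if "u < n" for u using that t by simp
      have X2: "members t' = X'"
        using st' y(1) by (auto simp: members_def X'_def X_def st_def[symmetric] split: if_splits)
      have "growing cn v t'"
        unfolding growing_def Let_def X2
      proof (intro conjI allI impI)
        fix u assume u: "u < n"
        show "arr t' ''st'' u \<le> 3" using st'[OF u] g1(1)[OF u] by (auto split: if_splits)
      next
        \<comment> \<open>As long as \<open>v\<close> is not taken, it is the only vertex with a
          nonzero mark, so it is the one being tried.\<close>
        show "v \<in> X' \<or> X' = {} \<and> arr t' ''st'' v = 1 \<and> (\<forall>u<n. u \<noteq> v \<longrightarrow> arr t' ''st'' u = 0)"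
        proof (cases "v \<in> X")
          case False
          then have "\<forall>u<n. u \<noteq> v \<longrightarrow> st u = 0" using g1(4) by blast
          then have "y = v" using y(1,3) by (auto simp: st_def)
          then show ?thesis by (simp add: X'_def)
        qed (simp add: X'_def)
      next
        fix u assume u: "u < n" "arr t' ''st'' u = 1"
        have "st u = 0 \<and> linked cn E y u \<or> st u = 1 \<and> u \<noteq> y"
          using st'[OF u(1)] u(2) by (cases "u = y"; cases "st u = 0 \<and> linked cn E y u"; simp)
        moreover have "X \<noteq> {}" if "st u = 1" "u \<noteq> y"
        proof
          assume "X = {}"
          then have "\<forall>u<n. u \<noteq> v \<longrightarrow> st u = 0" using g1(4) by blast
          then have "u = v" "y = v" using that(1) u(1) y by (auto simp: st_def)
          then show False using that(2) by simp
        qed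
        ultimately show "\<exists>x\<in>X'. linked cn E x u" using g1(5)[OF u(1)] by (auto simp: X'_def)
      next
        fix u assume u: "u < n" "arr t' ''st'' u = 0"
        have "st u = 0" "\<not> linked cn E y u"
          using st'[OF u(1)] u(2) by (cases "u = y"; cases "st u = 0 \<and> linked cn E y u"; simp)+
        then show "\<forall>x\<in>X'. \<not> linked cn E x u" using g1(6)[OF u(1)] by (auto simp: X'_def)
      next
        fix u assume u: "u < n" "arr t' ''st'' u = 3"
        have "st u = 3" using st'[OF u(1)] u(2) by (cases "u = y"; cases "st u = 0 \<and> linked cn E y u"; simp)
        then have "\<not> chordal (induced_edges E (insert u X))" using g1(7)[OF u(1)] by simp
        then show "\<not> chordal (induced_edges E (insert u X'))"
          using chordal_mono[of E "insert u X'" "insert u X"] by (auto simp: X'_def)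
      qed (use ch X'c in auto)
      then show "?Q t'" using X2 st' y(1)
        by (auto simp: X'_def X_def[symmetric] st_def[symmetric])
    qed
  next
    assume "\<not> bval (Eq (Var ''ok'') (Const 1)) t"
    then have nch: "\<not> chordal (induced_edges E X')" using t by simp
    show "ex (Put ''st'' (Var ''y'') (Const 3)) t (2 + n * 4) ?Q"
    proof (rule ex_straight)
      let ?t = "effect (Put ''st'' (Var ''y'') (Const 3)) t"
      have st': "arr ?t ''st'' = st(y := 3)" using t by simp
      have X2: "members ?t = X"
        unfolding members_def st' using y by (auto simp: X_def members_def st_def)
      \<comment> \<open>A single vertex is chordal, so the first trial cannot fail and
        \<open>v\<close> is never rejected.\<close>
      have "X \<noteq> {}"
      proof
        assume "X = {}"
        have "chordal (induced_edges E {y})"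
          by (rule insertion_order_chordal[of E "{y}" "\<lambda>_. 0"])
            (auto simp: insertion_order_def prior_def clique_def)
        then show False using nch \<open>X = {}\<close> by (simp add: X'_def)
      qed
      then have "growing cn v ?t"
        unfolding growing_def Let_def X2 st' using g1 nch by (auto simp: X'_def)
      then show "?Q ?t" unfolding X2 st' X_def[symmetric] by (auto simp: st_def)
    qed auto
  qed
  have "ex (try_prog cn) s (1 + (100 * W + Suc (2 + n * 4))) ?Q"
    unfolding try_prog_def
  proof (rule ex_Seq, rule ex_straight)
    have "ex (mcs_prog ;; ?if) s1 (100 * W + Suc (2 + n * 4)) ?Q"
    proof (rule ex_Seq, rule ex_conseq[OF mcs_correct[OF env1 X1] order_refl])
      fix t assume ok: "(reg t ''ok'' = 1 \<longleftrightarrow> chordal (induced_edges E X')) \<and>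
        (chordal (induced_edges E X') \<longrightarrow> insertion_order E X' (arr t ''num'')) \<and>
        (\<forall>x<n. x \<notin> X' \<longrightarrow> arr t ''num'' x = 0)" and un: "unchanged mcs_prog s1 t"
      have "env t" by (rule env_unchanged[OF env1 un]) (auto simp: graph_arrays_def)
      moreover have "reg t ''y'' = y" "arr t ''st'' = st(y := 2)"
        using un s1 by (auto simp: unchanged_def)
      ultimately show "ex ?if t (Suc (2 + n * 4)) ?Q" using ok final by blast
    qed
    then show "ex (mcs_prog ;; ?if) (effect ?put s) (100 * W + Suc (2 + n * 4)) ?Q"
      unfolding s1_def by blast
  qed auto
  then show ?thesis by (rule ex_conseq) auto
qed

definition done_count :: "state \<Rightarrow> nat" where
  "done_count s = card {u. u < n \<and> arr s ''st'' u \<ge> 2}"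

text \<open>A round either settles one more vertex, giving it mark 2 or 3, or finds nothing to try
  and changes no mark. Hence after \<open>n\<close> rounds no allowed vertex is waiting.\<close>

lemma grow_correct:
  assumes env: "env s" and v: "v < n" and g: "growing cn v s"
  shows "ex (grow_prog cn) s (2 + n * (112 * W)) (\<lambda>t. growing cn v t \<and>
     members s \<subseteq> members t \<and> members t \<subseteq> members s \<union> allowed s \<and>
     (\<forall>u<n. \<not> (arr t ''st'' u = 1 \<and> arr s ''al'' u = 1)))"
proof -
  let ?fin = "\<lambda>t. \<forall>u<n. \<not> (arr t ''st'' u = 1 \<and> arr s ''al'' u = 1)"
  let ?I = "\<lambda>i t. growing cn v t \<and> members s \<subseteq> members t \<and> members t \<subseteq> members s \<union> allowed s \<and>
     (i \<le> done_count t \<or> ?fin t)"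
  have "ex (grow_prog cn) s (2 + n * (110 * W + 2)) (?I n)"
    unfolding grow_prog_def
  proof (rule ex_For_const[where I = ?I])
    show "reg s ''n'' = n" using env by (simp add: env_def)
    show "?I 0 s" using g by simp
  next
    fix i t x assume "?I i t"
    moreover have "arr (t\<lparr>reg := (reg t)(''r'' := x)\<rparr>) = arr t" by simp
    ultimately show "?I i (t\<lparr>reg := (reg t)(''r'' := x)\<rparr>)"
      by (simp add: growing_def members_def done_count_def)
  next
    fix i t assume I: "?I i t" and un: "unchanged (For ''r'' ''n'' (round_prog cn)) s t"
    have envt: "env t" by (rule env_unchanged[OF env un]) (auto simp: graph_arrays_def)
    have al: "arr t ''al'' = arr s ''al''" using un by (auto simp: unchanged_def)
    let ?if = "If (Less (Var ''y'') (Var ''n'')) (try_prog cn) Skip"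
    have "ex (round_prog cn) t ((3 + n * 4) + Suc (4 + n * 4 + 100 * W)) (?I (Suc i))"
      unfolding round_prog_def
    proof (rule ex_Seq, rule ex_conseq[OF find_correct[OF envt] order_refl])
      fix t1 assume f: "reg t1 ''y'' < n \<and> arr t ''st'' (reg t1 ''y'') = 1 \<and> arr t ''al'' (reg t1 ''y'') = 1 \<or>
         reg t1 ''y'' = n \<and> (\<forall>u<n. \<not> (arr t ''st'' u = 1 \<and> arr t ''al'' u = 1))"
        and un1: "unchanged find_prog t t1"
      have env1: "env t1" by (rule env_unchanged[OF envt un1]) (auto simp: graph_arrays_def)
      have a1: "arr t1 = arr t" using un1 by (auto simp: unchanged_def)
      have n1: "reg t1 ''n'' = n" using env1 by (simp add: env_def)
      have same: "members t1 = members t" "done_count t1 = done_count t" "growing cn v t1 = growing cn v t"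
        unfolding growing_def members_def done_count_def a1 by simp_all
      show "ex ?if t1 (Suc (4 + n * 4 + 100 * W)) (?I (Suc i))"
      proof (rule ex_If)
        assume "bval (Less (Var ''y'') (Var ''n'')) t1"
        then have y: "reg t1 ''y'' < n" using n1 by simp
        then have y1: "arr t ''st'' (reg t1 ''y'') = 1" "arr t ''al'' (reg t1 ''y'') = 1" using f by auto
        show "ex (try_prog cn) t1 (4 + n * 4 + 100 * W) (?I (Suc i))"
        proof (rule ex_conseq[OF try_correct[OF env1 v _ y refl] order_refl])
          show "growing cn v t1" using I same by simp
          show "arr t1 ''st'' (reg t1 ''y'') = 1" using y1 a1 by simp
        next
          let ?y = "reg t1 ''y''"
          fix t2 assume t2: "growing cn v t2 \<and> members t1 \<subseteq> members t2 \<and>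
             members t2 \<subseteq> insert ?y (members t1) \<and> arr t2 ''st'' ?y \<ge> 2 \<and>
             (\<forall>u<n. arr t1 ''st'' u \<ge> 2 \<longrightarrow> arr t2 ''st'' u \<ge> 2)"
          have "Suc (done_count t) = card (insert ?y {u. u < n \<and> arr t ''st'' u \<ge> 2})"
            unfolding done_count_def using y1 by simp
          also have "\<dots> \<le> done_count t2"
            unfolding done_count_def using t2 y by (intro card_mono) (auto simp: a1)
          finally have "Suc i \<le> done_count t2" using I y y1 al by auto
          moreover have "?y \<in> allowed s" using y y1 al by (simp add: allowed_def)
          ultimately show "?I (Suc i) t2" using t2 I same by auto
        qed
      next
        assume "\<not> bval (Less (Var ''y'') (Var ''n'')) t1"
        then have "?fin t1" using f n1 a1 al by auto
        then show "ex Skip t1 (4 + n * 4 + 100 * W) (?I (Suc i))"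
          using I same by (intro ex_straight) auto
      qed
    qed
    then show "ex (round_prog cn) t (110 * W) (?I (Suc i))"
      by (rule ex_conseq) (simp_all add: W_def)
  qed auto
  then show ?thesis
  proof (rule ex_conseq)
    show "2 + n * (110 * W + 2) \<le> 2 + n * (112 * W)" by (simp add: W_def)
    fix t assume I: "?I n t"
    have "?fin t"
    proof (cases "n \<le> done_count t")
      case True
      have "{u. u < n \<and> arr t ''st'' u \<ge> 2} = {..<n}"
        using True by (intro card_seteq) (auto simp: done_count_def)
      then have "arr t ''st'' u \<ge> 2" if "u < n" for u using that by auto
      then show ?thesis by fastforce
    qed (use I in auto)
    then show "growing cn v t \<and> members s \<subseteq> members t \<and> members t \<subseteq> members s \<union> allowed s \<and> ?fin t"
      using I by simp
  qed
qed

text \<open>Otherwise \<open>P\<close> has a vertex outside the set but linked to it. Its mark is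
  not 0, as it is linked; not 1, by assumption; and not 3, since the union is chordal.\<close>

lemma growing_absorbs:
  assumes g: "growing cn v t" and vX: "v \<in> members t"
    and fin: "\<And>u. u \<in> P \<Longrightarrow> u < n \<and> arr t ''st'' u \<noteq> 1"
    and P: "conn_if cn E P" "v \<in> P" and ch: "chordal (induced_edges E (P \<union> members t))"
  shows "P \<subseteq> members t"
proof (rule ccontr)
  assume "\<not> P \<subseteq> members t"
  then obtain u w where uw: "u \<in> members t" "w \<in> P" "w \<notin> members t" "linked cn E u w"
    using conn_if_boundary[OF P(1) vX P(2)] by blast
  have w: "w < n" "arr t ''st'' w \<noteq> 1" using fin uw by auto
  have "arr t ''st'' w \<le> 3" using g w unfolding growing_def Let_def by blast
  moreover have "arr t ''st'' w \<noteq> 0" using g uw w unfolding growing_def Let_def by blast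
  moreover have "arr t ''st'' w \<noteq> 2" using uw w by (simp add: members_def)
  ultimately have "arr t ''st'' w = 3" using w by linarith
  then have "\<not> chordal (induced_edges E (insert w (members t)))"
    using g w unfolding growing_def Let_def by blast
  then show False using chordal_mono[OF ch, of "insert w (members t)"] uw by blast
qed

definition solution :: "bool \<Rightarrow> nat set \<Rightarrow> bool" where
  "solution cn S \<longleftrightarrow> inclusion_maximal (feasible cn {..<n} E) S"

text \<open>Two growths of \<open>n\<close> rounds at \<open>112 * W\<close> each, plus linear
  work.\<close>

definition extend_cost :: nat where
  "extend_cost = 240 * Suc n * W"

text \<open>Both claims come from \<open>growing_absorbs\<close>: maximality after the second
  growth, with a feasible superset as \<open>P\<close>, and absorption of \<open>P\<close> after the
  first, where the chordal allowed set contains the union. The second claim is conditional since the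
  very first solution is computed before any candidate exists.\<close>

lemma extend_correct:
  assumes env: "env s" and v: "v < n" "reg s ''v'' = v"
  shows "ex (extend_prog cn) s extend_cost (\<lambda>t. solution cn (members t) \<and>
     (chordal (induced_edges E (allowed s)) \<longrightarrow>
       (\<forall>P. v \<in> P \<and> P \<subseteq> allowed s \<and> conn_if cn E P \<longrightarrow> P \<subseteq> members t)))"
    (is "ex _ _ _ ?Q")
proof -
  let ?put = "Put ''st'' (Var ''v'') (Const 1)"
  let ?g = "2 + n * (112 * W)"
  have second: "ex (grow_prog cn) t ?g ?Q"
    if t: "env t" "growing cn v t" "\<forall>u<n. arr t ''al'' u = 1"
      "chordal (induced_edges E (allowed s)) \<Longrightarrow>
       (\<forall>P. v \<in> P \<and> P \<subseteq> allowed s \<and> conn_if cn E P \<longrightarrow> P \<subseteq> members t)" for t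
  proof (rule ex_conseq[OF grow_correct[OF t(1) v(1) t(2)] order_refl])
    fix t' assume t': "growing cn v t' \<and> members t \<subseteq> members t' \<and> members t' \<subseteq> members t \<union> allowed t \<and>
      (\<forall>u<n. \<not> (arr t' ''st'' u = 1 \<and> arr t ''al'' u = 1))"
    let ?X = "members t'"
    have no1: "arr t' ''st'' u \<noteq> 1" if "u < n" for u using t' t(3) that by blast
    have g: "chordal (induced_edges E ?X)" "conn_if cn E ?X"
      "v \<in> ?X \<or> ?X = {} \<and> arr t' ''st'' v = 1 \<and> (\<forall>u<n. u \<noteq> v \<longrightarrow> arr t' ''st'' u = 0)"
      using t' unfolding growing_def Let_def by blast+
    have vX: "v \<in> ?X" using g(3) no1[OF v(1)] by blast
    have "feasible cn {..<n} E ?X"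
      using g by (auto simp: feasible_def induced_chordal_def members_def)
    moreover have "Y = ?X" if Y: "feasible cn {..<n} E Y" "?X \<subseteq> Y" for Y
    proof -
      have "Y \<union> ?X = Y" using Y by blast
      then have "Y \<subseteq> ?X"
        using growing_absorbs[of cn v t' Y] t' vX no1 Y by (auto simp: feasible_def induced_chordal_def)
      then show ?thesis using Y by blast
    qed
    ultimately have "solution cn ?X" by (auto simp: solution_def inclusion_maximal_def)
    then show "?Q t'" using t' t(4) by blast
  qed
  have allow: "ex (allow_prog ;; grow_prog cn) t ((2 + n * (1 + 2)) + ?g) ?Q"
    if t: "env t" "growing cn v t"
      "chordal (induced_edges E (allowed s)) \<Longrightarrow>
       (\<forall>P. v \<in> P \<and> P \<subseteq> allowed s \<and> conn_if cn E P \<longrightarrow> P \<subseteq> members t)" for t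
    unfolding allow_prog_def
  proof (rule ex_Seq, rule ex_For_const[where I = "\<lambda>i t. \<forall>u<i. arr t ''al'' u = 1"])
    show "reg t ''n'' = n" using t by (simp add: env_def)
  next
    let ?f = "For ''i'' ''n'' (Put ''al'' (Var ''i'') (Const 1))"
    fix t' :: state assume al: "\<forall>u<n. arr t' ''al'' u = 1" and un: "unchanged ?f t t'"
    have "env t'" by (rule env_unchanged[OF t(1) un]) (auto simp: graph_arrays_def)
    moreover have st: "arr t' ''st'' = arr t ''st''" using un by (auto simp: unchanged_def)
    moreover have "members t' = members t" by (rule members_cong[OF st])
    moreover from this have "growing cn v t'" using t(2) unfolding growing_def st by simp
    ultimately show "ex (grow_prog cn) t' ?g ?Q"
      using second[of t'] al t(3) by simp
  qed (auto intro!: ex_straight simp: less_Suc_eq)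
  have first: "ex (grow_prog cn ;; allow_prog ;; grow_prog cn) t (?g + ((2 + n * (1 + 2)) + ?g)) ?Q"
    if t: "env t" "allowed t = allowed s" "\<forall>u<n. arr t ''st'' u = (if u = v then 1 else 0)" for t
  proof (rule ex_Seq, rule ex_conseq[OF grow_correct[OF t(1) v(1)] order_refl])
    have mt: "members t = {}" using t(3) by (auto simp: members_def)
    have "chordal (induced_edges E {})"
      by (rule insertion_order_chordal[of E "{}" "\<lambda>_. 0"]) (auto simp: insertion_order_def)
    then show "growing cn v t"
      unfolding growing_def mt Let_def using t(3) v(1) by auto
    fix t' assume t': "growing cn v t' \<and> members t \<subseteq> members t' \<and> members t' \<subseteq> members t \<union> allowed t \<and>
      (\<forall>u<n. \<not> (arr t' ''st'' u = 1 \<and> arr t ''al'' u = 1))" and un: "unchanged (grow_prog cn) t t'"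
    have env': "env t'" by (rule env_unchanged[OF t(1) un]) (auto simp: graph_arrays_def)
    have "P \<subseteq> members t'" if ch: "chordal (induced_edges E (allowed s))"
      and P: "v \<in> P" "P \<subseteq> allowed s" "conn_if cn E P" for P
    proof (rule growing_absorbs[of cn v])
      show no1: "u < n \<and> arr t' ''st'' u \<noteq> 1" if "u \<in> P" for u
        using that t' P(2) t(2) unfolding allowed_def by blast
      have "v \<in> members t' \<or> arr t' ''st'' v = 1" using t' unfolding growing_def Let_def by blast
      then show "v \<in> members t'" using no1 P(1) by blast
      have "P \<union> members t' \<subseteq> allowed s" using t' P(2) mt t(2) by blast
      then show "chordal (induced_edges E (P \<union> members t'))" by (rule chordal_mono[OF ch])
    qed (use t' P in auto)
    then show "ex (allow_prog ;; grow_prog cn) t' ((2 + n * (1 + 2)) + ?g) ?Q"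
      using allow[OF env'] t' by blast
  qed
  have "ex (extend_prog cn) s ((2 + n * (1 + 2)) + (1 + (?g + ((2 + n * (1 + 2)) + ?g)))) ?Q"
    unfolding extend_prog_def clear_prog_def
  proof (rule ex_Seq, rule ex_For_const[where I = "\<lambda>i t. \<forall>u<i. arr t ''st'' u = 0"])
    show "reg s ''n'' = n" using env by (simp add: env_def)
  next
    let ?f = "For ''i'' ''n'' (Put ''st'' (Var ''i'') (Const 0))"
    fix t :: state assume st: "\<forall>u<n. arr t ''st'' u = 0" and un: "unchanged ?f s t"
    have envt: "env t" by (rule env_unchanged[OF env un]) (auto simp: graph_arrays_def)
    let ?t = "effect ?put t"
    have un': "unchanged ?put t ?t" by (simp add: unchanged_def)
    have rv: "reg t ''v'' = v" and al: "arr t ''al'' = arr s ''al''" using un v by (auto simp: unchanged_def)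
    show "ex (?put ;; grow_prog cn ;; allow_prog ;; grow_prog cn) t
       (1 + (?g + ((2 + n * (1 + 2)) + ?g))) ?Q"
    proof (rule ex_Seq, rule ex_straight)
      have "env ?t" by (rule env_unchanged[OF envt un']) (auto simp: graph_arrays_def)
      moreover have "allowed ?t = allowed s" using al by (simp add: allowed_def)
      moreover have "\<forall>u<n. arr ?t ''st'' u = (if u = v then 1 else 0)" using st rv by simp
      ultimately show "ex (grow_prog cn ;; allow_prog ;; grow_prog cn) ?t
         (?g + ((2 + n * (1 + 2)) + ?g)) ?Q" using first by blast
    qed auto
  qed (auto intro!: ex_straight simp: less_Suc_eq)
  then show ?thesis
  proof (rule ex_conseq)
    have "n * 6 \<le> 6 * W" "9 \<le> 9 * W" by (auto simp: W_def)
    then show "(2 + n * (1 + 2)) + (1 + (?g + ((2 + n * (1 + 2)) + ?g))) \<le> extend_cost"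
      unfolding extend_cost_def by (simp add: algebra_simps)
  qed
qed

end

section \<open>Neighbouring solutions\<close>

definition load_prog :: com where
  "load_prog = For ''i'' ''n''
     (If (Eq (Get ''mem'' (Var ''i'')) (Const 1))
       (Put ''st'' (Var ''i'') (Const 2)) (Put ''st'' (Var ''i'') (Const 0)))"

text \<open>Every extension runs the search again and overwrites \<open>num\<close>.\<close>

definition save_prog :: com where
  "save_prog = For ''i'' ''n'' (Put ''ord'' (Var ''i'') (Get ''num'' (Var ''i'')))"

text \<open>The index one past the neighbour list of \<open>v\<close> stands for the choice
  \<open>a = v\<close>.\<close>

definition choose_prog :: com where
  "choose_prog =
     If (Less (Var ''q'') (Get ''deg'' (Var ''v'')))
       (Assign ''a'' (Get ''nbr'' (Plus (Get ''base'' (Var ''v'')) (Var ''q''))))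
       (Assign ''a'' (Var ''v''))"

text \<open>Only negation and conjunction are available as connectives, so the disjunctions of
  \<open>candidate\<close> appear negated.\<close>

definition candidate_test :: bexp where
  "candidate_test =
     Not (And (Not (Eq (Var ''i'') (Var ''v'')))
       (Not (And (Eq (Get ''mem'' (Var ''i'')) (Const 1))
         (Not (And (Eq (Get ''adj'' (Plus (Get ''base'' (Var ''v'')) (Var ''i''))) (Const 1))
           (And (Not (Eq (Var ''i'') (Var ''a'')))
             (Not (And (Eq (Get ''adj'' (Plus (Get ''base'' (Var ''a'')) (Var ''i''))) (Const 1))
               (Less (Get ''ord'' (Var ''i'')) (Get ''ord'' (Var ''a''))))))))))) "

definition candidate_prog :: com where
  "candidate_prog = For ''i'' ''n''
     (If candidate_test (Put ''al'' (Var ''i'') (Const 1)) (Put ''al'' (Var ''i'') (Const 0)))"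

definition neighbor_prog :: "bool \<Rightarrow> com \<Rightarrow> com" where
  "neighbor_prog cn em = choose_prog ;; candidate_prog ;; extend_prog cn ;; em"

definition vertex_prog :: "bool \<Rightarrow> com \<Rightarrow> com" where
  "vertex_prog cn em =
     If (Eq (Get ''mem'' (Var ''v'')) (Const 0))
       (Assign ''dd'' (Plus (Get ''deg'' (Var ''v'')) (Const 1)) ;;
        For ''q'' ''dd'' (neighbor_prog cn em))
       Skip"

text \<open>\<open>em\<close> consumes each neighbour found.\<close>

definition neighbors_prog :: "bool \<Rightarrow> com \<Rightarrow> com" where
  "neighbors_prog cn em =
     load_prog ;; mcs_prog ;; save_prog ;; For ''v'' ''n'' (vertex_prog cn em)"

definition work_regs :: "string set" where
  "work_regs = {''w'', ''c'', ''b'', ''p'', ''k'', ''d'', ''e'', ''ok'', ''j'', ''u'', ''i'', ''y'', ''r'', ''v'', ''q'', ''a'', ''dd''}"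

definition work_arrs :: "string set" where
  "work_arrs = {''st'', ''al'', ''cnt'', ''bk'', ''sz'', ''num'', ''ord''}"

lemma neighbors_parts_changes [simp]:
  "regs_of load_prog = {''i''}" "arrs_of load_prog = {''st''}"
  "regs_of save_prog = {''i''}" "arrs_of save_prog = {''ord''}"
  "regs_of choose_prog = {''a''}" "arrs_of choose_prog = {}"
  "regs_of candidate_prog = {''i''}" "arrs_of candidate_prog = {''al''}"
  "regs_of (neighbor_prog cn em) = {''r'', ''y'', ''a''} \<union> mcs_regs \<union> regs_of em"
  "arrs_of (neighbor_prog cn em) = {''st'', ''al'', ''cnt'', ''bk'', ''sz'', ''num''} \<union> arrs_of em"
  "regs_of (vertex_prog cn em) = {''r'', ''y'', ''a'', ''q'', ''dd''} \<union> mcs_regs \<union> regs_of em"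
  "arrs_of (vertex_prog cn em) = {''st'', ''al'', ''cnt'', ''bk'', ''sz'', ''num''} \<union> arrs_of em"
  "regs_of (neighbors_prog cn em) = work_regs \<union> regs_of em"
  "arrs_of (neighbors_prog cn em) = work_arrs \<union> arrs_of em"
  by (auto simp: load_prog_def save_prog_def choose_prog_def candidate_prog_def neighbor_prog_def
      vertex_prog_def neighbors_prog_def work_regs_def work_arrs_def)

context graph begin

text \<open>\<open>mem\<close> keeps the solution being expanded, while \<open>st\<close> is
  overwritten by each extension.\<close>

definition stored :: "state \<Rightarrow> nat set" where
  "stored s = {u. u < n \<and> arr s ''mem'' u = 1}"

lemma load_correct:
  assumes env: "env s"
  shows "ex load_prog s (2 + n * 4) (\<lambda>t. members t = stored s)"
proof -
  have "ex load_prog s (2 + n * (2 + 2)) (\<lambda>t. \<forall>u<n. arr t ''st'' u = 2 \<longleftrightarrow> arr s ''mem'' u = 1)"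
    unfolding load_prog_def
  proof (rule ex_For_const[where I = "\<lambda>i t. \<forall>u<i. arr t ''st'' u = 2 \<longleftrightarrow> arr s ''mem'' u = 1"])
    show "reg s ''n'' = n" using env by (simp add: env_def)
  next
    let ?b = "If (Eq (Get ''mem'' (Var ''i'')) (Const 1))
       (Put ''st'' (Var ''i'') (Const 2)) (Put ''st'' (Var ''i'') (Const 0))"
    fix i t assume I: "\<forall>u<i. arr t ''st'' u = 2 \<longleftrightarrow> arr s ''mem'' u = 1" and ri: "reg t ''i'' = i"
      and un: "unchanged (For ''i'' ''n'' ?b) s t"
    have "arr t ''mem'' = arr s ''mem''" using un by (auto simp: unchanged_def)
    then show "ex ?b t 2 (\<lambda>t. \<forall>u<Suc i. arr t ''st'' u = 2 \<longleftrightarrow> arr s ''mem'' u = 1)"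
      by (intro ex_straight) (use I ri in \<open>auto simp: less_Suc_eq\<close>)
  qed auto
  then show ?thesis by (rule ex_conseq) (auto simp: members_def stored_def)
qed

lemma save_correct:
  assumes env: "env s"
  shows "ex save_prog s (2 + n * 3) (\<lambda>t. \<forall>u<n. arr t ''ord'' u = arr s ''num'' u)"
proof -
  have "ex save_prog s (2 + n * (1 + 2)) (\<lambda>t. \<forall>u<n. arr t ''ord'' u = arr s ''num'' u)"
    unfolding save_prog_def
  proof (rule ex_For_const[where I = "\<lambda>i t. \<forall>u<i. arr t ''ord'' u = arr s ''num'' u"])
    show "reg s ''n'' = n" using env by (simp add: env_def)
  next
    let ?b = "Put ''ord'' (Var ''i'') (Get ''num'' (Var ''i''))"
    fix i t assume I: "\<forall>u<i. arr t ''ord'' u = arr s ''num'' u" and ri: "reg t ''i'' = i"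
      and un: "unchanged (For ''i'' ''n'' ?b) s t"
    have "arr t ''num'' = arr s ''num''" using un by (auto simp: unchanged_def)
    then show "ex ?b t 1 (\<lambda>t. \<forall>u<Suc i. arr t ''ord'' u = arr s ''num'' u)"
      by (intro ex_straight) (use I ri in \<open>auto simp: less_Suc_eq\<close>)
  qed auto
  then show ?thesis by (rule ex_conseq) auto
qed

lemma candidate_correct:
  assumes env: "env s" and v: "reg s ''v'' = v" "v < n" and a: "reg s ''a'' = a" "a < n"
  shows "ex candidate_prog s (2 + n * 4) (\<lambda>t. allowed t = candidate E (stored s) (arr s ''ord'') v a)"
proof -
  let ?C = "candidate E (stored s) (arr s ''ord'') v a"
  let ?b = "If candidate_test (Put ''al'' (Var ''i'') (Const 1)) (Put ''al'' (Var ''i'') (Const 0))"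
  have "ex candidate_prog s (2 + n * (2 + 2)) (\<lambda>t. \<forall>u<n. arr t ''al'' u = 1 \<longleftrightarrow> u \<in> ?C)"
    unfolding candidate_prog_def
  proof (rule ex_For_const[where I = "\<lambda>i t. \<forall>u<i. arr t ''al'' u = 1 \<longleftrightarrow> u \<in> ?C"])
    show "reg s ''n'' = n" using env by (simp add: env_def)
  next
    fix i t assume i: "i < n" and I: "\<forall>u<i. arr t ''al'' u = 1 \<longleftrightarrow> u \<in> ?C" and ri: "reg t ''i'' = i"
      and un: "unchanged (For ''i'' ''n'' ?b) s t"
    have envt: "env t" by (rule env_unchanged[OF env un]) (auto simp: graph_arrays_def)
    have eq: "arr t ''mem'' = arr s ''mem''" "arr t ''ord'' = arr s ''ord''"
      "reg t ''v'' = v" "reg t ''a'' = a" using un v a by (auto simp: unchanged_def)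
    have m: "arr t ''adj'' (arr t ''base'' v + i) = 1 \<longleftrightarrow> adj E v i"
      "arr t ''adj'' (arr t ''base'' a + i) = 1 \<longleftrightarrow> adj E a i"
      using envt i v a by (auto simp: env_def)
    have "bval candidate_test t \<longleftrightarrow> i \<in> ?C"
      unfolding candidate_test_def candidate_def stored_def using i m ri by (auto simp: eq)
    then show "ex ?b t 2 (\<lambda>t. \<forall>u<Suc i. arr t ''al'' u = 1 \<longleftrightarrow> u \<in> ?C)"
      by (intro ex_straight) (use I ri in \<open>auto simp: less_Suc_eq\<close>)
  qed auto
  then show ?thesis
    by (rule ex_conseq) (use v in \<open>auto simp: allowed_def candidate_def stored_def\<close>)
qed

text \<open>What the proximity argument demands for the pair \<open>v\<close>, \<open>a\<close>. It
  is monotone in \<open>N\<close>, so the results for successive pairs can be accumulated.\<close>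

definition covers :: "bool \<Rightarrow> nat set \<Rightarrow> (nat \<Rightarrow> nat) \<Rightarrow> nat set set \<Rightarrow> nat \<Rightarrow> nat \<Rightarrow> bool" where
  "covers cn S num N v a \<longleftrightarrow> (\<exists>R\<in>N. \<forall>P. v \<in> P \<and> P \<subseteq> candidate E S num v a \<and> conn_if cn E P \<longrightarrow> P \<subseteq> R)"

lemma covers_mono: "covers cn S num N v a \<Longrightarrow> N \<subseteq> N' \<Longrightarrow> covers cn S num N' v a"
  by (auto simp: covers_def)

text \<open>The existential quantifier hides the order of \<open>S\<close> found by the search. All
  neighbours \<open>a\<close> of \<open>v\<close> are covered, as the loop runs over the whole
  list.\<close>

definition neighborhood :: "bool \<Rightarrow> nat set \<Rightarrow> nat set set \<Rightarrow> bool" where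
  "neighborhood cn S N \<longleftrightarrow> N \<subseteq> Collect (solution cn) \<and>
     (\<exists>num. inj_on num S \<and> (\<forall>v<n. v \<notin> S \<longrightarrow> (\<forall>a. a = v \<or> adj E v a \<longrightarrow> covers cn S num N v a)))"

end

text \<open>The same expansion is needed with neighbours written out and with neighbours put into
  the queue. \<open>J\<close> relates the state and the events so far to the neighbours consumed; it
  may look only at \<open>JR\<close> and \<open>JA\<close>, which the expansion itself leaves
  alone.\<close>

locale emitter = graph +
  fixes cn :: bool and em :: com and ke :: nat
    and J :: "state \<Rightarrow> event list \<Rightarrow> nat set list \<Rightarrow> bool"
    and JR JA :: "string set"
  assumes em_regs: "regs_of em \<inter> {''n'', ''n1'', ''v'', ''q'', ''dd''} = {}"
    and em_arrs: "arrs_of em \<inter> (graph_arrays \<union> {''mem'', ''ord''}) = {}"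
    and J_cong: "\<And>s t es Rs. J s es Rs \<Longrightarrow> (\<And>x. x \<in> JR \<Longrightarrow> reg t x = reg s x) \<Longrightarrow>
       (\<And>a. a \<in> JA \<Longrightarrow> arr t a = arr s a) \<Longrightarrow> J t es Rs"
    and J_regs: "JR \<inter> work_regs = {}" and J_arrs: "JA \<inter> work_arrs = {}"
    and em_correct: "\<And>s es Rs. env s \<Longrightarrow> J s es Rs \<Longrightarrow> solution cn (members s) \<Longrightarrow>
       wp em s ke (\<lambda>t fs. J t (es @ fs) (Rs @ [members s]))"
begin

lemma em_simps [simp]:
  "''n'' \<notin> regs_of em" "''n1'' \<notin> regs_of em" "''v'' \<notin> regs_of em" "''q'' \<notin> regs_of em"
  "''dd'' \<notin> regs_of em" "''mem'' \<notin> arrs_of em" "''ord'' \<notin> arrs_of em" "''base'' \<notin> arrs_of em" "''adj'' \<notin> arrs_of em" "''deg'' \<notin> arrs_of em"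
  "''nbr'' \<notin> arrs_of em" "''pow'' \<notin> arrs_of em"
  using em_regs em_arrs by (auto simp: graph_arrays_def)

lemma J_unchanged:
  assumes "J s es Rs" "unchanged c s t" "regs_of c \<subseteq> work_regs" "arrs_of c \<subseteq> work_arrs"
  shows "J t es Rs"
  by (rule J_cong[OF assms(1)]) (use assms J_regs J_arrs in \<open>auto simp: unchanged_def\<close>)

definition neighbor_cost :: nat where
  "neighbor_cost = extend_cost + ke + 4 * n + 4"

lemma neighbor_correct:
  assumes env: "env s" and J: "J s es Rs" and S: "S = stored s" "insertion_order E S (arr s ''ord'')"
    and out: "\<And>x. x < n \<Longrightarrow> x \<notin> S \<Longrightarrow> arr s ''ord'' x = 0"
    and v: "v < n" "v \<notin> S" "reg s ''v'' = v"
    and q: "reg s ''q'' = q" "q < Suc (length (nb v))"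
  shows "wp (neighbor_prog cn em) s neighbor_cost (\<lambda>t fs. \<exists>R. J t (es @ fs) (Rs @ [R]) \<and> solution cn R \<and>
     covers cn S (arr s ''ord'') {R} v ((nb v @ [v]) ! q))"
    (is "wp _ _ _ ?Q")
proof -
  define a where "a = (nb v @ [v]) ! q"
  have "a \<in> set (nb v @ [v])" unfolding a_def using q by (intro nth_mem) simp
  then have an: "a < n" using set_nb[OF v(1)] adj_bound v(1) by auto
  define s1 where "s1 = effect choose_prog s"
  have un1: "unchanged choose_prog s s1"
    by (simp add: s1_def choose_prog_def unchanged_def)
  have s1: "reg s1 ''a'' = a" "arr s1 = arr s" "reg s1 ''v'' = v"
    using v q env by (auto simp: s1_def choose_prog_def a_def nth_append env_def less_Suc_eq)
  have env1: "env s1" by (rule env_unchanged[OF env un1]) auto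
  have J1: "J s1 es Rs" by (rule J_unchanged[OF J un1]) (auto simp: work_regs_def)
  have st1: "stored s1 = S" by (simp add: stored_def s1 S(1))
  let ?C = "candidate E S (arr s ''ord'') v a"
  \<comment> \<open>This includes a neighbour \<open>a\<close> outside \<open>S\<close>: its number
    is 0, as \<open>candidate_chordal\<close> asks.\<close>
  have "chordal (induced_edges E ?C)"
    by (rule candidate_chordal[OF S(2) _ v(2)]) (use S(1) out[OF an] in \<open>auto simp: stored_def\<close>)
  note chC = this
  have "wp (choose_prog ;; candidate_prog ;; extend_prog cn ;; em) s
     (2 + ((2 + n * 4) + (extend_cost + ke))) ?Q"
  proof (rule wp_Seq_silent, rule ex_straight)
    have "wp (candidate_prog ;; extend_prog cn ;; em) s1 ((2 + n * 4) + (extend_cost + ke)) ?Q"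
    proof (rule wp_Seq_silent, rule ex_conseq[OF candidate_correct[OF env1 s1(3) v(1) s1(1) an] order_refl])
      fix s2 assume al: "allowed s2 = candidate E (stored s1) (arr s1 ''ord'') v a"
        and un2: "unchanged candidate_prog s1 s2"
      have env2: "env s2" by (rule env_unchanged[OF env1 un2]) (auto simp: graph_arrays_def)
      have J2: "J s2 es Rs" by (rule J_unchanged[OF J1 un2]) (auto simp: work_regs_def work_arrs_def)
      have v2: "reg s2 ''v'' = v" using un2 s1 by (auto simp: unchanged_def)
      have al2: "allowed s2 = ?C" using al st1 s1 by simp
      show "wp (extend_prog cn ;; em) s2 (extend_cost + ke) ?Q"
      proof (rule wp_Seq_silent, rule ex_conseq[OF extend_correct[OF env2 v(1) v2] order_refl])
        fix s3 assume e: "solution cn (members s3) \<and> (chordal (induced_edges E (allowed s2)) \<longrightarrow>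
            (\<forall>P. v \<in> P \<and> P \<subseteq> allowed s2 \<and> conn_if cn E P \<longrightarrow> P \<subseteq> members s3))"
          and un3: "unchanged (extend_prog cn) s2 s3"
        have env3: "env s3" by (rule env_unchanged[OF env2 un3]) (auto simp: graph_arrays_def)
        have J3: "J s3 es Rs" by (rule J_unchanged[OF J2 un3]) (auto simp: work_regs_def work_arrs_def)
        have cov: "covers cn S (arr s ''ord'') {members s3} v a"
          using e chC unfolding covers_def al2 by blast
        show "wp em s3 ke ?Q"
          by (rule wp_conseq[OF em_correct[OF env3 J3]]) (use e cov in \<open>auto simp: a_def\<close>)
      qed
    qed
    then show "wp (candidate_prog ;; extend_prog cn ;; em) (effect choose_prog s)
        ((2 + n * 4) + (extend_cost + ke)) ?Q"
      by (simp add: s1_def)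
  qed (auto simp: choose_prog_def)
  then show ?thesis unfolding neighbor_prog_def by (rule wp_conseq) (auto simp: neighbor_cost_def)
qed

lemma vertex_correct:
  assumes env: "env s" and J: "J s es Rs" and S: "S = stored s" "insertion_order E S (arr s ''ord'')"
    and mem: "\<And>u. u < n \<Longrightarrow> arr s ''mem'' u \<le> 1"
    and out: "\<And>x. x < n \<Longrightarrow> x \<notin> S \<Longrightarrow> arr s ''ord'' x = 0"
    and v: "v < n" "reg s ''v'' = v"
  shows "wp (vertex_prog cn em) s (4 + Suc (length (nb v)) * (neighbor_cost + 2)) (\<lambda>t fs.
     \<exists>Ns. J t (es @ fs) (Rs @ Ns) \<and> (\<forall>R\<in>set Ns. solution cn R) \<and>
       (v \<notin> S \<longrightarrow> (\<forall>a. a = v \<or> adj E v a \<longrightarrow> covers cn S (arr s ''ord'') (set Ns) v a)))"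
    (is "wp _ _ _ ?Q")
proof -
  define D where "D = Suc (length (nb v))"
  let ?as = "nb v @ [v]"
  let ?num = "arr s ''ord''"
  have setas: "set ?as = {a. a = v \<or> adj E v a}" using set_nb[OF v(1)] by auto
  let ?dd = "Assign ''dd'' (Plus (Get ''deg'' (Var ''v'')) (Const 1))"
  let ?for = "For ''q'' ''dd'' (neighbor_prog cn em)"
  let ?I = "\<lambda>i t es'. \<exists>Ns. J t es' (Rs @ Ns) \<and> (\<forall>R\<in>set Ns. solution cn R) \<and>
     (\<forall>a\<in>set (take i ?as). covers cn S ?num (set Ns) v a)"
  have "wp (vertex_prog cn em) s (Suc (1 + (2 + (\<Sum>i<D. neighbor_cost + 2)))) ?Q"
    unfolding vertex_prog_def
  proof (rule wp_If)
    assume "bval (Eq (Get ''mem'' (Var ''v'')) (Const 0)) s"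
    then have vS: "v \<notin> S" using v by (simp add: S(1) stored_def)
    let ?s = "effect ?dd s"
    show "wp (?dd ;; ?for) s (1 + (2 + (\<Sum>i<D. neighbor_cost + 2))) ?Q"
    proof (rule wp_Seq_silent, rule ex_straight)
      have un: "unchanged ?dd s ?s" by (simp add: unchanged_def)
      have env1: "env ?s" by (rule env_unchanged[OF env un]) auto
      have J1: "J ?s es Rs" by (rule J_unchanged[OF J un]) (auto simp: work_regs_def)
      have "wp ?for ?s (2 + (\<Sum>i<D. neighbor_cost + 2)) (\<lambda>t fs. ?I D t (es @ fs))"
      proof (rule wp_For[where I = ?I and Q = "?I D"])
        show "reg ?s ''dd'' = D" using env v by (simp add: env_def D_def)
        show "?I 0 ?s es" using J1 by (intro exI[of _ "[]"]) simp
      next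
        fix i t es' x assume "?I i t es'"
        then obtain Ns where Ns: "J t es' (Rs @ Ns)" "\<forall>R\<in>set Ns. solution cn R"
          "\<forall>a\<in>set (take i ?as). covers cn S ?num (set Ns) v a" by blast
        have "J (t\<lparr>reg := (reg t)(''q'' := x)\<rparr>) es' (Rs @ Ns)"
          by (rule J_cong[OF Ns(1)]) (use J_regs in \<open>auto simp: work_regs_def\<close>)
        then show "?I i (t\<lparr>reg := (reg t)(''q'' := x)\<rparr>) es'" using Ns by blast
      next
        fix i t es' assume i: "i < D" and I: "?I i t es'" and rq: "reg t ''q'' = i"
          and un': "unchanged ?for ?s t"
        obtain Ns where Ns: "J t es' (Rs @ Ns)" "\<forall>R\<in>set Ns. solution cn R"
          "\<forall>a\<in>set (take i ?as). covers cn S ?num (set Ns) v a" using I by blast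
        have envt: "env t" by (rule env_unchanged[OF env1 un']) (auto simp: graph_arrays_def)
        have eq: "arr t ''mem'' = arr s ''mem''" "arr t ''ord'' = ?num" "reg t ''v'' = v"
          using un' v by (auto simp: unchanged_def)
        have St: "S = stored t" by (simp add: S(1) stored_def eq)
        have tk: "set (take (Suc i) ?as) = insert (?as ! i) (set (take i ?as))"
          using i by (simp add: take_Suc_conv_app_nth D_def del: take_append)
        have "wp (neighbor_prog cn em) t neighbor_cost (\<lambda>t' fs. \<exists>R. J t' (es' @ fs) ((Rs @ Ns) @ [R]) \<and>
            solution cn R \<and> covers cn S (arr t ''ord'') {R} v (?as ! i))"
          by (rule neighbor_correct[OF envt Ns(1) St _ _ v(1) vS eq(3) rq])
            (use S(2) out i eq in \<open>simp_all add: D_def\<close>)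
        then show "wp (neighbor_prog cn em) t neighbor_cost (\<lambda>t' fs. ?I (Suc i) t' (es' @ fs))"
        proof (rule wp_conseq)
          fix t' fs assume "\<exists>R. J t' (es' @ fs) ((Rs @ Ns) @ [R]) \<and>
            solution cn R \<and> covers cn S (arr t ''ord'') {R} v (?as ! i)"
          then obtain R where R: "J t' (es' @ fs) (Rs @ (Ns @ [R]))" "solution cn R"
            "covers cn S ?num {R} v (?as ! i)" using eq by auto
          have "covers cn S ?num (set (Ns @ [R])) v a" if "a \<in> set (take (Suc i) ?as)" for a
            using that Ns(3) R(3) covers_mono[of cn S ?num _ v a "set (Ns @ [R])"] unfolding tk by auto
          then show "?I (Suc i) t' (es' @ fs)" using R Ns(2) by (intro exI[of _ "Ns @ [R]"]) auto
        qed simp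
      qed auto
      then show "wp ?for ?s (2 + (\<Sum>i<D. neighbor_cost + 2)) ?Q"
      proof (rule wp_conseq)
        have tk: "take D ?as = ?as" by (simp add: D_def)
        fix t fs assume "?I D t (es @ fs)"
        then obtain Ns where "J t (es @ fs) (Rs @ Ns)" "\<forall>R\<in>set Ns. solution cn R"
          "\<forall>a\<in>set ?as. covers cn S ?num (set Ns) v a" unfolding tk by blast
        then show "?Q t fs" unfolding setas by blast
      qed simp
    qed auto
  next
    assume "\<not> bval (Eq (Get ''mem'' (Var ''v'')) (Const 0)) s"
    \<comment> \<open>Entries of \<open>mem\<close> are 0 or 1, so failing the test for 0 means
      membership.\<close>
    then have "v \<in> S" using v mem[of v] by (simp add: S(1) stored_def)
    then show "wp Skip s (1 + (2 + (\<Sum>i<D. neighbor_cost + 2))) ?Q"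
      using J by (intro wp_straight) (auto intro!: exI[of _ "[]"])
  qed
  then show ?thesis by (rule wp_conseq) (auto simp: D_def)
qed

text \<open>The number of pairs, summed over all vertices, is at most \<open>n + 2 * m\<close> and
  thus below \<open>W\<close>; the 120 per unit absorbs the search on \<open>S\<close> and the loop
  overhead.\<close>

definition neighbors_cost :: nat where
  "neighbors_cost = W * (neighbor_cost + 120)"

lemma neighbors_correct:
  assumes env: "env s" and J: "J s es Rs" and mem: "\<And>u. u < n \<Longrightarrow> arr s ''mem'' u \<le> 1"
    and S: "S = stored s" "solution cn S"
  shows "wp (neighbors_prog cn em) s neighbors_cost (\<lambda>t fs.
     \<exists>Ns. J t (es @ fs) (Rs @ Ns) \<and> neighborhood cn S (set Ns))"
    (is "wp _ _ _ ?Q")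
proof -
  have ch: "chordal (induced_edges E S)"
    using S(2) by (auto simp: solution_def inclusion_maximal_def feasible_def induced_chordal_def)
  let ?for = "For ''v'' ''n'' (vertex_prog cn em)"
  let ?k = "\<lambda>v. 4 + Suc (length (nb v)) * (neighbor_cost + 2)"
  let ?K = "2 + (\<Sum>v<n. ?k v + 2)"
  have loop: "wp ?for t ?K ?Q"
    if t: "env t" "J t es Rs" "S = stored t" "insertion_order E S (arr t ''ord'')"
      "\<And>u. u < n \<Longrightarrow> arr t ''mem'' u \<le> 1" "\<And>x. x < n \<Longrightarrow> x \<notin> S \<Longrightarrow> arr t ''ord'' x = 0" for t
  proof -
    let ?num = "arr t ''ord''"
    let ?I = "\<lambda>i t es'. \<exists>Ns. J t es' (Rs @ Ns) \<and> (\<forall>R\<in>set Ns. solution cn R) \<and>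
      (\<forall>v<i. v \<notin> S \<longrightarrow> (\<forall>a. a = v \<or> adj E v a \<longrightarrow> covers cn S ?num (set Ns) v a))"
    have "wp ?for t ?K (\<lambda>t fs. ?I n t (es @ fs))"
    proof (rule wp_For[where I = ?I and Q = "?I n"])
      show "reg t ''n'' = n" using t(1) by (simp add: env_def)
      show "?I 0 t es" using t(2) by (intro exI[of _ "[]"]) simp
    next
      fix i t es' x assume "?I i t es'"
      then obtain Ns where Ns: "J t es' (Rs @ Ns)" "\<forall>R\<in>set Ns. solution cn R"
        "\<forall>v<i. v \<notin> S \<longrightarrow> (\<forall>a. a = v \<or> adj E v a \<longrightarrow> covers cn S ?num (set Ns) v a)" by blast
      have "J (t\<lparr>reg := (reg t)(''v'' := x)\<rparr>) es' (Rs @ Ns)"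
        by (rule J_cong[OF Ns(1)]) (use J_regs in \<open>auto simp: work_regs_def\<close>)
      then show "?I i (t\<lparr>reg := (reg t)(''v'' := x)\<rparr>) es'" using Ns by blast
    next
      fix i u es' assume i: "i < n" and I: "?I i u es'" and rv: "reg u ''v'' = i"
        and un: "unchanged ?for t u"
      obtain Ns where Ns: "J u es' (Rs @ Ns)" "\<forall>R\<in>set Ns. solution cn R"
        "\<forall>v<i. v \<notin> S \<longrightarrow> (\<forall>a. a = v \<or> adj E v a \<longrightarrow> covers cn S ?num (set Ns) v a)" using I by blast
      have envu: "env u" by (rule env_unchanged[OF t(1) un]) (auto simp: graph_arrays_def)
      have eq: "arr u ''mem'' = arr t ''mem''" "arr u ''ord'' = ?num"
        using un by (auto simp: unchanged_def)
      have Su: "S = stored u" by (simp add: t(3) stored_def eq)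
      have "wp (vertex_prog cn em) u (?k i) (\<lambda>t' fs.
        \<exists>Ms. J t' (es' @ fs) ((Rs @ Ns) @ Ms) \<and> (\<forall>R\<in>set Ms. solution cn R) \<and>
        (i \<notin> S \<longrightarrow> (\<forall>a. a = i \<or> adj E i a \<longrightarrow> covers cn S (arr u ''ord'') (set Ms) i a)))"
        by (rule vertex_correct[OF envu Ns(1) Su _ _ _ i rv]) (use t eq in simp_all)
      then show "wp (vertex_prog cn em) u (?k i) (\<lambda>t' fs. ?I (Suc i) t' (es' @ fs))"
      proof (rule wp_conseq)
        fix t' fs assume "\<exists>Ms. J t' (es' @ fs) ((Rs @ Ns) @ Ms) \<and> (\<forall>R\<in>set Ms. solution cn R) \<and>
          (i \<notin> S \<longrightarrow> (\<forall>a. a = i \<or> adj E i a \<longrightarrow> covers cn S (arr u ''ord'') (set Ms) i a))"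
        then obtain Ms where Ms: "J t' (es' @ fs) (Rs @ (Ns @ Ms))" "\<forall>R\<in>set Ms. solution cn R"
          "i \<notin> S \<longrightarrow> (\<forall>a. a = i \<or> adj E i a \<longrightarrow> covers cn S ?num (set Ms) i a)" using eq by auto
        have "covers cn S ?num (set (Ns @ Ms)) v a"
          if "v < Suc i" "v \<notin> S" "a = v \<or> adj E v a" for v a
        proof (cases "v = i")
          case True
          then have "covers cn S ?num (set Ms) v a" using Ms(3) that by blast
          then show ?thesis by (rule covers_mono) simp
        next
          case False
          then have "v < i" using that(1) by simp
          then have "covers cn S ?num (set Ns) v a" using Ns(3) that by blast
          then show ?thesis by (rule covers_mono) simp
        qed
        then show "?I (Suc i) t' (es' @ fs)"
          using Ms Ns(2) by (intro exI[of _ "Ns @ Ms"]) auto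
      qed simp
    qed auto
    then show ?thesis
    proof (rule wp_conseq)
      fix u fs assume "?I n u (es @ fs)"
      then obtain Ns where "J u (es @ fs) (Rs @ Ns)" "\<forall>R\<in>set Ns. solution cn R"
        "\<forall>v<n. v \<notin> S \<longrightarrow> (\<forall>a. a = v \<or> adj E v a \<longrightarrow> covers cn S ?num (set Ns) v a)" by blast
      moreover have "inj_on ?num S" using t(4) by (simp add: insertion_order_def)
      ultimately show "?Q u fs" unfolding neighborhood_def by blast
    qed simp
  qed
  have "wp (neighbors_prog cn em) s ((2 + n * 4) + (100 * W + ((2 + n * 3) + ?K))) ?Q"
    unfolding neighbors_prog_def
  proof (rule wp_Seq_silent, rule ex_conseq[OF load_correct[OF env] order_refl])
    fix s1 assume m1: "members s1 = stored s" and un1: "unchanged load_prog s s1"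
    have env1: "env s1" by (rule env_unchanged[OF env un1]) (auto simp: graph_arrays_def)
    have J1: "J s1 es Rs" by (rule J_unchanged[OF J un1]) (auto simp: work_regs_def work_arrs_def)
    have mem1: "arr s1 ''mem'' = arr s ''mem''" using un1 by (auto simp: unchanged_def)
    have S1: "S = members s1" using m1 S(1) by simp
    show "wp (mcs_prog ;; save_prog ;; ?for) s1 (100 * W + ((2 + n * 3) + ?K)) ?Q"
    proof (rule wp_Seq_silent, rule ex_conseq[OF mcs_correct[OF env1 S1] order_refl])
      fix s2 assume m: "(reg s2 ''ok'' = 1 \<longleftrightarrow> chordal (induced_edges E S)) \<and>
         (chordal (induced_edges E S) \<longrightarrow> insertion_order E S (arr s2 ''num'')) \<and>
         (\<forall>x<n. x \<notin> S \<longrightarrow> arr s2 ''num'' x = 0)" and un2: "unchanged mcs_prog s1 s2"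
      have env2: "env s2" by (rule env_unchanged[OF env1 un2]) (auto simp: graph_arrays_def)
      have J2: "J s2 es Rs" by (rule J_unchanged[OF J1 un2]) (auto simp: work_regs_def work_arrs_def)
      have mem2: "arr s2 ''mem'' = arr s ''mem''" using un2 mem1 by (auto simp: unchanged_def)
      show "wp (save_prog ;; ?for) s2 ((2 + n * 3) + ?K) ?Q"
      proof (rule wp_Seq_silent, rule ex_conseq[OF save_correct[OF env2] order_refl])
        fix s3 assume o3: "\<forall>u<n. arr s3 ''ord'' u = arr s2 ''num'' u" and un3: "unchanged save_prog s2 s3"
        have env3: "env s3" by (rule env_unchanged[OF env2 un3]) (auto simp: graph_arrays_def)
        have J3: "J s3 es Rs" by (rule J_unchanged[OF J2 un3]) (auto simp: work_regs_def work_arrs_def)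
        have mem3: "arr s3 ''mem'' = arr s ''mem''" using un3 mem2 by (auto simp: unchanged_def)
        have S3: "S = stored s3" by (simp add: S(1) stored_def mem3)
        have Sn: "S \<subseteq> {..<n}" by (auto simp: S(1) stored_def)
        have eq: "arr s3 ''ord'' x = arr s2 ''num'' x" if "x \<in> S" for x using o3 Sn that by auto
        have "insertion_order E S (arr s2 ''num'')" using m ch by blast
        moreover have "prior E S (arr s3 ''ord'') u (arr s3 ''ord'' u) =
            prior E S (arr s2 ''num'') u (arr s2 ''num'' u)" if "u \<in> S" for u
          using that by (auto simp: prior_def eq)
        moreover have "inj_on (arr s3 ''ord'') S \<longleftrightarrow> inj_on (arr s2 ''num'') S"
          by (rule inj_on_cong) (use eq in auto)
        ultimately have io: "insertion_order E S (arr s3 ''ord'')"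
          by (simp add: insertion_order_def)
        show "wp ?for s3 ?K ?Q"
          by (rule loop[OF env3 J3 S3 io]) (use mem mem3 o3 m in auto)
      qed
    qed
  qed
  then show ?thesis
  proof (rule wp_conseq)
    have "(\<Sum>v<n. ?k v + 2) = (\<Sum>v<n. 6 + (neighbor_cost + 2)) + (\<Sum>v<n. length (nb v)) * (neighbor_cost + 2)"
      by (simp add: sum.distrib sum_distrib_left sum_distrib_right algebra_simps)
    also have "\<dots> = n * (neighbor_cost + 8) + 2 * m * (neighbor_cost + 2)"
      by (simp add: handshake)
    also have "\<dots> \<le> n * (neighbor_cost + 8) + 2 * m * (neighbor_cost + 8)"
      by (intro add_mono mult_le_mono) auto
    finally show "(2 + n * 4) + (100 * W + ((2 + n * 3) + ?K)) \<le> neighbors_cost"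
      by (simp add: neighbors_cost_def W_def algebra_simps)
  qed
qed

end

section \<open>Reading the graph\<close>

text \<open>Neighbours in the order in which \<open>edge_prog\<close> stores them, so that the array
  rows equal these lists literally.\<close>

definition neighbor_list :: "(nat \<times> nat) list \<Rightarrow> nat \<Rightarrow> nat list" where
  "neighbor_list es u =
     concat (map (\<lambda>(a, b). (if a = u then [b] else []) @ (if b = u then [a] else [])) es)"

lemma neighbor_list_append: "neighbor_list (es @ fs) u = neighbor_list es u @ neighbor_list fs u"
  by (simp add: neighbor_list_def)

lemma neighbor_list_single:
  "a \<noteq> b \<Longrightarrow> neighbor_list [(a, b)] u = (if u = a then [b] else if u = b then [a] else [])"
  by (auto simp: neighbor_list_def)

lemma set_neighbor_list: "v \<in> set (neighbor_list es u) \<longleftrightarrow> (\<exists>(a, b)\<in>set es. {a, b} = {u, v})"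
  by (fastforce simp: neighbor_list_def doubleton_eq_iff split: if_splits)

text \<open>A repetition would stem from two entries with the same pair of ends. Distinctness is
  assumed of unordered pairs, which also excludes a reversed copy of an edge.\<close>

lemma distinct_neighbor_list:
  assumes "distinct (map (\<lambda>(a, b). {a, b}) es)" "\<forall>(a, b)\<in>set es. a \<noteq> b"
  shows "distinct (neighbor_list es u)"
  using assms
proof (induction es)
  case (Cons e es)
  obtain a b where e: "e = (a, b)" by force
  have ab: "a \<noteq> b" and new: "{a, b} \<notin> (\<lambda>(a, b). {a, b}) ` set es"
    using Cons.prems unfolding e by simp_all
  have not: "v \<notin> set (neighbor_list es u)" if "{u, v} = {a, b}" for v
  proof
    assume "v \<in> set (neighbor_list es u)"
    then obtain c d where cd: "(c, d) \<in> set es" "{c, d} = {u, v}" unfolding set_neighbor_list by blast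
    have "(\<lambda>(a, b). {a, b}) (c, d) \<in> (\<lambda>(a, b). {a, b}) ` set es" using cd(1) by (rule imageI)
    then show False using new cd(2) that by simp
  qed
  have "neighbor_list (e # es) u = neighbor_list [(a, b)] u @ neighbor_list es u"
    using neighbor_list_append[of "[e]" es] e by simp
  moreover have "distinct (neighbor_list es u)" using Cons by simp
  ultimately show ?case
    using not[of a] not[of b] ab by (auto simp: neighbor_list_single insert_commute)
qed (simp add: neighbor_list_def)

lemma sum_neighbor_list:
  assumes "\<forall>(a, b)\<in>set es. a < n \<and> b < n \<and> a \<noteq> b"
  shows "(\<Sum>u<n. length (neighbor_list es u)) = 2 * length es"
  using assms
proof (induction es)
  case (Cons e es)
  obtain a b where e: "e = (a, b)" by force
  have ab: "a \<noteq> b" "a < n" "b < n" using Cons.prems e by auto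
  have "neighbor_list (e # es) u = neighbor_list [(a, b)] u @ neighbor_list es u" for u
    using neighbor_list_append[of "[e]" es] e by simp
  then have "(\<Sum>u<n. length (neighbor_list (e # es) u)) =
      (\<Sum>u<n. length (neighbor_list [(a, b)] u)) + (\<Sum>u<n. length (neighbor_list es u))"
    by (simp add: sum.distrib)
  also have "(\<Sum>u<n. length (neighbor_list [(a, b)] u)) = (\<Sum>u<n. (if u = a then 1 else 0) + (if u = b then 1 else 0))"
    using ab by (intro sum.cong) (auto simp: neighbor_list_single)
  also have "\<dots> = 2" using ab by (simp add: sum.distrib)
  finally show ?case using Cons by simp
qed (simp add: neighbor_list_def)

locale graph_instance =
  fixes G :: Defs.graph
  assumes simple: "simple_graph G"
begin

lemma edge_props: "(a, b) \<in> set (snd G) \<Longrightarrow> a < fst G \<and> b < fst G \<and> a \<noteq> b"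
  using simple by (auto simp: simple_graph_def verts_def)

lemma card_edges: "card (edges G) = length (snd G)"
proof -
  have "distinct (map (\<lambda>(u, v). {u, v}) (snd G))" using simple by (simp add: simple_graph_def)
  from distinct_card[OF this] show ?thesis by (simp add: edges_def)
qed

end

sublocale graph_instance \<subseteq>
  graph "fst G" "length (snd G)" "edges G" "neighbor_list (snd G)"
proof
  fix e assume "e \<in> edges G"
  then obtain a b where "(a, b) \<in> set (snd G)" "e = {a, b}" by (auto simp: edges_def)
  then show "\<exists>x y. e = {x, y} \<and> x \<noteq> y" "e \<subseteq> {..<fst G}" using edge_props by blast+
next
  fix u assume "u < fst G"
  show "distinct (neighbor_list (snd G) u)"
    using simple edge_props by (intro distinct_neighbor_list) (auto simp: simple_graph_def)
  show "set (neighbor_list (snd G) u) = {v. adj (edges G) u v}"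
  proof (intro set_eqI iffI)
    fix v assume "v \<in> set (neighbor_list (snd G) u)"
    then obtain a b where ab: "(a, b) \<in> set (snd G)" "{a, b} = {u, v}"
      unfolding set_neighbor_list by blast
    have "(\<lambda>(a, b). {a, b}) (a, b) \<in> edges G" unfolding edges_def using ab(1) by (rule imageI)
    moreover have "u \<noteq> v" using edge_props[OF ab(1)] ab(2) by (auto simp: doubleton_eq_iff)
    ultimately show "v \<in> {v. adj (edges G) u v}" using ab(2) by (simp add: adj_def)
  next
    fix v assume "v \<in> {v. adj (edges G) u v}"
    then have "{u, v} \<in> edges G" by (simp add: adj_def)
    then obtain a b where "(a, b) \<in> set (snd G)" "{a, b} = {u, v}" by (auto simp: edges_def)
    then show "v \<in> set (neighbor_list (snd G) u)" unfolding set_neighbor_list by blast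
  qed
next
  show "(\<Sum>u<fst G. length (neighbor_list (snd G) u)) = 2 * length (snd G)"
    using edge_props by (intro sum_neighbor_list) auto
qed

definition base_prog :: com where
  "base_prog = Assign ''x'' (Const 0) ;;
     For ''i'' ''n1''
       (Put ''base'' (Var ''i'') (Var ''x'') ;; Assign ''x'' (Plus (Var ''x'') (Var ''W'')))"

definition pow_prog :: com where
  "pow_prog = Assign ''z'' (Const 1) ;;
     For ''i'' ''n''
       (Put ''pow'' (Var ''i'') (Var ''z'') ;; Assign ''z'' (Plus (Var ''z'') (Var ''z'')))"

definition edge_prog :: com where
  "edge_prog =
     Assign ''u'' (Get ''input'' (Var ''l'')) ;;
     Assign ''w'' (Get ''input'' (Plus (Var ''l'') (Const 1))) ;;
     Assign ''l'' (Plus (Var ''l'') (Const 2)) ;;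
     Put ''adj'' (Plus (Get ''base'' (Var ''u'')) (Var ''w'')) (Const 1) ;;
     Put ''adj'' (Plus (Get ''base'' (Var ''w'')) (Var ''u'')) (Const 1) ;;
     Put ''nbr'' (Plus (Get ''base'' (Var ''u'')) (Get ''deg'' (Var ''u''))) (Var ''w'') ;;
     Put ''deg'' (Var ''u'') (Plus (Get ''deg'' (Var ''u'')) (Const 1)) ;;
     Put ''nbr'' (Plus (Get ''base'' (Var ''w'')) (Get ''deg'' (Var ''w''))) (Var ''u'') ;;
     Put ''deg'' (Var ''w'') (Plus (Get ''deg'' (Var ''w'')) (Const 1))"

definition edges_prog :: com where
  "edges_prog = Assign ''l'' (Const 2) ;; For ''e'' ''m'' edge_prog"

definition sizes_prog :: com where
  "sizes_prog =
     Assign ''n'' (Get ''input'' (Const 0)) ;;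
     Assign ''m'' (Get ''input'' (Const 1)) ;;
     Assign ''n1'' (Plus (Var ''n'') (Const 1)) ;;
     Assign ''W'' (Plus (Var ''n1'') (Plus (Var ''m'') (Var ''m'')))"

definition setup_prog :: com where
  "setup_prog = sizes_prog ;; base_prog ;; pow_prog ;; edges_prog"

lemma setup_parts_changes [simp]:
  "regs_of base_prog = {''x'', ''i''}" "arrs_of base_prog = {''base''}"
  "regs_of pow_prog = {''z'', ''i''}" "arrs_of pow_prog = {''pow''}"
  "regs_of edge_prog = {''u'', ''w'', ''l''}" "arrs_of edge_prog = {''adj'', ''nbr'', ''deg''}"
  "regs_of edges_prog = {''u'', ''w'', ''l'', ''e''}" "arrs_of edges_prog = {''adj'', ''nbr'', ''deg''}"
  "regs_of sizes_prog = {''n'', ''m'', ''n1'', ''W''}" "arrs_of sizes_prog = {}"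
  "regs_of setup_prog = {''n'', ''m'', ''n1'', ''W'', ''x'', ''z'', ''i'', ''u'', ''w'', ''l'', ''e''}"
  "arrs_of setup_prog = {''base'', ''pow'', ''adj'', ''nbr'', ''deg''}"
  by (auto simp: base_prog_def pow_prog_def edge_prog_def edges_prog_def sizes_prog_def setup_prog_def)

lemma concat_pairs_nth:
  "i < length es \<Longrightarrow> concat (map (\<lambda>(u, v). [u, v]) es) ! (2 * i) = fst (es ! i) \<and>
     concat (map (\<lambda>(u, v). [u, v]) es) ! Suc (2 * i) = snd (es ! i)"
proof (induction es arbitrary: i)
  case (Cons e es)
  then show ?case by (cases i) (auto split: prod.splits)
qed simp

lemma length_concat_pairs: "length (concat (map (\<lambda>(u, v). [u, v]) es)) = 2 * length es"
  by (induction es) auto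

lemma length_encode_graph: "length (encode_graph G) = 2 + 2 * length (snd G)"
  by (simp add: encode_graph_def length_concat_pairs)

lemma encode_graph_nth:
  "encode_graph G ! 0 = fst G" "encode_graph G ! 1 = length (snd G)"
  "i < length (snd G) \<Longrightarrow> encode_graph G ! (2 + 2 * i) = fst (snd G ! i)"
  "i < length (snd G) \<Longrightarrow> encode_graph G ! (3 + 2 * i) = snd (snd G ! i)"
  using concat_pairs_nth[of i "snd G"] by (simp_all add: encode_graph_def numeral_3_eq_3)

context graph_instance begin

abbreviation "nv \<equiv> fst G"
abbreviation "es \<equiv> snd G"

lemma base_correct:
  assumes "reg s ''n1'' = Suc nv" "reg s ''W'' = W"
  shows "ex base_prog s (3 + Suc nv * 4) (\<lambda>t. \<forall>i\<le>nv. arr t ''base'' i = i * W)"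
proof -
  let ?b = "Put ''base'' (Var ''i'') (Var ''x'') ;; Assign ''x'' (Plus (Var ''x'') (Var ''W''))"
  let ?I = "\<lambda>i t. reg t ''x'' = i * W \<and> (\<forall>j<i. arr t ''base'' j = j * W)"
  let ?s = "effect (Assign ''x'' (Const 0)) s"
  have "ex base_prog s (1 + (2 + Suc nv * (2 + 2))) (?I (Suc nv))"
    unfolding base_prog_def
  proof (rule ex_Seq, rule ex_straight)
    show "ex (For ''i'' ''n1'' ?b) ?s (2 + Suc nv * (2 + 2)) (?I (Suc nv))"
    proof (rule ex_For_const[where I = ?I])
      show "reg ?s ''n1'' = Suc nv" using assms by simp
    next
      fix i t assume I: "?I i t" and ri: "reg t ''i'' = i" and un: "unchanged (For ''i'' ''n1'' ?b) ?s t"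
      have "reg t ''W'' = W" using un assms by (auto simp: unchanged_def)
      then show "ex ?b t 2 (?I (Suc i))"
        by (intro ex_straight) (use I ri in \<open>auto simp: less_Suc_eq\<close>)
    qed auto
  qed auto
  then show ?thesis by (rule ex_conseq) auto
qed

lemma pow_correct:
  assumes "reg s ''n'' = nv"
  shows "ex pow_prog s (3 + nv * 4) (\<lambda>t. \<forall>i<nv. arr t ''pow'' i = 2 ^ i)"
proof -
  let ?b = "Put ''pow'' (Var ''i'') (Var ''z'') ;; Assign ''z'' (Plus (Var ''z'') (Var ''z''))"
  let ?I = "\<lambda>i t. reg t ''z'' = 2 ^ i \<and> (\<forall>j<i. arr t ''pow'' j = 2 ^ j)"
  let ?s = "effect (Assign ''z'' (Const 1)) s"
  have "ex pow_prog s (1 + (2 + nv * (2 + 2))) (?I nv)"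
    unfolding pow_prog_def
  proof (rule ex_Seq, rule ex_straight)
    show "ex (For ''i'' ''n'' ?b) ?s (2 + nv * (2 + 2)) (?I nv)"
    proof (rule ex_For_const[where I = ?I])
      show "reg ?s ''n'' = nv" using assms by simp
    next
      fix i and t :: state assume I: "?I i t" and ri: "reg t ''i'' = i"
      show "ex ?b t 2 (?I (Suc i))"
        by (intro ex_straight) (use I ri in \<open>auto simp: less_Suc_eq\<close>)
    qed auto
  qed auto
  then show ?thesis by (rule ex_conseq) auto
qed

definition read_edges :: "nat \<Rightarrow> state \<Rightarrow> bool" where
  "read_edges e t \<longleftrightarrow> (let nb = neighbor_list (take e es) in
     reg t ''l'' = 2 + 2 * e \<and>
     (\<forall>u<nv. \<forall>v<nv. arr t ''adj'' (u * W + v) = (if v \<in> set (nb u) then 1 else 0)) \<and>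
     (\<forall>u<nv. arr t ''deg'' u = length (nb u)) \<and>
     (\<forall>u<nv. \<forall>i<length (nb u). arr t ''nbr'' (u * W + i) = nb u ! i))"

lemma edge_correct:
  assumes e: "e < length es" and I: "read_edges e t"
    and inp: "\<And>i. i < length (encode_graph G) \<Longrightarrow> arr t ''input'' i = encode_graph G ! i"
    and base: "\<And>i. i \<le> nv \<Longrightarrow> arr t ''base'' i = i * W"
  shows "read_edges (Suc e) (effect edge_prog t)"
proof -
  obtain a b where ab: "es ! e = (a, b)" by force
  then have "(a, b) \<in> set es" using e by (metis nth_mem)
  then have ab': "a < nv" "b < nv" "a \<noteq> b" using edge_props by auto
  define nb where "nb = neighbor_list (take e es)"
  define nb' where "nb' = neighbor_list (take (Suc e) es)"
  have nb': "nb' u = nb u @ (if u = a then [b] else if u = b then [a] else [])" for u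
    using e ab ab'(3) by (simp add: nb'_def nb_def take_Suc_conv_app_nth neighbor_list_append neighbor_list_single)
  \<comment> \<open>A partial neighbour list is a prefix of the full one, so writing behind its end
    stays inside the row.\<close>
  have len: "length (nb u) < W" if "u < nv" for u
  proof -
    have "neighbor_list es u = nb u @ neighbor_list (drop e es) u"
      unfolding nb_def by (simp flip: neighbor_list_append)
    then show ?thesis using degree_bound[OF that] by simp
  qed
  have l: "reg t ''l'' = 2 + 2 * e"
    and adj: "\<And>u v. u < nv \<Longrightarrow> v < nv \<Longrightarrow> arr t ''adj'' (u * W + v) = (if v \<in> set (nb u) then 1 else 0)"
    and deg: "\<And>u. u < nv \<Longrightarrow> arr t ''deg'' u = length (nb u)"
    and nbr: "\<And>u i. u < nv \<Longrightarrow> i < length (nb u) \<Longrightarrow> arr t ''nbr'' (u * W + i) = nb u ! i"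
    using I unfolding read_edges_def Let_def nb_def by auto
  have in1: "arr t ''input'' (2 + 2 * e) = a" "arr t ''input'' (3 + 2 * e) = b"
    using inp[of "2 + 2 * e"] inp[of "3 + 2 * e"] e ab encode_graph_nth(3,4)[of e G]
    by (simp_all add: length_encode_graph)
  then have in2: "arr t ''input'' (Suc (Suc (2 * e))) = a" "arr t ''input'' (Suc (Suc (Suc (2 * e)))) = b"
    by (simp_all add: numeral_3_eq_3)
  let ?t = "effect edge_prog t"
  have ft: "reg ?t ''l'' = 2 + 2 * Suc e"
    "arr ?t ''adj'' = (arr t ''adj'')(a * W + b := 1, b * W + a := 1)"
    "arr ?t ''deg'' = (arr t ''deg'')(a := Suc (length (nb a)), b := Suc (length (nb b)))"
    "arr ?t ''nbr'' = (arr t ''nbr'')(a * W + length (nb a) := b, b * W + length (nb b) := a)"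
    using l in2 base ab' deg by (simp_all add: edge_prog_def)
  show ?thesis
    unfolding read_edges_def Let_def nb'_def[symmetric] ft
  proof (intro conjI allI impI)
    fix u v assume uv: "u < nv" "v < nv"
    have "u * W + v = a * W + b \<longleftrightarrow> u = a \<and> v = b" "u * W + v = b * W + a \<longleftrightarrow> u = b \<and> v = a"
      using index_eq uv ab' n_less_W by auto
    then show "((arr t ''adj'')(a * W + b := 1, b * W + a := 1)) (u * W + v) = (if v \<in> set (nb' u) then 1 else 0)"
      using adj[OF uv] ab' by (auto simp: nb')
  next
    fix u assume u: "u < nv"
    show "((arr t ''deg'')(a := Suc (length (nb a)), b := Suc (length (nb b)))) u = length (nb' u)"
      using deg[OF u] ab' by (auto simp: nb')
  next
    fix u i assume u: "u < nv" and i: "i < length (nb' u)"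
    have iW: "i < W" using i len[OF u] by (auto simp: nb' split: if_splits)
    have eq: "u * W + i = a * W + length (nb a) \<longleftrightarrow> u = a \<and> i = length (nb a)"
      "u * W + i = b * W + length (nb b) \<longleftrightarrow> u = b \<and> i = length (nb b)"
      using index_eq[OF iW] len ab' by auto
    show "((arr t ''nbr'')(a * W + length (nb a) := b, b * W + length (nb b) := a)) (u * W + i) = nb' u ! i"
    proof (cases "i < length (nb u)")
      case True
      then show ?thesis using nbr[OF u True] eq by (auto simp: nb' nth_append)
    next
      case False
      then have "i = length (nb u)" "u = a \<or> u = b" using i by (auto simp: nb' split: if_splits)
      then show ?thesis using eq ab' by (auto simp: nb')
    qed
  qed simp
qed

definition setup_cost :: nat where
  "setup_cost = 30 * W"

text \<open>Stated for any state with the right input and blank \<open>adj\<close> and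
  \<open>deg\<close>: it is applied to the initial state and to the state left after reading a
  solution.\<close>

lemma setup_correct:
  assumes inp: "\<And>i. i < length (encode_graph G) \<Longrightarrow> arr s ''input'' i = encode_graph G ! i"
    and zero: "\<And>i. arr s ''adj'' i = 0" "\<And>i. arr s ''deg'' i = 0"
  shows "ex setup_prog s setup_cost env"
proof -
  define s1 where "s1 = effect sizes_prog s"
  have un1: "unchanged sizes_prog s s1"
    unfolding s1_def by (simp add: unchanged_def sizes_prog_def)
  have i01: "arr s ''input'' 0 = nv" "arr s ''input'' (Suc 0) = length es"
    using inp[of 0] inp[of 1] encode_graph_nth(1,2)[of G] by (simp_all add: length_encode_graph)
  have r1: "reg s1 ''n'' = nv" "reg s1 ''n1'' = Suc nv" "reg s1 ''m'' = length es" "reg s1 ''W'' = W"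
    using i01 by (simp_all add: s1_def sizes_prog_def W_def)
  have E: "ex edges_prog t (1 + (2 + length es * (9 + 2))) (\<lambda>u. env u)"
    if t: "arr t ''input'' = arr s ''input''" "arr t ''adj'' = arr s ''adj''" "arr t ''deg'' = arr s ''deg''"
      "reg t ''n'' = nv" "reg t ''n1'' = Suc nv" "reg t ''m'' = length es"
      "\<forall>i\<le>nv. arr t ''base'' i = i * W" "\<forall>i<nv. arr t ''pow'' i = 2 ^ i" for t
    unfolding edges_prog_def
  proof (rule ex_Seq, rule ex_straight)
    let ?l = "Assign ''l'' (Const 2)"
    let ?t = "effect ?l t"
    show "ex (For ''e'' ''m'' edge_prog) ?t (2 + length es * (9 + 2)) env"
    proof (rule ex_For_const[where I = read_edges])
      show "reg ?t ''m'' = length es" using t by simp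
      show "read_edges 0 ?t" using t zero by (simp add: read_edges_def neighbor_list_def)
    next
      fix i u x assume "read_edges i u"
      then show "read_edges i (u\<lparr>reg := (reg u)(''e'' := x)\<rparr>)" by (simp add: read_edges_def)
    next
      fix i u assume i: "i < length es" and I: "read_edges i u"
        and un: "unchanged (For ''e'' ''m'' edge_prog) ?t u"
      have "arr u ''input'' = arr s ''input''" "arr u ''base'' = arr t ''base''"
        using un t by (auto simp: unchanged_def)
      then have "read_edges (Suc i) (effect edge_prog u)"
        using i I inp t(7) by (intro edge_correct) auto
      then show "ex edge_prog u 9 (read_edges (Suc i))"
        by (intro ex_straight) (simp_all add: edge_prog_def)
    next
      fix u assume I: "read_edges (length es) u" and un: "unchanged (For ''e'' ''m'' edge_prog) ?t u"
      have "arr u ''pow'' = arr t ''pow''" "arr u ''base'' = arr t ''base''"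
        "reg u ''n'' = nv" "reg u ''n1'' = Suc nv"
        using un t by (auto simp: unchanged_def)
      then show "env u" using I t(7,8) set_nb unfolding env_def read_edges_def Let_def by simp
    qed auto
  qed auto
  have "ex setup_prog s (4 + ((3 + Suc nv * 4) + ((3 + nv * 4) + (1 + (2 + length es * (9 + 2)))))) env"
    unfolding setup_prog_def
  proof (rule ex_Seq, rule ex_straight)
    have "ex (base_prog ;; pow_prog ;; edges_prog) s1
       ((3 + Suc nv * 4) + ((3 + nv * 4) + (1 + (2 + length es * (9 + 2))))) env"
    proof (rule ex_Seq, rule ex_conseq[OF base_correct[OF r1(2,4)] order_refl])
      fix s2 :: state assume b2: "\<forall>i\<le>nv. arr s2 ''base'' i = i * W" and un2: "unchanged base_prog s1 s2"
      have r2: "reg s2 ''n'' = nv" using un2 r1 by (auto simp: unchanged_def)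
      show "ex (pow_prog ;; edges_prog) s2 ((3 + nv * 4) + (1 + (2 + length es * (9 + 2)))) env"
      proof (rule ex_Seq, rule ex_conseq[OF pow_correct[OF r2] order_refl])
        fix s3 :: state assume p3: "\<forall>i<nv. arr s3 ''pow'' i = 2 ^ i" and un3: "unchanged pow_prog s2 s3"
        show "ex edges_prog s3 (1 + (2 + length es * (9 + 2))) env"
          by (rule E) (use un1 un2 un3 r1 b2 p3 in \<open>auto simp: unchanged_def\<close>)
      qed
    qed
    then show "ex (base_prog ;; pow_prog ;; edges_prog) (effect sizes_prog s)
       ((3 + Suc nv * 4) + ((3 + nv * 4) + (1 + (2 + length es * (9 + 2))))) env"
      by (simp add: s1_def)
  qed (auto simp: sizes_prog_def)
  then show ?thesis by (rule ex_conseq) (auto simp: setup_cost_def W_def)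
qed

end

section \<open>Output and a first solution\<close>

definition output_prog :: com where
  "output_prog = For ''i'' ''n''
     (If (Eq (Get ''st'' (Var ''i'')) (Const 2)) (Out (Var ''i'')) Skip)"

definition emit_prog :: com where
  "emit_prog = output_prog ;; Close"

lemma output_changes [simp]:
  "regs_of output_prog = {''i''}" "arrs_of output_prog = {}"
  "regs_of emit_prog = {''i''}" "arrs_of emit_prog = {}"
  by (auto simp: output_prog_def emit_prog_def)

lemma wp_Out: "Q s [Word (aval e s)] \<Longrightarrow> wp (Out e) s 1 Q"
  unfolding wp_def using exec.Out[of e s] by force

lemma wp_Close: "Q s [End] \<Longrightarrow> wp Close s 1 Q"
  unfolding wp_def using exec.Close[of s] by force

lemma ex_For_zero:
  assumes "x \<notin> regs_of c" "y \<notin> regs_of c" "x \<noteq> y" "reg s y = 0"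
  shows "ex (For x y c) s 2 (\<lambda>t. True)"
proof -
  have "ex (For x y c) s (2 + 0 * (0 + 2)) (\<lambda>t. True)"
    by (rule ex_For_const[where I = "\<lambda>_ _. True", OF assms]) auto
  then show ?thesis by simp
qed

context graph begin

definition listed :: "nat set \<Rightarrow> nat list" where
  "listed X = filter (\<lambda>u. u \<in> X) [0..<n]"

lemma set_listed: "X \<subseteq> {..<n} \<Longrightarrow> set (listed X) = X"
  by (auto simp: listed_def)

lemma distinct_listed: "distinct (listed X)"
  by (simp add: listed_def)

lemma members_bound: "members s \<subseteq> {..<n}"
  by (auto simp: members_def)

lemma output_correct:
  assumes env: "env s"
  shows "wp output_prog s (2 + n * 4) (\<lambda>t fs. fs = map Word (listed (members s)))"
proof -
  let ?b = "If (Eq (Get ''st'' (Var ''i'')) (Const 2)) (Out (Var ''i'')) Skip"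
  let ?I = "\<lambda>i (t :: state) fs. fs = map Word (filter (\<lambda>u. u \<in> members s) [0..<i])"
  have "wp output_prog s (2 + (\<Sum>i<n. 2 + 2)) (\<lambda>t fs. ?I n t ([] @ fs))"
    unfolding output_prog_def
  proof (rule wp_For[where I = ?I and Q = "?I n"])
    show "reg s ''n'' = n" using env by (simp add: env_def)
  next
    fix i t fs assume i: "i < n" and I: "?I i t fs" and ri: "reg t ''i'' = i"
      and un: "unchanged (For ''i'' ''n'' ?b) s t"
    have "arr t ''st'' = arr s ''st''" using un by (auto simp: unchanged_def)
    then have st: "arr t ''st'' i = 2 \<longleftrightarrow> i \<in> members s" using i by (simp add: members_def)
    have "wp ?b t (Suc 1) (\<lambda>t' gs. ?I (Suc i) t' (fs @ gs))"
    proof (rule wp_If)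
      assume "bval (Eq (Get ''st'' (Var ''i'')) (Const 2)) t"
      then show "wp (Out (Var ''i'')) t 1 (\<lambda>t' gs. ?I (Suc i) t' (fs @ gs))"
        using st ri I by (intro wp_Out) simp
    next
      assume "\<not> bval (Eq (Get ''st'' (Var ''i'')) (Const 2)) t"
      then show "wp Skip t 1 (\<lambda>t' gs. ?I (Suc i) t' (fs @ gs))"
        using st ri I by (intro wp_straight) simp_all
    qed
    then show "wp ?b t 2 (\<lambda>t' gs. ?I (Suc i) t' (fs @ gs))" by (rule wp_conseq) auto
  qed auto
  then show ?thesis by (rule wp_conseq) (auto simp: listed_def)
qed

lemma emit_correct:
  assumes "env s"
  shows "wp emit_prog s (3 + n * 4) (\<lambda>t fs. fs = written [listed (members s)])"
proof -
  have "wp emit_prog s ((2 + n * 4) + 1) (\<lambda>t fs. fs = written [listed (members s)])"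
    unfolding emit_prog_def
    by (rule wp_Seq, rule wp_conseq[OF output_correct[OF assms] order_refl])
      (auto intro!: wp_Close[simplified] simp: written_def)
  then show ?thesis by (rule wp_conseq) auto
qed

lemma chordal_empty: "chordal (induced_edges E {})"
  by (rule insertion_order_chordal[of E "{}" "\<lambda>_. 0"]) (auto simp: insertion_order_def)

text \<open>In the graph without vertices, 0 is not a vertex and \<open>extend_correct\<close> does
  not apply; there all loops are empty and the empty set is the solution.\<close>

lemma extend_any:
  assumes env: "env s" and v: "reg s ''v'' = 0"
  shows "ex (extend_prog cn) s extend_cost (\<lambda>t. solution cn (members t))"
proof (cases "n = 0")
  case False
  then show ?thesis using extend_correct[OF env _ v, of cn] by (auto elim!: ex_conseq)
next
  case True
  have sol: "solution cn {}"
    using chordal_empty True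
    unfolding solution_def inclusion_maximal_def feasible_def induced_chordal_def by auto
  have skip: "ex (For x ''n'' c ;; d) t (2 + k) (\<lambda>_. True)"
    if "x \<notin> regs_of c" "''n'' \<notin> regs_of c" "x \<noteq> ''n''" "reg t ''n'' = 0"
      "\<And>u. reg u ''n'' = 0 \<Longrightarrow> ex d u k (\<lambda>_. True)" for x c d t k
    by (rule ex_Seq, rule ex_conseq[OF ex_For_zero[OF that(1-4)] order_refl])
      (use that in \<open>auto simp: unchanged_def\<close>)
  have "ex (extend_prog cn) s (2 + (1 + (2 + (2 + 2)))) (\<lambda>_. True)"
    unfolding extend_prog_def clear_prog_def grow_prog_def allow_prog_def
  proof (rule skip)
    fix u :: state assume u: "reg u ''n'' = 0"
    show "ex (Put ''st'' (Var ''v'') (Const 1) ;; For ''r'' ''n'' (round_prog cn) ;;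
       For ''i'' ''n'' (Put ''al'' (Var ''i'') (Const 1)) ;; For ''r'' ''n'' (round_prog cn)) u
       (1 + (2 + (2 + 2))) (\<lambda>_. True)"
    proof (rule ex_Seq, rule ex_straight)
      let ?u = "effect (Put ''st'' (Var ''v'') (Const 1)) u"
      show "ex (For ''r'' ''n'' (round_prog cn) ;; For ''i'' ''n'' (Put ''al'' (Var ''i'') (Const 1)) ;;
         For ''r'' ''n'' (round_prog cn)) ?u (2 + (2 + 2)) (\<lambda>_. True)"
        by (intro skip ex_For_zero) (use u in auto)
    qed auto
  next
    show "reg s ''n'' = 0" using env True unfolding env_def by simp
  qed auto
  then show ?thesis
  proof (rule ex_conseq)
    show "2 + (1 + (2 + (2 + 2))) \<le> extend_cost" by (simp add: extend_cost_def W_def)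
    fix t
    have "members t = {}" using True unfolding members_def by simp
    then show "solution cn (members t)" using sol by simp
  qed
qed

definition emitted :: "state \<Rightarrow> event list \<Rightarrow> nat set list \<Rightarrow> bool" where
  "emitted s es Rs \<longleftrightarrow> (\<exists>xss. es = written xss \<and> map set xss = Rs \<and> (\<forall>xs\<in>set xss. distinct xs))"

lemma emit_emitter: "emitter n m E nb cn emit_prog (3 + n * 4) emitted {} {}"
proof
  fix s es Rs assume env: "env s" and J: "emitted s es Rs"
  obtain xss where xss: "es = written xss" "map set xss = Rs" "\<forall>xs\<in>set xss. distinct xs"
    using J by (auto simp: emitted_def)
  show "wp emit_prog s (3 + n * 4) (\<lambda>t fs. emitted t (es @ fs) (Rs @ [members s]))"
  proof (rule wp_conseq[OF emit_correct[OF env] order_refl])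
    fix t fs assume "fs = written [listed (members s)]"
    then show "emitted t (es @ fs) (Rs @ [members s])"
      using xss set_listed[OF members_bound] distinct_listed unfolding emitted_def
      by (intro exI[of _ "xss @ [listed (members s)]"]) (auto simp: written_append)
  qed
qed (auto simp: emitted_def)

text \<open>The cost of an expansion outside the emitter locale, as a function of the cost of
  consuming one neighbour.\<close>

definition neighbors_bound :: "nat \<Rightarrow> nat" where
  "neighbors_bound ke = W * (extend_cost + ke + 4 * n + 124)"

end

context emitter begin

lemma neighbors_cost_eq: "neighbors_cost = neighbors_bound ke"
  by (simp add: neighbors_cost_def neighbor_cost_def neighbors_bound_def)

end

section \<open>The queue of solutions\<close>

definition encode_prog :: com where
  "encode_prog = Assign ''code'' (Const 0) ;;
     For ''i'' ''n'' (If (Eq (Get ''st'' (Var ''i'')) (Const 2))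
       (Assign ''code'' (Plus (Var ''code'') (Get ''pow'' (Var ''i'')))) Skip)"

definition enqueue_prog :: com where
  "enqueue_prog = If (Eq (Get ''seen'' (Var ''code'')) (Const 0))
     (Put ''seen'' (Var ''code'') (Const 1) ;;
      Put ''que'' (Var ''qt'') (Var ''code'') ;;
      Assign ''qt'' (Plus (Var ''qt'') (Const 1)))
     Skip"

definition record_prog :: com where
  "record_prog = encode_prog ;; enqueue_prog"

text \<open>Binary digits are recovered from the highest down, by comparison and
  subtraction.\<close>

definition fetch_prog :: com where
  "fetch_prog = (Assign ''code'' (Get ''que'' (Var ''qh'')) ;; Assign ''qh'' (Plus (Var ''qh'') (Const 1))) ;;
     For ''i'' ''n''
       (Assign ''x'' (Minus (Minus (Var ''n'') (Const 1)) (Var ''i'')) ;;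
        If (Less (Var ''code'') (Get ''pow'' (Var ''x'')))
          (Put ''mem'' (Var ''x'') (Const 0))
          (Put ''mem'' (Var ''x'') (Const 1) ;;
           Assign ''code'' (Minus (Var ''code'') (Get ''pow'' (Var ''x'')))))"

lemma queue_parts_changes [simp]:
  "regs_of encode_prog = {''code'', ''i''}" "arrs_of encode_prog = {}"
  "regs_of enqueue_prog = {''qt''}" "arrs_of enqueue_prog = {''seen'', ''que''}"
  "regs_of record_prog = {''code'', ''i'', ''qt''}" "arrs_of record_prog = {''seen'', ''que''}"
  "regs_of fetch_prog = {''code'', ''qh'', ''i'', ''x''}" "arrs_of fetch_prog = {''mem''}"
  by (auto simp: encode_prog_def enqueue_prog_def record_prog_def fetch_prog_def)

lemma set_encode_less: "A \<subseteq> {..<k} \<Longrightarrow> set_encode A < 2 ^ k"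
proof -
  assume "A \<subseteq> {..<k}"
  then have "set_encode A \<le> (\<Sum>i<k. 2 ^ i)"
    unfolding set_encode_def by (intro sum_mono2) auto
  also have "(\<Sum>i<k. 2 ^ i) < (2 :: nat) ^ k" by (induction k) auto
  finally show ?thesis .
qed

text \<open>As \<open>remdups\<close> keeps last occurrences, the list is reversed twice.\<close>

definition firsts :: "'a list \<Rightarrow> 'a list" where
  "firsts Rs = rev (remdups (rev Rs))"

lemma firsts_simps [simp]:
  "firsts [] = []" "set (firsts Rs) = set Rs" "distinct (firsts Rs)"
  "firsts (Rs @ [R]) = (if R \<in> set Rs then firsts Rs else firsts Rs @ [R])"
  by (simp_all add: firsts_def)

lemma firsts_distinct: "distinct Rs \<Longrightarrow> firsts Rs = Rs"
  by (simp add: firsts_def distinct_remdups_id)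

text \<open>Discovered sets are only appended, so positions in the queue stay valid during an
  expansion.\<close>

lemma firsts_append: "\<exists>Qs. firsts (Rs @ Ns) = firsts Rs @ Qs"
proof (induction Ns rule: rev_induct)
  case (snoc R Ns)
  then show ?case using firsts_simps(4)[of "Rs @ Ns" R] by auto
qed simp

context graph begin

text \<open>\<open>seen\<close> is specified just at codes of vertex sets; as
  \<open>set_encode\<close> is injective on finite sets, different sets never share an
  entry.\<close>

definition queue :: "state \<Rightarrow> nat set list \<Rightarrow> bool" where
  "queue s Q \<longleftrightarrow> reg s ''qt'' = length Q \<and> (\<forall>i<length Q. arr s ''que'' i = set_encode (Q ! i)) \<and>
     (\<forall>S. S \<subseteq> {..<n} \<longrightarrow> arr s ''seen'' (set_encode S) = (if S \<in> set Q then 1 else 0))"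

definition recorded :: "state \<Rightarrow> event list \<Rightarrow> nat set list \<Rightarrow> bool" where
  "recorded s es Rs \<longleftrightarrow> es = [] \<and> queue s (firsts Rs)"

lemma queue_cong:
  assumes "queue s Q" "reg t ''qt'' = reg s ''qt''" "arr t ''que'' = arr s ''que''"
    "arr t ''seen'' = arr s ''seen''"
  shows "queue t Q"
  using assms by (simp add: queue_def)

lemma encode_correct:
  assumes env: "env s"
  shows "ex encode_prog s (3 + n * 4) (\<lambda>t. reg t ''code'' = set_encode (members s))"
proof -
  let ?b = "If (Eq (Get ''st'' (Var ''i'')) (Const 2))
       (Assign ''code'' (Plus (Var ''code'') (Get ''pow'' (Var ''i'')))) Skip"
  let ?a = "Assign ''code'' (Const 0)"
  let ?I = "\<lambda>i (t :: state). reg t ''code'' = set_encode {u \<in> members s. u < i}"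
  let ?s = "effect ?a s"
  have "ex encode_prog s (1 + (2 + n * (2 + 2))) (?I n)"
    unfolding encode_prog_def
  proof (rule ex_Seq, rule ex_straight)
    show "ex (For ''i'' ''n'' ?b) ?s (2 + n * (2 + 2)) (?I n)"
    proof (rule ex_For_const[where I = ?I])
      show "reg ?s ''n'' = n" using env by (simp add: env_def)
    next
      fix i and t :: state
      assume i: "i < n" and I: "?I i t" and ri: "reg t ''i'' = i" and un: "unchanged (For ''i'' ''n'' ?b) ?s t"
      have ar: "arr t = arr s" using un by (auto simp: unchanged_def)
      have st: "arr t ''st'' i = 2 \<longleftrightarrow> i \<in> members s" using i by (simp add: ar members_def)
      have pw: "arr t ''pow'' i = 2 ^ i" using env i by (simp add: ar env_def)
      have "{u \<in> members s. u < Suc i} =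
        (if i \<in> members s then insert i {u \<in> members s. u < i} else {u \<in> members s. u < i})"
        by (auto simp: less_Suc_eq)
      then show "ex ?b t 2 (?I (Suc i))"
        by (intro ex_straight) (use I ri st pw in \<open>auto simp: add.commute\<close>)
    qed auto
  qed auto
  then show ?thesis
  proof (rule ex_conseq)
    fix t :: state assume "reg t ''code'' = set_encode {u \<in> members s. u < n}"
    moreover have "{u \<in> members s. u < n} = members s" by (auto simp: members_def)
    ultimately show "reg t ''code'' = set_encode (members s)" by simp
  qed simp
qed

lemma record_correct:
  assumes env: "env s" and q: "queue s (firsts Rs)"
  shows "ex record_prog s (7 + n * 4) (\<lambda>t. queue t (firsts (Rs @ [members s])))"
proof -
  define R where "R = members s"
  have R: "R \<subseteq> {..<n}" using members_bound by (simp add: R_def)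
  have "ex record_prog s ((3 + n * 4) + 4) (\<lambda>t. queue t (firsts (Rs @ [R])))"
    unfolding record_prog_def
  proof (rule ex_Seq, rule ex_conseq[OF encode_correct[OF env] order_refl])
    fix t assume c: "reg t ''code'' = set_encode (members s)" and un: "unchanged encode_prog s t"
    have qt: "queue t (firsts Rs)"
      by (rule queue_cong[OF q]) (use un in \<open>auto simp: unchanged_def\<close>)
    have seen: "arr t ''seen'' (set_encode R) = (if R \<in> set Rs then 1 else 0)"
      using qt R by (simp add: queue_def)
    have inj: "set_encode S = set_encode R \<longleftrightarrow> S = R" if "S \<subseteq> {..<n}" for S
      using that R by (intro set_encode_eq) (auto intro: finite_subset)
    have "queue (effect enqueue_prog t) (firsts (Rs @ [R]))"
    proof (cases "R \<in> set Rs")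
      case True
      then have "effect enqueue_prog t = t" using seen c by (simp add: enqueue_prog_def R_def)
      then show ?thesis using qt True by simp
    next
      case False
      then have e: "reg (effect enqueue_prog t) ''qt'' = Suc (length (firsts Rs))"
        "arr (effect enqueue_prog t) ''que'' = (arr t ''que'')(length (firsts Rs) := set_encode R)"
        "arr (effect enqueue_prog t) ''seen'' = (arr t ''seen'')(set_encode R := 1)"
        using seen c qt by (simp_all add: enqueue_prog_def R_def queue_def)
      show ?thesis unfolding queue_def e using qt False inj
        by (auto simp: queue_def nth_append less_Suc_eq)
    qed
    then show "ex enqueue_prog t 4 (\<lambda>t. queue t (firsts (Rs @ [R])))"
      by (intro ex_straight) (auto simp: enqueue_prog_def)
  qed
  then show ?thesis by (rule ex_conseq) (auto simp: R_def)
qed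

lemma record_emitter:
  "emitter n m E nb cn record_prog (7 + n * 4) recorded {''qt''} {''que'', ''seen''}"
proof
  fix s es Rs assume env: "env s" and J: "recorded s es Rs"
  then have q: "queue s (firsts Rs)" "es = []" by (auto simp: recorded_def)
  show "wp record_prog s (7 + n * 4) (\<lambda>t fs. recorded t (es @ fs) (Rs @ [members s]))"
    by (rule ex_wp[OF record_correct[OF env q(1)]]) (auto simp: recorded_def q(2))
next
  fix s t :: state and es Rs assume "recorded s es Rs" "\<And>x. x \<in> {''qt''} \<Longrightarrow> reg t x = reg s x"
    "\<And>a. a \<in> {''que'', ''seen''} \<Longrightarrow> arr t a = arr s a"
  then show "recorded t es Rs" by (auto simp: recorded_def intro: queue_cong)
qed (auto simp: graph_arrays_def work_regs_def work_arrs_def)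

lemma fetch_correct:
  assumes env: "env s" and S: "arr s ''que'' (reg s ''qh'') = set_encode S" "S \<subseteq> {..<n}"
  shows "ex fetch_prog s (4 + n * 6) (\<lambda>t. stored t = S \<and> (\<forall>u<n. arr t ''mem'' u \<le> 1) \<and>
    reg t ''qh'' = Suc (reg s ''qh''))"
proof -
  let ?a = "Assign ''code'' (Get ''que'' (Var ''qh'')) ;; Assign ''qh'' (Plus (Var ''qh'') (Const 1))"
  let ?b = "Assign ''x'' (Minus (Minus (Var ''n'') (Const 1)) (Var ''i'')) ;;
        If (Less (Var ''code'') (Get ''pow'' (Var ''x'')))
          (Put ''mem'' (Var ''x'') (Const 0))
          (Put ''mem'' (Var ''x'') (Const 1) ;;
           Assign ''code'' (Minus (Var ''code'') (Get ''pow'' (Var ''x''))))"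
  let ?s = "effect ?a s"
  let ?I = "\<lambda>i (t :: state). reg t ''code'' = set_encode {u \<in> S. u < n - i} \<and>
     (\<forall>u<n. n - i \<le> u \<longrightarrow> arr t ''mem'' u = (if u \<in> S then 1 else 0)) \<and>
     reg t ''qh'' = Suc (reg s ''qh'')"
  have finS: "finite S" using S(2) by (rule finite_subset) simp
  have "ex fetch_prog s (2 + (2 + n * (4 + 2))) (?I n)"
    unfolding fetch_prog_def
  proof (rule ex_Seq, rule ex_straight)
    show "ex (For ''i'' ''n'' ?b) ?s (2 + n * (4 + 2)) (?I n)"
    proof (rule ex_For_const[where I = ?I])
      show "reg ?s ''n'' = n" using env by (simp add: env_def)
      have "{u \<in> S. u < n} = S" using S(2) by auto
      then show "?I 0 ?s" using S(1) by simp
    next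
      fix i and t :: state
      assume i: "i < n" and I: "?I i t" and ri: "reg t ''i'' = i" and un: "unchanged (For ''i'' ''n'' ?b) ?s t"
      define x where "x = n - 1 - i"
      have x: "x < n" "n - i = Suc x" "n - Suc i = x" using i by (auto simp: x_def)
      have "arr t ''pow'' = arr s ''pow''" "reg t ''n'' = reg s ''n''" using un by (auto simp: unchanged_def)
      then have tx: "arr t ''pow'' x = 2 ^ x" "reg t ''n'' = n" using env x by (simp_all add: env_def)
      \<comment> \<open>The lower digits sum to less than \<open>2 ^ x\<close>, so comparing the
        remaining code with \<open>2 ^ x\<close> decides membership of \<open>x\<close>.\<close>
      have less: "set_encode {u \<in> S. u < x} < 2 ^ x" by (rule set_encode_less) auto
      have code: "reg t ''code'' = (if x \<in> S then 2 ^ x else 0) + set_encode {u \<in> S. u < x}"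
      proof -
        have "{u \<in> S. u < Suc x} = (if x \<in> S then insert x {u \<in> S. u < x} else {u \<in> S. u < x})"
          by (auto simp: less_Suc_eq)
        then show ?thesis using I finS unfolding x(2) by simp
      qed
      let ?t = "effect ?b t"
      have rx: "n - Suc i = x" by (simp add: x_def)
      have e: "reg ?t ''code'' = set_encode {u \<in> S. u < x}"
        "arr ?t ''mem'' = (arr t ''mem'')(x := if x \<in> S then 1 else 0)"
        "reg ?t ''qh'' = reg t ''qh''"
        using code less ri tx rx by auto
      have "?I (Suc i) ?t"
        unfolding e x(3) using I unfolding x(2) by (auto simp: le_less Suc_le_eq)
      then show "ex ?b t 4 (?I (Suc i))" by (rule ex_straight[rotated 2]) auto
    qed auto
  qed auto
  then show ?thesis
  proof (rule ex_conseq)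
    fix t assume "?I n t"
    then show "stored t = S \<and> (\<forall>u<n. arr t ''mem'' u \<le> 1) \<and> reg t ''qh'' = Suc (reg s ''qh'')"
      using S(2) by (auto simp: stored_def split: if_splits)
  qed simp
qed

end

section \<open>Listing all solutions\<close>

context graph begin

lemma solution_bound: "solution cn S \<Longrightarrow> S \<subseteq> {..<n}"
  by (auto simp: solution_def inclusion_maximal_def feasible_def induced_chordal_def)

lemma finite_solutions: "finite (Collect (solution cn))"
  by (rule finite_subset[of _ "Pow {..<n}"]) (auto dest: solution_bound)

lemma neighborhood_proximity:
  assumes "neighborhood cn S N" "solution cn S" "solution cn S'" "S \<noteq> S'"
  shows "\<exists>R\<in>N. card (proximity cn E S S') < card (proximity cn E R S')"
proof -
  obtain num where num: "inj_on num S"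
    "\<forall>v<n. v \<notin> S \<longrightarrow> (\<forall>a. a = v \<or> adj E v a \<longrightarrow> covers cn S num N v a)"
    using assms(1) unfolding neighborhood_def by blast
  show ?thesis
  proof (rule proximity_increases[where V = "{..<n}" and num = num])
    fix v a assume "v \<in> {..<n}" "v \<notin> S" "a = v \<or> a \<in> S \<and> adj E v a"
    then have "covers cn S num N v a" using num(2) by blast
    then show "\<exists>R\<in>N. \<forall>P. v \<in> P \<and> P \<subseteq> candidate E S num v a \<and> conn_if cn E P \<longrightarrow> P \<subseteq> R"
      by (simp add: covers_def)
  qed (use assms num(1) E in \<open>auto simp: solution_def\<close>)
qed

text \<open>If \<open>S'\<close> were missing, take a listed solution of greatest proximity to it;
  its neighbourhood contains a closer one, which is listed as well.\<close>

lemma closed_complete: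
  assumes Q: "Q \<subseteq> Collect (solution cn)" "Q \<noteq> {}"
    and closed: "\<And>S. S \<in> Q \<Longrightarrow> \<exists>N\<subseteq>Q. neighborhood cn S N"
  shows "Q = Collect (solution cn)"
proof (rule ccontr)
  assume "Q \<noteq> Collect (solution cn)"
  then obtain S' where S': "solution cn S'" "S' \<notin> Q" using Q(1) by blast
  let ?f = "\<lambda>S. card (proximity cn E S S')"
  have fin: "finite (?f ` Q)" using finite_subset[OF Q(1) finite_solutions] by simp
  then have "Max (?f ` Q) \<in> ?f ` Q" using Q(2) by (intro Max_in) auto
  then obtain S where S: "S \<in> Q" "?f S = Max (?f ` Q)" by auto
  obtain N where N: "N \<subseteq> Q" "neighborhood cn S N" using closed[OF S(1)] by blast
  obtain R where R: "R \<in> N" "?f S < ?f R"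
    using neighborhood_proximity[OF N(2) _ S'(1)] S S' Q(1) by blast
  have "?f R \<le> Max (?f ` Q)" using fin R(1) N(1) by (intro Max_ge) auto
  then show False using R(2) S(2) by simp
qed

end

definition visit_solution_prog :: com where
  "visit_solution_prog = fetch_prog ;; load_prog ;; output_prog"

text \<open>The item is closed before the expansion starts, so the expansion is charged to the next
  segment.\<close>

definition iteration_prog :: "bool \<Rightarrow> com" where
  "iteration_prog cn = visit_solution_prog ;; Close ;; neighbors_prog cn record_prog"

definition list_prog :: "bool \<Rightarrow> com" where
  "list_prog cn = setup_prog ;; Assign ''v'' (Const 0) ;; extend_prog cn ;; record_prog ;;
     While (Less (Var ''qh'') (Var ''qt'')) (iteration_prog cn)"

lemma visible_no_End: "End \<notin> set (visible t) \<Longrightarrow> segments t = [t]"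
  by (induction t rule: segments.induct) auto

lemma segments_End: "End \<notin> set (visible t) \<Longrightarrow> segments (t @ End # u) = (t @ [End]) # segments u"
  using visible_no_End[of t] by (simp add: segments_append)

lemma segments_silent:
  "End \<notin> set (visible t) \<Longrightarrow> segments (t @ u) = (t @ hd (segments u)) # tl (segments u)"
  using visible_no_End[of t] by (simp add: segments_append)

context graph begin

text \<open>At \<open>h = length Q\<close> the queue is closed under neighbourhoods, which gives
  completeness; distinctness of \<open>Q\<close> gives single output.\<close>

definition listing_state :: "bool \<Rightarrow> state \<Rightarrow> nat set list \<Rightarrow> nat \<Rightarrow> bool" where
  "listing_state cn s Q h \<longleftrightarrow> env s \<and> queue s Q \<and> distinct Q \<and> set Q \<subseteq> Collect (solution cn) \<and>
     reg s ''qh'' = h \<and> h \<le> length Q \<and> (\<forall>i<h. \<exists>N\<subseteq>set Q. neighborhood cn (Q ! i) N)"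

definition visit_bound :: nat where
  "visit_bound = 8 + n * 14"

abbreviation record_bound :: nat where
  "record_bound \<equiv> neighbors_bound (7 + n * 4)"

text \<open>The trace is split at its \<open>End\<close> because the two halves belong to different
  segments and are bounded separately.\<close>

lemma iteration_correct:
  assumes inv: "listing_state cn s Q h" and h: "h < length Q"
  shows "\<exists>t u s' Q'. exec (iteration_prog cn) s (t @ End # u) s' \<and>
     visible t = map Word (listed (Q ! h)) \<and> visible u = [] \<and>
     length t \<le> visit_bound \<and> length u \<le> record_bound \<and> listing_state cn s' (Q @ Q') (Suc h)"
proof -
  define S where "S = Q ! h"
  have env: "env s" and q: "queue s Q" and Q: "distinct Q" "set Q \<subseteq> Collect (solution cn)"
    and qh: "reg s ''qh'' = h" and nbh: "\<forall>i<h. \<exists>N\<subseteq>set Q. neighborhood cn (Q ! i) N"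
    using inv by (auto simp: listing_state_def)
  have solS: "solution cn S" using Q(2) h unfolding S_def by (meson mem_Collect_eq nth_mem subsetD)
  have Sn: "S \<subseteq> {..<n}" by (rule solution_bound[OF solS])
  have que: "arr s ''que'' (reg s ''qh'') = set_encode S" using q h by (simp add: queue_def qh S_def)
  let ?T = "\<lambda>t. env t \<and> queue t Q \<and> stored t = S \<and> (\<forall>u<n. arr t ''mem'' u \<le> 1) \<and> reg t ''qh'' = Suc h"
  have "wp visit_solution_prog s ((4 + n * 6) + ((2 + n * 4) + (2 + n * 4)))
     (\<lambda>t fs. ?T t \<and> fs = map Word (listed S))"
    unfolding visit_solution_prog_def
  proof (rule wp_Seq_silent, rule ex_conseq[OF fetch_correct[OF env que Sn] order_refl])
    fix s1 assume f: "stored s1 = S \<and> (\<forall>u<n. arr s1 ''mem'' u \<le> 1) \<and> reg s1 ''qh'' = Suc (reg s ''qh'')"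
      and un1: "unchanged fetch_prog s s1"
    have T1: "?T s1"
      using f qh env_unchanged[OF env un1] queue_cong[OF q, of s1] un1
      by (auto simp: graph_arrays_def unchanged_def)
    then have env1: "env s1" by blast
    show "wp (load_prog ;; output_prog) s1 ((2 + n * 4) + (2 + n * 4)) (\<lambda>t fs. ?T t \<and> fs = map Word (listed S))"
    proof (rule wp_Seq_silent, rule ex_conseq[OF load_correct[OF env1] order_refl])
      fix s2 assume m: "members s2 = stored s1" and un2: "unchanged load_prog s1 s2"
      have T2: "?T s2"
        using T1 env_unchanged[OF env1 un2] queue_cong[of s1 Q s2] un2
        by (auto simp: graph_arrays_def unchanged_def stored_def)
      then have env2: "env s2" by blast
      show "wp output_prog s2 (2 + n * 4) (\<lambda>t fs. ?T t \<and> fs = map Word (listed S))"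
      proof (rule wp_conseq[OF output_correct[OF env2] order_refl])
        fix t fs assume fs: "fs = map Word (listed (members s2))" and un3: "unchanged output_prog s2 t"
        have "?T t"
          using T2 env_unchanged[OF env2 un3] queue_cong[of s2 Q t] un3
          by (auto simp: graph_arrays_def unchanged_def stored_def)
        then show "?T t \<and> fs = map Word (listed S)" using fs m T1 by simp
      qed
    qed
  qed
  then obtain t s1 where t: "exec visit_solution_prog s t s1" "length t \<le> visit_bound"
    "visible t = map Word (listed S)" and T: "?T s1"
    unfolding wp_def by (auto simp: visit_bound_def)
  interpret r: emitter n m E nb cn record_prog "7 + n * 4" recorded "{''qt''}" "{''que'', ''seen''}"
    by (rule record_emitter)
  \<comment> \<open>The queue has no repetitions, so it can serve as its own history of recorded
    sets.\<close>
  have J: "recorded s1 [] Q" using T Q(1) by (simp add: recorded_def firsts_distinct)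
  have "wp (neighbors_prog cn record_prog) s1 record_bound
      (\<lambda>t fs. \<exists>Ns. recorded t ([] @ fs) (Q @ Ns) \<and> neighborhood cn S (set Ns))"
    using r.neighbors_correct[OF _ J, of S] T solS by (simp add: r.neighbors_cost_eq)
  then obtain u s2 Ns where u: "exec (neighbors_prog cn record_prog) s1 u s2" "length u \<le> record_bound"
    "recorded s2 (visible u) (Q @ Ns)" and N: "neighborhood cn S (set Ns)"
    unfolding wp_def by auto
  have un: "unchanged (neighbors_prog cn record_prog) s1 s2" by (rule exec_unchanged[OF u(1)])
  have vu: "visible u = []" and q2: "queue s2 (firsts (Q @ Ns))" using u(3) by (auto simp: recorded_def)
  obtain Q' where Q': "firsts (Q @ Ns) = Q @ Q'" using firsts_append[of Q Ns] Q(1) by (auto simp: firsts_distinct)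
  have set': "set (Q @ Q') = set Q \<union> set Ns" by (metis Q' firsts_simps(2) set_append)
  have "listing_state cn s2 (Q @ Q') (Suc h)"
    unfolding listing_state_def
  proof (intro conjI allI impI)
    show "env s2"
      by (rule env_unchanged[of s1, OF _ un]) (use T in \<open>auto simp: graph_arrays_def work_regs_def work_arrs_def\<close>)
    show "queue s2 (Q @ Q')" using q2 Q' by simp
    show "distinct (Q @ Q')" by (metis Q' firsts_simps(3))
    show "set (Q @ Q') \<subseteq> Collect (solution cn)" using set' Q(2) N by (auto simp: neighborhood_def)
    show "reg s2 ''qh'' = Suc h" using un T by (auto simp: unchanged_def work_regs_def)
    show "Suc h \<le> length (Q @ Q')" using h by simp
    fix i assume i: "i < Suc h"
    show "\<exists>N\<subseteq>set (Q @ Q'). neighborhood cn ((Q @ Q') ! i) N"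
    proof (cases "i = h")
      case True
      then show ?thesis using N set' h by (intro exI[of _ "set Ns"]) (auto simp: nth_append S_def)
    next
      case False
      then have "i < h" using i by simp
      then obtain N' where "N' \<subseteq> set Q" "neighborhood cn (Q ! i) N'" using nbh by blast
      then show ?thesis using i False h set' by (intro exI[of _ N']) (auto simp: nth_append)
    qed
  qed
  moreover have "exec (iteration_prog cn) s (t @ [End] @ u) s2"
    unfolding iteration_prog_def by (rule exec.Seq[OF t(1) exec.Seq[OF exec.Close u(1)]])
  ultimately show ?thesis using t u vu by (auto simp: S_def)
qed

text \<open>Induction on the number of solutions not yet expanded; the queue is a repetition-free
  list of solutions, so it cannot outgrow their number. The 2 pays for the loop test and the
  \<open>End\<close>.\<close>

lemma listing_loop:
  assumes "listing_state cn s Q h"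
  shows "\<exists>t s' Q'. exec (While (Less (Var ''qh'') (Var ''qt'')) (iteration_prog cn)) s t s' \<and>
     listing_state cn s' (Q @ Q') (length (Q @ Q')) \<and>
     visible t = written (map listed (drop h (Q @ Q'))) \<and>
     length (hd (segments t)) \<le> visit_bound + 2 \<and>
     (\<forall>seg\<in>set (tl (segments t)). length seg \<le> record_bound + (visit_bound + 2))"
  using assms
proof (induction "card (Collect (solution cn)) - h" arbitrary: s Q h rule: less_induct)
  case less
  let ?b = "Less (Var ''qh'') (Var ''qt'')"
  have qh: "reg s ''qh'' = h" and qt: "reg s ''qt'' = length Q" and hQ: "h \<le> length Q"
    and Q: "distinct Q" "set Q \<subseteq> Collect (solution cn)"
    using less(2) by (auto simp: listing_state_def queue_def)
  have "card (set Q) \<le> card (Collect (solution cn))" by (rule card_mono[OF finite_solutions Q(2)])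
  then have lenQ: "length Q \<le> card (Collect (solution cn))" using Q(1) by (simp add: distinct_card)
  show ?case
  proof (cases "h < length Q")
    case False
    then have "exec (While ?b (iteration_prog cn)) s [Step] s" using qh qt by (intro exec.WhileFalse) simp
    then show ?thesis using less(2) hQ False
      by (intro exI[of _ "[Step]"] exI[of _ s] exI[of _ "[]"]) (auto simp: written_def)
  next
    case True
    obtain t u s1 Q1 where it: "exec (iteration_prog cn) s (t @ End # u) s1"
      "visible t = map Word (listed (Q ! h))" "visible u = []"
      "length t \<le> visit_bound" "length u \<le> record_bound" "listing_state cn s1 (Q @ Q1) (Suc h)"
      using iteration_correct[OF less(2) True] by blast
    have "card (Collect (solution cn)) - Suc h < card (Collect (solution cn)) - h" using True lenQ by simp
    from less(1)[OF this it(6)] obtain t' s' Q2 where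
      t': "exec (While ?b (iteration_prog cn)) s1 t' s'"
      "listing_state cn s' ((Q @ Q1) @ Q2) (length ((Q @ Q1) @ Q2))"
      "visible t' = written (map listed (drop (Suc h) ((Q @ Q1) @ Q2)))"
      "length (hd (segments t')) \<le> visit_bound + 2"
      "\<forall>seg\<in>set (tl (segments t')). length seg \<le> record_bound + (visit_bound + 2)" by blast
    have ex: "exec (While ?b (iteration_prog cn)) s (Step # (t @ End # u) @ t') s'"
      using qh qt True by (intro exec.WhileTrue[OF _ it(1) t'(1)]) simp
    have "drop h (Q @ Q1 @ Q2) = Q ! h # drop (Suc h) (Q @ Q1 @ Q2)"
      using True Cons_nth_drop_Suc[of h "Q @ Q1 @ Q2"] by (simp add: nth_append)
    then have vis: "visible (Step # (t @ End # u) @ t') = written (map listed (drop h (Q @ Q1 @ Q2)))"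
      using it(2,3) t'(3) by (simp add: written_def)
    \<comment> \<open>The expansion part \<open>u\<close> produces no \<open>End\<close>, so it
      merges with the first segment of the remaining loop.\<close>
    have segs: "segments (Step # (t @ End # u) @ t') = (Step # t @ [End]) # (u @ hd (segments t')) # tl (segments t')"
    proof -
      have "End \<notin> set (visible (Step # t))" using it(2) by auto
      then have "segments ((Step # t) @ End # (u @ t')) = ((Step # t) @ [End]) # segments (u @ t')"
        by (rule segments_End)
      moreover have "segments (u @ t') = (u @ hd (segments t')) # tl (segments t')"
        using it(3) by (intro segments_silent) simp
      ultimately show ?thesis by (simp only: append_Cons append_assoc)
    qed
    show ?thesis
    proof (intro exI conjI)
      show "exec (While ?b (iteration_prog cn)) s (Step # (t @ End # u) @ t') s'" by (rule ex)
      show "listing_state cn s' (Q @ Q1 @ Q2) (length (Q @ Q1 @ Q2))" using t'(2) by simp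
      show "visible (Step # (t @ End # u) @ t') = written (map listed (drop h (Q @ Q1 @ Q2)))"
        by (rule vis)
      show "length (hd (segments (Step # (t @ End # u) @ t'))) \<le> visit_bound + 2"
        unfolding segs using it(4) by simp
      show "\<forall>seg\<in>set (tl (segments (Step # (t @ End # u) @ t'))).
          length seg \<le> record_bound + (visit_bound + 2)"
        unfolding segs using it(5) t'(4,5) by auto
    qed
  qed
qed

end

context graph_instance begin

lemma queue_start: "queue (initial ws) []"
  by (simp add: queue_def initial_def)

lemma setup_initial: "ex setup_prog (initial (encode_graph G)) setup_cost env"
  by (rule setup_correct) (auto simp: initial_def)

definition delay_bound :: nat where
  "delay_bound = setup_cost + extend_cost + (8 + nv * 4) + (visit_bound + 2) + record_bound"

lemma list_prog_correct:
  "\<exists>t Ss. outputs (list_prog cn) (encode_graph G) t Ss \<and> distinct Ss \<and> set Ss = Collect (solution cn) \<and>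
     delay t \<le> delay_bound"
proof -
  let ?s = "initial (encode_graph G)"
  let ?loop = "While (Less (Var ''qh'') (Var ''qt'')) (iteration_prog cn)"
  let ?v = "Assign ''v'' (Const 0)"
  let ?start = "setup_prog ;; ?v ;; extend_prog cn ;; record_prog"
  have "ex ?start ?s (setup_cost + (1 + (extend_cost + (7 + nv * 4))))
     (\<lambda>t. \<exists>S. listing_state cn t [S] 0)"
  proof (rule ex_Seq, rule ex_conseq[OF setup_initial order_refl])
    fix s1 assume env1: "env s1" and un1: "unchanged setup_prog ?s s1"
    have q1: "queue s1 []" "reg s1 ''qh'' = 0"
      using un1 queue_cong[OF queue_start, of s1 "encode_graph G"] by (auto simp: unchanged_def initial_def)
    show "ex (?v ;; extend_prog cn ;; record_prog) s1 (1 + (extend_cost + (7 + nv * 4)))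
       (\<lambda>t. \<exists>S. listing_state cn t [S] 0)"
    proof (rule ex_Seq, rule ex_straight)
      let ?s2 = "effect ?v s1"
      have un2: "unchanged ?v s1 ?s2" by (simp add: unchanged_def)
      have env2: "env ?s2" by (rule env_unchanged[OF env1 un2]) auto
      have v2: "reg ?s2 ''v'' = 0" by simp
      have q2: "queue ?s2 []" "reg ?s2 ''qh'' = 0" using q1 by (auto intro: queue_cong)
      show "ex (extend_prog cn ;; record_prog) ?s2 (extend_cost + (7 + nv * 4)) (\<lambda>t. \<exists>S. listing_state cn t [S] 0)"
      proof (rule ex_Seq, rule ex_conseq[OF extend_any[OF env2 v2] order_refl])
        fix s3 assume sol: "solution cn (members s3)" and un3: "unchanged (extend_prog cn) ?s2 s3"
        have env3: "env s3" by (rule env_unchanged[OF env2 un3]) (auto simp: graph_arrays_def)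
        have q3: "queue s3 (firsts [])" "reg s3 ''qh'' = 0"
          using queue_cong[OF q2(1), of s3] un3 q2(2) by (auto simp: unchanged_def)
        show "ex record_prog s3 (7 + nv * 4) (\<lambda>t. \<exists>S. listing_state cn t [S] 0)"
        proof (rule ex_conseq[OF record_correct[OF env3 q3(1)] order_refl])
          fix t assume q: "queue t (firsts ([] @ [members s3]))" and un4: "unchanged record_prog s3 t"
          have "env t" by (rule env_unchanged[OF env3 un4]) (auto simp: graph_arrays_def)
          moreover have "reg t ''qh'' = 0" using un4 q3 by (auto simp: unchanged_def)
          moreover have "queue t [members s3]" using q by (simp add: firsts_distinct)
          ultimately have "listing_state cn t [members s3] 0" using sol by (simp add: listing_state_def)
          then show "\<exists>S. listing_state cn t [S] 0" ..
        qed
      qed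
    qed auto
  qed
  then obtain t0 s0 S where t0: "exec ?start ?s t0 s0"
    "length t0 \<le> setup_cost + (1 + (extend_cost + (7 + nv * 4)))" "visible t0 = []" "listing_state cn s0 [S] 0"
    unfolding ex_def wp_def by auto
  obtain t1 s1 Q' where t1: "exec ?loop s0 t1 s1" "listing_state cn s1 ([S] @ Q') (length ([S] @ Q'))"
    "visible t1 = written (map listed (drop 0 ([S] @ Q')))"
    "length (hd (segments t1)) \<le> visit_bound + 2"
    "\<forall>seg\<in>set (tl (segments t1)). length seg \<le> record_bound + (visit_bound + 2)"
    using listing_loop[OF t0(4)] by blast
  define Q where "Q = [S] @ Q'"
  define t where "t = t0 @ t1"
  have run: "run (list_prog cn) (encode_graph G) t"
  proof -
    \<comment> \<open>\<open>;;\<close> associates to the right, so \<open>?start\<close> is not a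
      subprogram of \<open>list_prog cn\<close>; its trace is taken apart and reassembled.\<close>
    from t0(1) obtain u1 u2 u3 u4 r1 r2 r3 where u: "exec setup_prog ?s u1 r1" "exec ?v r1 u2 r2"
      "exec (extend_prog cn) r2 u3 r3" "exec record_prog r3 u4 s0" "t0 = u1 @ u2 @ u3 @ u4"
      by (elim exec_SeqE) blast
    have "exec (list_prog cn) ?s (u1 @ u2 @ u3 @ u4 @ t1) s1"
      unfolding list_prog_def
      by (rule exec.Seq[OF u(1) exec.Seq[OF u(2) exec.Seq[OF u(3) exec.Seq[OF u(4) t1(1)]]]])
    then show ?thesis unfolding run_def t_def u(5) by auto
  qed
  have vis: "visible t = written (map listed Q)" using t0(3) t1(3) by (simp add: t_def Q_def)
  have Q: "distinct Q" "set Q \<subseteq> Collect (solution cn)"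
    using t1(2) by (auto simp: listing_state_def Q_def)
  have "set Q = Collect (solution cn)"
  proof (rule closed_complete[OF Q(2)])
    fix S assume "S \<in> set Q"
    then obtain i where "i < length Q" "S = Q ! i" by (metis in_set_conv_nth)
    then show "\<exists>N\<subseteq>set Q. neighborhood cn S N"
      using t1(2) unfolding listing_state_def Q_def[symmetric] by blast
  qed (simp add: Q_def)
  moreover have "map set (map listed Q) = Q"
    unfolding map_map by (rule map_idI) (use Q(2) in \<open>auto simp: set_listed[OF solution_bound]\<close>)
  ultimately have "outputs (list_prog cn) (encode_graph G) t Q \<and> distinct Q \<and> set Q = Collect (solution cn)"
    unfolding outputs_def items_written(1)[OF vis]
    using run items_written(2)[OF vis] Q(1) distinct_listed by auto
  moreover have "delay t \<le> delay_bound"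
  proof -
    \<comment> \<open>The startup is silent and merely prolongs the first segment.\<close>
    have segs: "segments t = (t0 @ hd (segments t1)) # tl (segments t1)"
      unfolding t_def using t0(3) by (intro segments_silent) simp
    have "length seg \<le> delay_bound" if "seg \<in> set (segments t)" for seg
      using that t0(2) t1(4,5) unfolding segs by (auto simp: delay_bound_def)
    then show ?thesis unfolding delay_def by (subst Max_le_iff) auto
  qed
  ultimately show ?thesis by blast
qed

end

section \<open>Proximity search\<close>

text \<open>The length of the list stands at position \<open>2 + 2 * m\<close>, right behind the
  encoded graph. Resetting \<open>i\<close> removes the last trace of the loop.\<close>

definition read_prog :: com where
  "read_prog =
     (Assign ''l'' (Plus (Const 2) (Plus (Get ''input'' (Const 1)) (Get ''input'' (Const 1)))) ;;
      Assign ''len'' (Get ''input'' (Var ''l''))) ;;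
     For ''i'' ''len''
       (Put ''mem'' (Get ''input'' (Plus (Plus (Var ''l'') (Const 1)) (Var ''i''))) (Const 1) ;;
        Put ''input'' (Plus (Plus (Var ''l'') (Const 1)) (Var ''i'')) (Const 0)) ;;
     Put ''input'' (Var ''l'') (Const 0) ;;
     Assign ''i'' (Const 0)"

text \<open>The list representing \<open>S\<close> is erased while it is read, so that the remaining computation
  depends on \<open>S\<close> only.\<close>

definition given_state :: "Defs.graph \<Rightarrow> nat set \<Rightarrow> state" where
  "given_state G S = (initial (encode_graph G))
     \<lparr>reg := (\<lambda>_. 0)(''l'' := length (encode_graph G), ''len'' := card S),
      arr := (arr (initial (encode_graph G)))(''mem'' := (\<lambda>u. if u \<in> S then 1 else 0))\<rparr>"

definition first_prog :: "bool \<Rightarrow> com" where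
  "first_prog cn = setup_prog ;; Assign ''v'' (Const 0) ;; extend_prog cn ;; emit_prog"

definition search_prog :: "bool \<Rightarrow> com" where
  "search_prog cn = setup_prog ;; neighbors_prog cn emit_prog"

text \<open>The neighbour function is defined by the program itself. Since execution is
  deterministic and starts from \<open>given_state G S\<close>, its value depends on the set
  \<open>S\<close> and not on a listing of it.\<close>

definition neighbor_sets :: "bool \<Rightarrow> Defs.graph \<Rightarrow> nat set \<Rightarrow> nat set set" where
  "neighbor_sets cn G S =
     {R. \<exists>t s'. exec (search_prog cn) (given_state G S) t s' \<and> R \<in> set ` set (items t)}"

text \<open>The final state is determined exactly, not up to an invariant: nothing of the order of
  \<open>xs\<close> may survive.\<close>

lemma read_correct:
  assumes xs: "set xs = S" "distinct xs"
  shows "ex read_prog (initial (encode_graph G @ length xs # xs)) (6 + card S * 4) (\<lambda>t. t = given_state G S)"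
proof -
  define enc where "enc = encode_graph G"
  define L where "L = length enc"
  define N where "N = length xs"
  have cS: "card S = N" using xs by (simp add: N_def distinct_card flip: xs(1))
  define s where "s = initial (enc @ N # xs)"
  let ?a = "Assign ''l'' (Plus (Const 2) (Plus (Get ''input'' (Const 1)) (Get ''input'' (Const 1)))) ;;
      Assign ''len'' (Get ''input'' (Var ''l''))"
  let ?b = "Put ''mem'' (Get ''input'' (Plus (Plus (Var ''l'') (Const 1)) (Var ''i''))) (Const 1) ;;
        Put ''input'' (Plus (Plus (Var ''l'') (Const 1)) (Var ''i'')) (Const 0)"
  let ?z = "Put ''input'' (Var ''l'') (Const 0)"
  let ?i = "Assign ''i'' (Const 0)"
  \<comment> \<open>The input array after \<open>i\<close> elements of the list have been read and
    erased.\<close>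
  define inp where "inp i k = (if k < L then enc ! k else if k = L then N
     else if L + i < k \<and> k \<le> L + N then xs ! (k - L - 1) else 0)" for i k
  define mem where "mem i u = (if u \<in> set (take i xs) then 1 else 0 :: nat)" for i u
  let ?I = "\<lambda>i (t :: state). (\<forall>x. x \<noteq> ''i'' \<longrightarrow> reg t x = ((\<lambda>_. 0)(''l'' := L, ''len'' := N)) x) \<and>
     (\<forall>a. arr t a = (if a = ''mem'' then mem i else if a = ''input'' then inp i else (\<lambda>_. 0)))"
  have e1: "enc ! Suc 0 = length (snd G)" "L = 2 + 2 * length (snd G)"
    using encode_graph_nth(2)[of G] length_encode_graph[of G] by (simp_all add: enc_def L_def)
  have s0: "reg s = (\<lambda>_. 0)" "\<And>a. a \<noteq> ''input'' \<Longrightarrow> arr s a = (\<lambda>_. 0)"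
    by (auto simp: s_def initial_def)
  have inp0: "arr s ''input'' k = inp 0 k" for k
  proof -
    consider "k < L" | "k = L" | "L < k" "k \<le> L + N" | "L + N < k" by linarith
    then show ?thesis
      by cases (auto simp: s_def initial_def inp_def L_def N_def nth_append nth_Cons')
  qed
  have "ex read_prog s (2 + ((2 + N * (2 + 2)) + (1 + 1))) (\<lambda>t. t = given_state G S)"
    unfolding read_prog_def
  proof (rule ex_Seq, rule ex_straight)
    let ?t = "effect ?a s"
    have "inp 0 (Suc 0) = length (snd G)" "inp 0 L = N" using e1 by (simp_all add: inp_def)
    then have "arr s ''input'' (Suc 0) = length (snd G)"
      "arr s ''input'' (Suc (Suc (length (snd G) + length (snd G)))) = N"
      using inp0[of "Suc 0"] inp0[of L] e1(2) by (simp_all add: mult_2)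
    then have at: "arr ?t = arr s" "reg ?t = (\<lambda>_. 0)(''l'' := L, ''len'' := N)"
      using e1(2) by (simp_all add: s0(1) mult_2)
    show "ex (For ''i'' ''len'' ?b ;; ?z ;; ?i) ?t ((2 + N * (2 + 2)) + (1 + 1)) (\<lambda>t. t = given_state G S)"
    proof (rule ex_Seq, rule ex_For_const[where I = ?I])
      show "reg ?t ''len'' = N" using at(2) by simp
      have "arr s ''input'' = inp 0" using inp0 by blast
      then show "?I 0 ?t" unfolding at using s0(2) by (auto simp: mem_def fun_eq_iff)
    next
      fix i and t :: state assume i: "i < N" and I: "?I i t" and ri: "reg t ''i'' = i"
      have l: "reg t ''l'' = L" using I by simp
      have x: "inp i (Suc (L + i)) = xs ! i" using i by (simp add: inp_def)
      have m: "(mem i)(xs ! i := 1) = mem (Suc i)"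
        using i by (auto simp: mem_def fun_eq_iff take_Suc_conv_app_nth N_def)
      have n: "(inp i)(Suc (L + i) := 0) = inp (Suc i)"
        by (auto simp: inp_def fun_eq_iff)
      have ai: "arr t ''input'' = inp i" "arr t ''mem'' = mem i" using I by simp_all
      have "arr (effect ?b t) = (arr t)(''mem'' := mem (Suc i), ''input'' := inp (Suc i))"
        using l ri x m n ai by simp
      moreover have "reg (effect ?b t) = reg t" by simp
      ultimately have "?I (Suc i) (effect ?b t)" using I by auto
      then show "ex ?b t 2 (?I (Suc i))" by (rule ex_straight[rotated 2]) auto
    next
      fix t assume I: "?I N t"
      let ?u = "effect ?i (effect ?z t)"
      have l: "reg t ''l'' = L" using I by simp
      have ai: "arr t ''input'' = inp N" using I by simp
      have z: "(inp N)(L := 0) = arr (initial enc) ''input''"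
        by (auto simp: inp_def initial_def L_def fun_eq_iff)
      have mN: "mem N = (\<lambda>u. if u \<in> S then 1 else 0)" using xs by (auto simp: mem_def N_def fun_eq_iff)
      have reg: "reg ?u = reg (given_state G S)"
        using I cS by (auto simp: given_state_def fun_eq_iff L_def enc_def)
      have "arr ?u = (arr t)(''input'' := (inp N)(L := 0))" using l ai by simp
      also have "\<dots> = arr (given_state G S)"
        unfolding z using I mN by (auto simp: given_state_def fun_eq_iff initial_def enc_def)
      finally have "?u = given_state G S" using reg by simp
      then have "ex ?i (effect ?z t) 1 (\<lambda>t. t = given_state G S)" by (intro ex_straight) auto
      then show "ex (?z ;; ?i) t (1 + 1) (\<lambda>t. t = given_state G S)"
        by (intro ex_Seq) (auto intro!: ex_straight[where c = ?z])
    qed auto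
  qed auto
  then show ?thesis unfolding enc_def[symmetric] N_def[symmetric] cS s_def[symmetric] by (rule ex_conseq) auto
qed

context graph_instance begin

lemma first_correct:
  "\<exists>t S. solution cn S \<and> outputs (first_prog cn) (encode_graph G) t [S] \<and>
     length t \<le> setup_cost + (1 + (extend_cost + (3 + nv * 4)))"
proof -
  let ?s = "initial (encode_graph G)"
  let ?v = "Assign ''v'' (Const 0)"
  let ?Q = "\<lambda>t fs. \<exists>S. solution cn S \<and> fs = written [listed S]"
  have "wp (first_prog cn) ?s (setup_cost + (1 + (extend_cost + (3 + nv * 4)))) ?Q"
    unfolding first_prog_def
  proof (rule wp_Seq_silent, rule ex_conseq[OF setup_initial order_refl])
    fix s1 assume env1: "env s1"
    show "wp (?v ;; extend_prog cn ;; emit_prog) s1 (1 + (extend_cost + (3 + nv * 4))) ?Q"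
    proof (rule wp_Seq_silent, rule ex_straight)
      let ?s2 = "effect ?v s1"
      have env2: "env ?s2" by (rule env_unchanged[OF env1, of ?v]) (auto simp: unchanged_def)
      have v2: "reg ?s2 ''v'' = 0" by simp
      show "wp (extend_prog cn ;; emit_prog) ?s2 (extend_cost + (3 + nv * 4)) ?Q"
      proof (rule wp_Seq_silent, rule ex_conseq[OF extend_any[OF env2 v2] order_refl])
        fix s3 assume sol: "solution cn (members s3)" and un3: "unchanged (extend_prog cn) ?s2 s3"
        have env3: "env s3" by (rule env_unchanged[OF env2 un3]) (auto simp: graph_arrays_def)
        show "wp emit_prog s3 (3 + nv * 4) ?Q"
          by (rule wp_conseq[OF emit_correct[OF env3] order_refl]) (use sol in auto)
      qed
    qed auto
  qed
  then obtain t s' S where t: "exec (first_prog cn) ?s t s'"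
    "length t \<le> setup_cost + (1 + (extend_cost + (3 + nv * 4)))" "solution cn S" "visible t = written [listed S]"
    unfolding wp_def by blast
  have "outputs (first_prog cn) (encode_graph G) t [S]"
    unfolding outputs_def items_written(1)[OF t(4)] run_def
    using t(1) items_written(2)[OF t(4)] distinct_listed set_listed[OF solution_bound[OF t(3)]] by auto
  then show ?thesis using t by blast
qed

lemma search_correct:
  assumes S: "solution cn S"
  shows "\<exists>t s'. exec (search_prog cn) (given_state G S) t s' \<and>
     length t \<le> setup_cost + neighbors_bound (3 + nv * 4) \<and>
     output_words (last (segments t)) = [] \<and> (\<forall>xs\<in>set (items t). distinct xs) \<and>
     neighborhood cn S (set ` set (items t))"
proof -
  let ?s = "given_state G S"
  have Sn: "S \<subseteq> {..<nv}" by (rule solution_bound[OF S])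
  interpret e: emitter nv "length es" "edges G" "neighbor_list es" cn emit_prog "3 + nv * 4" emitted "{}" "{}"
    by (rule emit_emitter)
  let ?Q = "\<lambda>t fs. \<exists>Ns. emitted t fs Ns \<and> neighborhood cn S (set Ns)"
  have "ex setup_prog ?s setup_cost env"
    by (rule setup_correct) (auto simp: given_state_def initial_def)
  then have "wp (search_prog cn) ?s (setup_cost + neighbors_bound (3 + nv * 4)) ?Q"
    unfolding search_prog_def
  proof (intro wp_Seq_silent, elim ex_conseq)
    fix s1 assume env: "env s1" and un: "unchanged setup_prog ?s s1"
    have mem: "arr s1 ''mem'' u = (if u \<in> S then 1 else 0)" for u
      using un by (simp add: unchanged_def given_state_def)
    have J: "emitted s1 [] []" by (auto simp: emitted_def written_def)
    have "S = stored s1" using Sn by (auto simp: stored_def mem)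
    then have "wp (neighbors_prog cn emit_prog) s1 (neighbors_bound (3 + nv * 4))
       (\<lambda>t fs. \<exists>Ns. emitted t ([] @ fs) ([] @ Ns) \<and> neighborhood cn S (set Ns))"
      using e.neighbors_correct[OF env J _ _ S] by (simp add: mem e.neighbors_cost_eq)
    then show "wp (neighbors_prog cn emit_prog) s1 (neighbors_bound (3 + nv * 4)) ?Q" by simp
  qed simp
  then obtain t s' Ns where t: "exec (search_prog cn) ?s t s'"
    "length t \<le> setup_cost + neighbors_bound (3 + nv * 4)" "emitted s' (visible t) Ns"
    "neighborhood cn S (set Ns)" unfolding wp_def by blast
  obtain xss where xss: "visible t = written xss" "map set xss = Ns" "\<forall>xs\<in>set xss. distinct xs"
    using t(3) by (auto simp: emitted_def)
  have "set ` set (items t) = set Ns" unfolding items_written(1)[OF xss(1)] using xss(2) by auto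
  then show ?thesis using t xss items_written[OF xss(1)] by auto
qed

lemma neighbor_sets_correct:
  assumes S: "solution cn S" and xs: "set xs = S" "distinct xs"
  shows "\<exists>t Ss. outputs (read_prog ;; search_prog cn) (encode_graph G @ length xs # xs) t Ss \<and>
       set Ss = neighbor_sets cn G S \<and>
       length t \<le> 6 + nv * 4 + setup_cost + neighbors_bound (3 + nv * 4)"
    and "neighborhood cn S (neighbor_sets cn G S)"
proof -
  obtain t s' where t: "exec (search_prog cn) (given_state G S) t s'"
     "length t \<le> setup_cost + neighbors_bound (3 + nv * 4)"
     "output_words (last (segments t)) = []" "\<forall>xs\<in>set (items t). distinct xs"
     "neighborhood cn S (set ` set (items t))"
    using search_correct[OF S] by (elim exE conjE) (rule that)
  have det: "u = t" if "exec (search_prog cn) (given_state G S) u u'" for u u'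
    using exec_deterministic[OF that t(1)] by simp
  have eq: "neighbor_sets cn G S = set ` set (items t)"
    unfolding neighbor_sets_def using t(1) det by blast
  then show "neighborhood cn S (neighbor_sets cn G S)" using t(5) by simp
  let ?ws = "encode_graph G @ length xs # xs"
  obtain t0 where t0: "exec read_prog (initial ?ws) t0 (given_state G S)" "length t0 \<le> 6 + card S * 4" "visible t0 = []"
    using read_correct[OF xs, of G] unfolding ex_def wp_def by auto
  have "card S \<le> nv" using card_mono[OF _ solution_bound[OF S]] by simp
  then have len: "length (t0 @ t) \<le> 6 + nv * 4 + setup_cost + neighbors_bound (3 + nv * 4)"
    using t0(2) t(2) by simp
  have run: "run (read_prog ;; search_prog cn) ?ws (t0 @ t)"
    unfolding run_def using exec.Seq[OF t0(1) t(1)] by blast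
  \<comment> \<open>Reading is silent, so it lengthens the first segment and leaves the items
    unchanged.\<close>
  have "segments (t0 @ t) = (t0 @ hd (segments t)) # tl (segments t)"
    using t0(3) by (intro segments_silent) simp
  then have w: "map output_words (segments (t0 @ t)) = map output_words (segments t)"
    using segments_visible[of t0] segments_visible[of "t0 @ t"] segments_visible[of t] t0(3) by simp
  then have items: "items (t0 @ t) = items t" by (metis items_def map_butlast)
  have "output_words (last (segments (t0 @ t))) = output_words (last (segments t))"
    using w by (metis last_map segments_nonempty)
  then have "outputs (read_prog ;; search_prog cn) ?ws (t0 @ t) (map set (items t))"
    unfolding outputs_def items using run t(3,4) by simp
  moreover have "set (map set (items t)) = neighbor_sets cn G S" by (simp add: eq)
  ultimately show "\<exists>t Ss. outputs (read_prog ;; search_prog cn) ?ws t Ss \<and>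
       set Ss = neighbor_sets cn G S \<and>
       length t \<le> 6 + nv * 4 + setup_cost + neighbors_bound (3 + nv * 4)"
    using len by blast
qed

section \<open>Numerical bounds: polynomial time and delay\<close>

lemma edges_le_square: "length es \<le> nv * nv"
proof -
  have "distinct es" using simple by (simp add: simple_graph_def distinct_map)
  then have "length es = card (set es)" by (simp add: distinct_card)
  also have "\<dots> \<le> card ({..<nv} \<times> {..<nv})" using edge_props by (intro card_mono) auto
  finally show ?thesis by simp
qed

lemma extend_cost_le: "extend_cost \<le> 240 * W ^ 2"
proof -
  have "240 * Suc nv * W \<le> 240 * W * W" by (intro mult_le_mono) (auto simp: W_def)
  then show ?thesis by (simp add: extend_cost_def power2_eq_square mult.assoc)
qed

lemma neighbors_bound_le: "ke \<le> 11 * W \<Longrightarrow> neighbors_bound ke \<le> 400 * W ^ 3"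
proof -
  assume ke: "ke \<le> 11 * W"
  have W1: "1 \<le> W" "n \<le> W" if "n = nv" for n using that by (auto simp: W_def)
  have WW: "W \<le> W * W" using W1(1) by simp
  have "extend_cost + ke + 4 * nv + 124 \<le> 240 * (W * W) + 11 * W + 4 * W + 124 * W"
    using extend_cost_le ke W1[of nv] by (simp add: power2_eq_square)
  also have "\<dots> \<le> 400 * (W * W)" using WW by simp
  finally have "neighbors_bound ke \<le> W * (400 * (W * W))"
    unfolding neighbors_bound_def by (rule mult_le_mono2)
  then show ?thesis by (simp add: power3_eq_cube)
qed

lemma W_le: "W \<le> 1 + nv + 2 * nv ^ 2"
  using edges_le_square by (simp add: W_def power2_eq_square)

lemma powers_W: "1 \<le> W" "W \<le> W ^ 3" "W ^ 2 \<le> W ^ 3"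
  by (auto simp: W_def power3_eq_cube power2_eq_square)

text \<open>Every vertex has degree at least 1, so \<open>n\<close> is at most \<open>2 * m\<close>
  and \<open>W\<close> at most \<open>5 * m\<close>. An extension then costs at most
  \<open>2400 * m * n\<close>, an expansion needs at most \<open>5 * m\<close> of them, and the rest
  fits between 12000 and 16000.\<close>

lemma linear_delay:
  assumes "no_isolated_vertices G"
  shows "delay_bound \<le> 16000 * (length es ^ 2 * nv + 1)"
proof -
  define m where "m = length es"
  have "1 \<le> length (neighbor_list es u)" if u: "u < nv" for u
  proof -
    obtain e where e: "e \<in> edges G" "u \<in> e"
      using assms u by (auto simp: no_isolated_vertices_def verts_def)
    then obtain v where "e = {u, v}" "u \<noteq> v" using E[OF e(1)] by auto
    then have "v \<in> set (neighbor_list es u)" using e(1) set_nb[OF u] by (simp add: adj_def)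
    then show ?thesis by (cases "neighbor_list es u") auto
  qed
  then have "(\<Sum>u<nv. 1) \<le> (\<Sum>u<nv. length (neighbor_list es u))" by (intro sum_mono) auto
  then have nm: "nv \<le> 2 * m" by (simp add: handshake m_def)
  show ?thesis
  proof (cases "nv = 0")
    case True
    \<comment> \<open>Without vertices the product is 0 and only the summand 1 is left; all costs
      are constants there.\<close>
    then have "W = 1" using handshake unfolding W_def by simp
    then show ?thesis using True
      unfolding delay_bound_def setup_cost_def extend_cost_def visit_bound_def neighbors_bound_def
      by simp
  next
    case False
    define p where "p = m * m * nv"
    have pos: "1 \<le> nv" "1 \<le> m" using False nm by auto
    have W5: "W \<le> 5 * m" using nm pos by (simp add: W_def m_def)
    have p1: "m * nv \<le> p" using pos by (simp add: p_def)
    have p2: "m \<le> m * nv" "nv \<le> m * nv" "1 \<le> m * nv" using pos by auto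
    have p3: "m * m \<le> p" "m \<le> p" "nv \<le> p" "1 \<le> p"
      using pos p1 p2 by (auto simp: p_def intro: order_trans)
    have ext: "extend_cost \<le> 2400 * (m * nv)"
    proof -
      have "extend_cost \<le> 240 * (2 * nv) * (5 * m)"
        unfolding extend_cost_def using pos W5 by (intro mult_le_mono) auto
      then show ?thesis by (simp add: mult_ac)
    qed
    have "record_bound \<le> (5 * m) * (2400 * (m * nv) + 131 + 8 * nv)"
      unfolding neighbors_bound_def using W5 ext by (intro mult_le_mono) auto
    also have "\<dots> = 12000 * p + 655 * m + 40 * (m * nv)" by (simp add: p_def algebra_simps)
    finally have "record_bound \<le> 12000 * p + 655 * m + 40 * (m * nv)" .
    then have "delay_bound \<le> 16000 * p"
      using p1 p3 ext W5 unfolding delay_bound_def setup_cost_def visit_bound_def by linarith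
    then show ?thesis by (simp add: p_def m_def power2_eq_square)
  qed
qed

end

definition problem :: "bool \<Rightarrow> Defs.graph listing_problem" where
  "problem cn = \<lparr>instances = {G. simple_graph G \<and> no_isolated_vertices G},
      encode = encode_graph, universe = verts,
      solutions = (\<lambda>G. {S. inclusion_maximal (feasible cn (verts G) (edges G)) S})\<rparr>"

lemma max_chordal_problem_eq: "max_chordal_problem = problem False"
proof -
  have "feasible False V E = induced_chordal V E" for V and E :: "nat set set"
    by (auto simp: feasible_def conn_if_def fun_eq_iff)
  then show ?thesis by (simp add: max_chordal_problem_def problem_def)
qed

lemma max_connected_chordal_problem_eq: "max_connected_chordal_problem = problem True"
proof -
  have "feasible True V E = connected_induced_chordal V E" for V and E :: "nat set set"
    by (auto simp: feasible_def connected_induced_chordal_def conn_if_def fun_eq_iff)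
  then show ?thesis by (simp add: max_connected_chordal_problem_def problem_def)
qed

lemma (in graph_instance) solutions_eq: "solutions (problem cn) G = Collect (solution cn)"
  by (auto simp: problem_def solution_def verts_def)

text \<open>\<open>1 + n + 2 * n ^ 2\<close> bounds \<open>W\<close>, since \<open>m\<close> is at
  most \<open>n ^ 2\<close>; an expansion takes time of order \<open>W ^ 3\<close>.\<close>

definition size_poly :: "nat poly" where
  "size_poly = [:1000:] * [:1, 1, 2:] ^ 3"

lemma (in graph_instance) size_poly_bound: "k \<le> 1000 * W ^ 3 \<Longrightarrow> k \<le> poly size_poly (card (verts G))"
proof -
  assume "k \<le> 1000 * W ^ 3"
  also have "\<dots> \<le> 1000 * (1 + nv + 2 * nv ^ 2) ^ 3" using W_le by (simp add: power_mono)
  also have "1 + nv + 2 * nv ^ 2 = poly [:1, 1, 2:] nv" by (simp add: power2_eq_square algebra_simps)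
  also have "1000 * poly [:1, 1, 2:] nv ^ 3 = poly size_poly (card (verts G))"
    by (simp add: size_poly_def verts_def)
  finally show ?thesis .
qed

lemma problem_listable:
  "listable_with_delay (problem cn) (\<lambda>G. card (edges G) ^ 2 * card (verts G))"
  unfolding listable_with_delay_def
proof (intro exI[of _ "list_prog cn"] exI[of _ 16000] ballI)
  fix G assume "G \<in> instances (problem cn)"
  then have G: "simple_graph G" "no_isolated_vertices G" by (auto simp: problem_def)
  interpret graph_instance G by standard (rule G(1))
  obtain t Ss where t: "outputs (list_prog cn) (encode_graph G) t Ss" "distinct Ss"
    "set Ss = Collect (solution cn)" "delay t \<le> delay_bound" using list_prog_correct by blast
  have "delay t \<le> 16000 * (card (edges G) ^ 2 * card (verts G) + 1)"
    using order_trans[OF t(4) linear_delay[OF G(2)]] by (simp add: card_edges verts_def)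
  moreover have "encode (problem cn) G = encode_graph G" by (simp add: problem_def)
  ultimately show "\<exists>t Ss. outputs (list_prog cn) (encode (problem cn) G) t Ss \<and> distinct Ss \<and>
      set Ss = solutions (problem cn) G \<and> delay t \<le> 16000 * (card (edges G) ^ 2 * card (verts G) + 1)"
    using t(1-3) unfolding solutions_eq by metis
qed

lemma problem_proximity_searchable: "proximity_searchable (problem cn)"
  unfolding proximity_searchable_def
proof (intro conjI exI[of _ "\<lambda>G. proximity cn (edges G)"] exI[of _ "neighbor_sets cn"] ballI impI)
  show "one_solution_in_polytime (problem cn)"
    unfolding one_solution_in_polytime_def
  proof (intro exI[of _ "first_prog cn"] exI[of _ size_poly] ballI)
    fix G assume "G \<in> instances (problem cn)"
    then have "simple_graph G" by (simp add: problem_def)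
    then interpret graph_instance G by (rule graph_instance.intro)
    obtain t S where t: "solution cn S" "outputs (first_prog cn) (encode_graph G) t [S]"
      "length t \<le> setup_cost + (1 + (extend_cost + (3 + nv * 4)))" using first_correct by blast
    have "nv \<le> W" by (simp add: W_def)
    then have "setup_cost + (1 + (extend_cost + (3 + nv * 4))) \<le> 1000 * W ^ 3"
      using powers_W extend_cost_le unfolding setup_cost_def by linarith
    then have "length t \<le> poly size_poly (card (verts G))" using t(3) by (intro size_poly_bound) simp
    then show "\<exists>t. \<exists>S\<in>solutions (problem cn) G. outputs (first_prog cn) (encode (problem cn) G) t [S] \<and>
       length t \<le> poly size_poly (card (universe (problem cn) G))"
      using t unfolding solutions_eq by (auto simp: problem_def)
  qed
next
  show "neighbors_in_polytime (problem cn) (neighbor_sets cn)"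
    unfolding neighbors_in_polytime_def
  proof (intro exI[of _ "read_prog ;; search_prog cn"] exI[of _ size_poly] ballI allI impI)
    fix G S xs assume G: "G \<in> instances (problem cn)" and S: "S \<in> solutions (problem cn) G"
      and xs: "set xs = S \<and> distinct xs"
    have "simple_graph G" using G by (simp add: problem_def)
  then interpret graph_instance G by (rule graph_instance.intro)
    have "solution cn S" using S unfolding solutions_eq by simp
    then obtain t Ss where t: "outputs (read_prog ;; search_prog cn) (encode_graph G @ length xs # xs) t Ss"
      "set Ss = neighbor_sets cn G S" "length t \<le> 6 + nv * 4 + setup_cost + neighbors_bound (3 + nv * 4)"
      using neighbor_sets_correct(1) xs by blast
    have "nv \<le> W" by (simp add: W_def)
    then have "6 + nv * 4 + setup_cost + neighbors_bound (3 + nv * 4) \<le> 1000 * W ^ 3"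
      using powers_W neighbors_bound_le[of "3 + nv * 4"] unfolding setup_cost_def by linarith
    then have "length t \<le> poly size_poly (card (verts G))" using t(3) by (intro size_poly_bound) simp
    then show "\<exists>t Ss. outputs (read_prog ;; search_prog cn) (encode (problem cn) G @ length xs # xs) t Ss \<and>
       set Ss = neighbor_sets cn G S \<and> length t \<le> poly size_poly (card (universe (problem cn) G))"
      using t by (auto simp: problem_def)
  qed
next
  fix G S S' assume G: "G \<in> instances (problem cn)" and S: "S \<in> solutions (problem cn) G" "S' \<in> solutions (problem cn) G"
  have "simple_graph G" using G by (simp add: problem_def)
  then interpret graph_instance G by (rule graph_instance.intro)
  have sol: "solution cn S" "solution cn S'" using S unfolding solutions_eq by auto
  show "proximity cn (edges G) S S' \<subseteq> universe (problem cn) G"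
    using solution_bound[OF sol(2)] by (auto simp: problem_def proximity_def verts_def)
  obtain xs where xs: "set xs = S" "distinct xs"
    using finite_distinct_list[of S] finite_subset[OF solution_bound[OF sol(1)]] by auto
  assume "S \<noteq> S'"
  then show "\<exists>R\<in>neighbor_sets cn G S. card (proximity cn (edges G) S S') < card (proximity cn (edges G) R S')"
    using neighborhood_proximity[OF neighbor_sets_correct(2)[OF sol(1) xs] sol] by blast
next
  fix G S assume G: "G \<in> instances (problem cn)" and S: "S \<in> solutions (problem cn) G"
  have "simple_graph G" using G by (simp add: problem_def)
  then interpret graph_instance G by (rule graph_instance.intro)
  have sol: "solution cn S" using S unfolding solutions_eq by auto
  obtain xs where xs: "set xs = S" "distinct xs"
    using finite_distinct_list[of S] finite_subset[OF solution_bound[OF sol]] by auto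
  show "neighbor_sets cn G S \<subseteq> solutions (problem cn) G"
    using neighbor_sets_correct(2)[OF sol xs] unfolding solutions_eq by (simp add: neighborhood_def)
qed

theorem theorem7p3:
  shows "proximity_searchable max_chordal_problem
    \<and> proximity_searchable max_connected_chordal_problem
    \<and> listable_with_delay max_chordal_problem
        (\<lambda>G. card (edges G) ^ 2 * card (verts G))
    \<and> listable_with_delay max_connected_chordal_problem
        (\<lambda>G. card (edges G) ^ 2 * card (verts G))"
  unfolding max_chordal_problem_eq max_connected_chordal_problem_eq
  using problem_proximity_searchable problem_listable by blast

end
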